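(* Let $q$ be a fixed power of an odd prime, and let $EX_n$ denote $\frac12$ of the sum of the average of $X_n$ over $O^+(n,q)$ and the average of $X_n$ over $O^-(n,q)$. Then, as $n\to\infty$, $$EX_n=\tfrac32\log(n)+O(1).$$
   Context: Let $\delta$ be a non-square in $F_q$. For $n=2l+1$ odd, $O^+(n,q)$ and $O^-(n,q)$ are the subgroups of $GL(n,q)$ preserving the non-degenerate symmetric bilinear forms with matrices $A$ and $\delta A$ respectively, where $A$ is the orthogonal sum of $(1)$ and $\begin{pmatrix}0_l & I_l \\ I_l & 0_l\end{pmatrix}$ (the two groups are isomorphic). For $n=2l$ even, $O^+(n,q)$ preserves the form with matrix $\begin{pmatrix}0_l & I_l \\ I_l & 0_l\end{pmatrix}$ and $O^-(n,q)$ the form which is the orthogonal sum of $\begin{pmatrix}0_{l-1} & I_{l-1} \\ I_{l-1} & 0_{l-1}\end{pmatrix}$ and $\mathrm{diag}(1,-\delta)$. For $\alpha\in O^\pm(n,q)$, $X_n(\alpha)$ is the number of irreducible polynomials over $F_q$ counted with multiplicity occurring in the canonical form of $\alpha$; that is, the number of irreducible factors over $F_q$, counted with multiplicity, of the characteristic polynomial of $\alpha$. The $O(1)$ constant may depend on $q$. *)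

theory Defs
  imports
    Complex_Main
    "HOL-Library.Landau_Symbols"
    "HOL-Library.Cardinality"
    "HOL-Computational_Algebra.Polynomial_Factorial"
    "Jordan_Normal_Form.Char_Poly"
begin

definition hyperbolic_mat :: "nat \<Rightarrow> 'a :: field mat" where
  "hyperbolic_mat l = four_block_mat (0\<^sub>m l l) (1\<^sub>m l) (1\<^sub>m l) (0\<^sub>m l l)"

definition bilin_form :: "'a :: field mat \<Rightarrow> 'a vec \<Rightarrow> 'a vec \<Rightarrow> 'a" where
  "bilin_form J v w = v \<bullet> (J *\<^sub>v w)"

definition isometry_group :: "nat \<Rightarrow> 'a :: field mat \<Rightarrow> 'a mat set" where
  "isometry_group n J = {A \<in> carrier_mat n n. invertible_mat A \<and>
     (\<forall>v \<in> carrier_vec n. \<forall>w \<in> carrier_vec n.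
        bilin_form J (A *\<^sub>v v) (A *\<^sub>v w) = bilin_form J v w)}"

definition plus_form_mat :: "nat \<Rightarrow> 'a :: field mat" where
  "plus_form_mat n =
     (if odd n then diag_block_mat [1\<^sub>m 1, hyperbolic_mat (n div 2)]
      else hyperbolic_mat (n div 2))"

text \<open>The intended range is \<open>n \<ge> 1\<close>. For \<open>n = 0\<close> the subtraction truncates and the
  matrix below does not have size \<open>0\<close>; only large \<open>n\<close> matter in what follows.\<close>

definition minus_form_mat :: "'a :: field \<Rightarrow> nat \<Rightarrow> 'a mat" where
  "minus_form_mat \<delta> n =
     (if odd n then \<delta> \<cdot>\<^sub>m plus_form_mat n
      else diag_block_mat
             [hyperbolic_mat (n div 2 - 1), mat_of_rows_list 2 [[1, 0], [0, - \<delta>]]])"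

definition O_plus :: "nat \<Rightarrow> 'a :: field mat set" where
  "O_plus n = isometry_group n (plus_form_mat n)"

definition O_minus :: "'a :: field \<Rightarrow> nat \<Rightarrow> 'a mat set" where
  "O_minus \<delta> n = isometry_group n (minus_form_mat \<delta> n)"

text \<open>Irreducible factors are taken up to associates, represented by monic polynomials,
  and each is counted with its multiplicity in \<open>f\<close>. The library constant for multiplicity has
  this same defining expression, but needs a sort on the coefficients stronger than \<open>field\<close>.\<close>

definition num_irreducible_factors :: "'a :: field poly \<Rightarrow> nat" where
  "num_irreducible_factors f =
     (\<Sum>p \<in> {p. monic p \<and> irreducible p \<and> p dvd f}. Max {m. p ^ m dvd f})"

definition num_factors_char_poly :: "'a :: field mat \<Rightarrow> nat" where
  "num_factors_char_poly A = num_irreducible_factors (char_poly A)"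

definition average :: "('b \<Rightarrow> nat) \<Rightarrow> 'b set \<Rightarrow> real" where
  "average f S = (\<Sum>x \<in> S. real (f x)) / real (card S)"

definition mean_X :: "'a :: field \<Rightarrow> nat \<Rightarrow> real" where
  "mean_X \<delta> n = 1 / 2 *
     (average num_factors_char_poly (O_plus n :: 'a mat set) +
      average num_factors_char_poly (O_minus \<delta> n))"

end

theory Submission
  imports Defs "HOL-Library.Function_Algebras"
begin

text \<open>The argument avoids conjugacy classes. Let \<open>G\<close> be the isometry group of a non-degenerate
  symmetric form on \<open>V\<close> of dimension \<open>n\<close>. Counting pairs \<open>(g, v)\<close> in which the polynomial \<open>f\<close> generates
  the annihilator of \<open>v\<close> under \<open>g\<close> amounts to counting \<open>G\<close>-orbits of tuples \<open>v, g v, g\<^sup>2 v, \<dots>\<close>;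
  by Witt's theorem these are separated by the Gram data \<open>B(g\<^sup>i v, v)\<close>. All Gram data vanish if \<open>f\<close> is a
  power of an irreducible that is not self-reciprocal, and the first half of them determines the rest
  if \<open>f\<close> is self-reciprocal. Hence the expected multiplicity \<open>E(\<phi>)\<close> of an irreducible \<open>\<phi>\<close> is at most
  \<open>w(\<phi>) + O(w(\<phi>)\<^sup>2)\<close>, where \<open>w(\<phi>) = q ^ - deg \<phi>\<close> if \<open>\<phi>\<close> is not self-reciprocal (then it occurs only
  if \<open>2 deg \<phi> \<le> n\<close>) and \<open>w(\<phi>) = q ^ - (deg \<phi> / 2)\<close> if it is, with the exceptions \<open>x - 1\<close> and \<open>x + 1\<close>,
  for which \<open>E(\<phi>) = O(1)\<close>.

  No separate lower bound is needed: the characteristic polynomial has degree \<open>n\<close>, so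
  \<open>\<Sum> deg \<phi> E(\<phi>) = n\<close>, while counting palindromic polynomials gives \<open>\<Sum> deg \<phi> w(\<phi>) \<le> n\<close>.
  So the total slack in the upper bounds is \<open>O(1)\<close>, and the expected number of factors is
  \<open>\<Sum> w(\<phi>) + O(1)\<close>. The same identities give \<open>\<Sum> deg \<phi> w(\<phi>) = D + O(1)\<close> over each of the two classes
  when \<open>w(\<phi>) \<ge> q ^ - D\<close>; by partial summation the irreducibles that are not self-reciprocal contribute
  \<open>ln n\<close> and the self-reciprocal ones \<open>ln n / 2\<close>.\<close>


section \<open>Irreducible factors and their multiplicity\<close>

text \<open>The passage from orbit counts to multiplicities is an estimate of sizes. If \<phi> has
  multiplicity m in the characteristic polynomial of g, the vectors killed by some power of
  \<phi>(g) number at least q ^ (m * deg \<phi>), and at least half of them have the highest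
  occurring power of \<phi> as annihilator. This controls m only up to a constant factor, which
  would spoil the coefficient 3/2. So the case m = 1 is charged exactly w(\<phi>) to leading order,
  and constants are lost only in terms of order w(\<phi>)^2, whose sum stays bounded even when
  weighted by the degree. For x - 1 and x + 1 the degree is odd, and rounding half the number of
  Gram entries up makes the orbit count q, so that E(\<phi>) is of order 1. The tuples may span
  degenerate, even totally isotropic subspaces, so Witt's theorem is proved for arbitrary
  independent families. Every non-degenerate symmetric form is treated at once, and each of the two
  averages obeys the estimate. The lower bound on the number of self-reciprocal irreducibles is
  itself read off from an orthogonal group, that of a hyperbolic form.\<close>

definition factor_mult :: "'a :: field poly \<Rightarrow> 'a poly \<Rightarrow> nat" where
  "factor_mult p f = Max {m. p ^ m dvd f}"

lemma irreducible_degree_pos: "irreducible (p :: 'a :: field poly) \<Longrightarrow> 0 < degree p"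
  by (metis irreducible_def is_unit_field_poly neq0_conv)

lemma pow_dvd_degree_le:
  fixes p f :: "'a :: field poly"
  assumes "irreducible p" "f \<noteq> 0" "p ^ m dvd f"
  shows "m * degree p \<le> degree f" "m \<le> degree f"
proof -
  have "p \<noteq> 0" using assms(1) by auto
  then have "degree (p ^ m) = m * degree p" by (simp add: degree_power_eq)
  then show 1: "m * degree p \<le> degree f" using dvd_imp_degree_le[OF assms(3,2)] by simp
  have "m * 1 \<le> m * degree p" using irreducible_degree_pos[OF assms(1)] by (intro mult_le_mono2) linarith
  with 1 show "m \<le> degree f" by linarith
qed

lemma pow_dvd_iff_le_factor_mult:
  fixes p f :: "'a :: field poly"
  assumes "irreducible p" "f \<noteq> 0"
  shows "p ^ m dvd f \<longleftrightarrow> m \<le> factor_mult p f"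
proof -
  let ?S = "{m. p ^ m dvd f}"
  have fin: "finite ?S"
    by (rule finite_subset[of _ "{..degree f}"]) (use pow_dvd_degree_le[OF assms] in auto)
  have "0 \<in> ?S" by simp
  then have "Max ?S \<in> ?S" using fin by (intro Max_in) blast+
  then have "p ^ factor_mult p f dvd f" by (simp add: factor_mult_def)
  then have "m \<le> factor_mult p f \<Longrightarrow> p ^ m dvd f" by (meson dvd_trans le_imp_power_dvd)
  moreover have "p ^ m dvd f \<Longrightarrow> m \<le> factor_mult p f" using fin by (auto simp: factor_mult_def intro: Max_ge)
  ultimately show ?thesis by blast
qed

lemma factor_mult_eqI:
  fixes p f :: "'a :: field poly"
  assumes "irreducible p" "f \<noteq> 0" "\<And>m. p ^ m dvd f \<longleftrightarrow> m \<le> k"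
  shows "factor_mult p f = k"
  using pow_dvd_iff_le_factor_mult[OF assms(1,2)] assms(3) by (metis le_antisym order_refl)

lemma factor_mult_eq_0_iff:
  fixes p f :: "'a :: field poly"
  assumes "irreducible p" "f \<noteq> 0"
  shows "factor_mult p f = 0 \<longleftrightarrow> \<not> p dvd f"
  using pow_dvd_iff_le_factor_mult[OF assms, of 1] by auto

lemma prime_elem_power_dvd_cancel:
  fixes p :: "'a :: idom"
  assumes "prime_elem p" "\<not> p dvd a" "p ^ m dvd a * g"
  shows "p ^ m dvd g"
  using assms(3)
proof (induction m)
  case (Suc m)
  then have "p ^ m dvd g" by (metis dvd_trans le_imp_power_dvd lessI less_imp_le)
  then obtain h where h: "g = p ^ m * h" by blast
  from Suc.prems have "p ^ m * p dvd p ^ m * (a * h)" by (simp add: h ac_simps)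
  then have "p dvd a * h" using assms(1) by (simp add: prime_elem_def)
  then have "p dvd h" using assms by (simp add: prime_elem_dvd_mult_iff)
  then show ?case by (simp add: h mult.commute)
qed simp

lemma monic_irreducible_dvd_eq:
  fixes p r :: "'a :: field poly"
  assumes "irreducible p" "monic p" "irreducible r" "monic r" "p dvd r"
  shows "p = r"
proof -
  obtain c where c: "r = p * c" using assms(5) by blast
  with assms(1,3) have "is_unit c" by (metis irreducible_altdef irreducible_not_unit c dvd_triv_left irreducibleD)
  then obtain b where "c = [:b:]" by (metis is_unit_field_poly degree_eq_zeroE)
  with c assms(2,4) show ?thesis by (metis lead_coeff_mult lead_coeff_pCons(2) mult_1 one_pCons mult.right_neutral)
qed

lemma monic_irreducible_divisor:
  fixes f :: "'a :: field poly"
  assumes "0 < degree f"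
  obtains p where "irreducible p" "monic p" "p dvd f"
proof -
  obtain p where p: "irreducible p" "p dvd f"
    using assms
  proof (induction "degree f" arbitrary: f thesis rule: less_induct)
    case less
    show ?case
    proof (cases "irreducible f")
      case True then show ?thesis using less.prems(1)[of f] by simp
    next
      case False
      have "f \<noteq> 0" "\<not> is_unit f" using less.prems by (auto simp: is_unit_field_poly)
      with False obtain a b where ab: "f = a * b" "\<not> is_unit a" "\<not> is_unit b"
        by (auto simp: irreducible_def)
      with \<open>f \<noteq> 0\<close> have "a \<noteq> 0" "b \<noteq> 0" by auto
      then have "degree a < degree f" "0 < degree a" using ab by (auto simp: is_unit_field_poly degree_mult_eq)
      then show ?thesis using less.hyps[of a] less.prems ab by (metis dvd_mult2)
    qed
  qed
  define c where "c = inverse (lead_coeff p)"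
  have nz: "lead_coeff p \<noteq> 0" using p(1) by auto
  have eq: "Polynomial.smult c p = p * [:c:]" by simp
  have "irreducible (Polynomial.smult c p)" unfolding eq using p(1) nz
    by (subst irreducible_mult_unit_right) (auto simp: c_def is_unit_field_poly)
  moreover have "monic (Polynomial.smult c p)" using nz by (simp add: c_def)
  moreover have "Polynomial.smult c p dvd f" using p(2) nz by (simp add: c_def smult_dvd)
  ultimately show ?thesis using that by blast
qed

text \<open>Splitting off one monic irreducible divisor \<open>r\<close> raises the multiplicity of
  \<open>r\<close> by one and changes no other. The index set \<open>S\<close> may be larger than
  the set of divisors, so that one set serves all polynomials of bounded degree and sums over
  polynomials and over irreducibles can be interchanged.\<close>

lemma sum_degree_mult:
  fixes f :: "'a :: field poly"
  assumes "finite S" "\<And>p. p \<in> S \<Longrightarrow> irreducible p \<and> monic p"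
    and "f \<noteq> 0" "\<And>p. irreducible p \<Longrightarrow> monic p \<Longrightarrow> p dvd f \<Longrightarrow> p \<in> S"
  shows "(\<Sum>p\<in>S. degree p * factor_mult p f) = degree f"
  using assms(3,4)
proof (induction "degree f" arbitrary: f rule: less_induct)
  case less
  show ?case
  proof (cases "degree f = 0")
    case True
    then have "factor_mult p f = 0" if "p \<in> S" for p
      using that assms(2) less.prems irreducible_degree_pos dvd_imp_degree_le factor_mult_eq_0_iff
      by (metis le_zero_eq neq0_conv)
    with True show ?thesis by simp
  next
    case False
    then obtain r where r: "irreducible r" "monic r" "r dvd f"
      using monic_irreducible_divisor by blast
    then obtain g where g: "f = r * g" by blast
    have g0: "g \<noteq> 0" "r \<noteq> 0" using g less.prems by auto
    have rS: "r \<in> S" using r less.prems by blast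
    have deg: "degree f = degree r + degree g" using g g0 by (simp add: degree_mult_eq)
    have IH: "(\<Sum>p\<in>S. degree p * factor_mult p g) = degree g"
      by (rule less.hyps) (use deg irreducible_degree_pos[OF r(1)] g0 g less.prems in auto)
    have m: "factor_mult p f = factor_mult p g + (if p = r then 1 else 0)" if "p \<in> S" for p
    proof (rule factor_mult_eqI)
      show "irreducible p" using that assms(2) by blast
      show "f \<noteq> 0" by fact
      fix m
      have iff: "p ^ m dvd g \<longleftrightarrow> m \<le> factor_mult p g" for m
        using pow_dvd_iff_le_factor_mult g0 that assms(2) by blast
      show "p ^ m dvd f \<longleftrightarrow> m \<le> factor_mult p g + (if p = r then 1 else 0)"
      proof (cases "p = r")
        case True
        show ?thesis
        proof (cases m)
          case (Suc k)
          then show ?thesis using True g g0 iff[of k] by simp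
        qed simp
      next
        case False
        have pp: "irreducible p" "monic p" using that assms(2) by auto
        have "\<not> p dvd r" using monic_irreducible_dvd_eq[OF pp r(1,2)] False by blast
        then have "p ^ m dvd f \<longleftrightarrow> p ^ m dvd g"
          using prime_elem_power_dvd_cancel[of p r m g] field_poly_irreducible_imp_prime[OF pp(1)] g
          by (metis dvd_mult)
        then show ?thesis using iff False by simp
      qed
    qed
    have "(\<Sum>p\<in>S. degree p * factor_mult p f) = (\<Sum>p\<in>S. degree p * factor_mult p g + (if p = r then degree r else 0))"
      by (rule sum.cong) (auto simp: m)
    also have "\<dots> = degree g + degree r" using IH rS assms(1) by (simp add: sum.distrib sum.delta)
    finally show ?thesis using deg by simp
  qed
qed

section \<open>Numbers of monic and of palindromic polynomials\<close>

definition monic_polys :: "nat \<Rightarrow> 'a :: field poly set" where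
  "monic_polys n = {f. monic f \<and> degree f = n}"

lemma
  shows finite_monic_polys: "finite (monic_polys n :: 'a :: {field, finite} poly set)"
    and card_monic_polys: "card (monic_polys n :: 'a poly set) = CARD('a) ^ n"
proof (induction n)
  case 0
  have "(monic_polys 0 :: 'a poly set) = {1}"
    unfolding monic_polys_def by (auto elim: degree_eq_zeroE)
  then show "finite (monic_polys 0 :: 'a poly set)" "card (monic_polys 0 :: 'a poly set) = CARD('a) ^ 0"
    by simp_all
next
  case (Suc n)
  let ?h = "\<lambda>(a, p). pCons a p :: 'a poly"
  have "(monic_polys (Suc n) :: 'a poly set) = ?h ` (UNIV \<times> monic_polys n)"
  proof (intro equalityI subsetI)
    fix f :: "'a poly" assume f: "f \<in> monic_polys (Suc n)"
    obtain a p where ap: "f = pCons a p" by (cases f)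
    with f have "p \<noteq> 0" by (auto simp: monic_polys_def)
    with f ap have "p \<in> monic_polys n" by (auto simp: monic_polys_def)
    with ap show "f \<in> ?h ` (UNIV \<times> monic_polys n)" by auto
  next
    fix f :: "'a poly" assume "f \<in> ?h ` (UNIV \<times> monic_polys n)"
    then obtain a p where ap: "f = pCons a p" "p \<in> monic_polys n" by auto
    then have "p \<noteq> 0" by (auto simp: monic_polys_def)
    with ap show "f \<in> monic_polys (Suc n)" by (auto simp: monic_polys_def)
  qed
  moreover have "inj_on ?h (UNIV \<times> monic_polys n)" by (auto simp: inj_on_def)
  ultimately show "finite (monic_polys (Suc n) :: 'a poly set)"
    "card (monic_polys (Suc n) :: 'a poly set) = CARD('a) ^ Suc n"
    using Suc by (simp_all add: card_image card_cartesian_product)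
qed

lemma card_monic_multiples:
  fixes p :: "'a :: {field, finite} poly"
  assumes "monic p"
  shows "card {f \<in> monic_polys n. p dvd f} = (if degree p \<le> n then CARD('a) ^ (n - degree p) else 0)"
proof (cases "degree p \<le> n")
  case False
  then have "{f \<in> monic_polys n. p dvd f} = {}"
    by (auto simp: monic_polys_def dest!: dvd_imp_degree_le)
  then show ?thesis using False by (simp only: card.empty if_False)
next
  case True
  have p0: "p \<noteq> 0" using assms by auto
  have "{f \<in> monic_polys n. p dvd f} = (*) p ` monic_polys (n - degree p)"
  proof (intro equalityI subsetI)
    fix f assume f: "f \<in> {f \<in> monic_polys n. p dvd f}"
    then obtain h where h: "f = p * h" by blast
    with f have "h \<noteq> 0" by (auto simp: monic_polys_def)
    moreover have "monic h" using f h assms by (simp add: monic_polys_def lead_coeff_mult)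
    ultimately have "h \<in> monic_polys (n - degree p)"
      using f h p0 by (auto simp: monic_polys_def degree_mult_eq)
    with h show "f \<in> (*) p ` monic_polys (n - degree p)" by blast
  next
    fix f assume "f \<in> (*) p ` monic_polys (n - degree p)"
    then obtain h where h: "f = p * h" "h \<in> monic_polys (n - degree p)" by blast
    then have "h \<noteq> 0" by (auto simp: monic_polys_def)
    have "monic h" using h by (auto simp: monic_polys_def)
    then have "monic f" using assms unfolding h(1) lead_coeff_mult by simp
    moreover have "degree f = n" using h \<open>h \<noteq> 0\<close> p0 True by (simp add: monic_polys_def degree_mult_eq)
    ultimately show "f \<in> {f \<in> monic_polys n. p dvd f}"
      using h by (simp add: monic_polys_def)
  qed
  moreover have "inj_on ((*) p) (monic_polys (n - degree p))" using p0 by (auto simp: inj_on_def)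
  ultimately show ?thesis using True card_monic_polys by (simp add: card_image)
qed

definition palindromes :: "nat \<Rightarrow> 'a :: field poly set" where
  "palindromes d = {f. monic f \<and> degree f = 2 * d \<and> reflect_poly f = f}"

lemma palindrome_coeff:
  assumes "f \<in> palindromes d" "i \<le> 2 * d"
  shows "coeff f (2 * d - i) = coeff f i"
  using assms by (metis (mono_tags, lifting) coeff_reflect_poly mem_Collect_eq not_less palindromes_def)

lemma finite_palindromes: "finite (palindromes d :: 'a :: {field, finite} poly set)"
  by (rule finite_subset[of _ "monic_polys (2 * d)"])
     (auto simp: palindromes_def monic_polys_def finite_monic_polys[unfolded monic_polys_def])

text \<open>Coefficients 1 to d are free; monicity makes the constant coefficient 1, and symmetry
  gives those above d.\<close>

lemma card_palindromes: "card (palindromes d :: 'a :: {field, finite} poly set) = CARD('a) ^ d"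
proof -
  let ?h = "\<lambda>f :: 'a poly. restrict (coeff f) {1..d}"
  let ?P = "PiE {1..d} (\<lambda>_. UNIV :: 'a set)"
  have inj: "inj_on ?h (palindromes d)"
  proof (rule inj_onI, rule poly_eqI)
    fix f g :: "'a poly" and i
    assume f: "f \<in> palindromes d" and g: "g \<in> palindromes d" and eq: "?h f = ?h g"
    have le: "coeff f i = coeff g i" if "i \<le> d" for i
    proof (cases "i = 0")
      case True
      moreover have "coeff f (2 * d) = 1" "coeff g (2 * d) = 1" using f g by (auto simp: palindromes_def)
      ultimately show ?thesis using palindrome_coeff[OF f, of 0] palindrome_coeff[OF g, of 0] by simp
    next
      case False
      then have "i \<in> {1..d}" using that by simp
      then show ?thesis using fun_cong[OF eq, of i] by simp
    qed
    consider "i \<le> d" | "d < i" "i \<le> 2 * d" | "2 * d < i" by linarith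
    then show "coeff f i = coeff g i"
    proof cases
      case 2
      then show ?thesis using palindrome_coeff[OF f, of i] palindrome_coeff[OF g, of i] le[of "2 * d - i"] by simp
    next
      case 3
      then show ?thesis using f g by (simp add: palindromes_def coeff_eq_0)
    qed (rule le)
  qed
  have "?h ` palindromes d = ?P"
  proof
    show "?P \<subseteq> ?h ` palindromes d"
    proof
      fix c assume c: "c \<in> ?P"
      define k where "k i = (if i = 0 \<or> i = 2 * d then 1 else if i \<le> d then c i else c (2 * d - i))" for i
      define f where "f = Poly (map k [0..<2 * d + 1])"
      have cf: "coeff f i = (if i \<le> 2 * d then k i else 0)" for i
        by (auto simp: f_def nth_default_def simp del: upt_Suc)
      have deg: "degree f = 2 * d"
      proof (rule antisym)
        show "degree f \<le> 2 * d" by (rule degree_le) (simp add: cf)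
        show "2 * d \<le> degree f" by (rule le_degree) (simp add: cf k_def)
      qed
      have "f \<in> palindromes d"
        unfolding palindromes_def
      proof (intro CollectI conjI poly_eqI)
        show "coeff (reflect_poly f) i = coeff f i" for i
        proof (cases "i \<le> 2 * d")
          case True
          consider "i = 0" | "i = d" | "0 < i" "i < d" | "d < i" "i < 2 * d" | "i = 2 * d" using True by linarith
          then have "k (2 * d - i) = k i" by cases (auto simp: k_def)
          with True show ?thesis by (simp add: coeff_reflect_poly deg cf)
        qed (simp add: coeff_reflect_poly deg cf)
      qed (simp_all add: deg cf k_def)
      moreover have "?h f = c"
        using c by (auto simp: cf k_def PiE_def extensional_def fun_eq_iff)
      ultimately show "c \<in> ?h ` palindromes d" by blast
    qed
  qed auto
  then have "card (palindromes d :: 'a poly set) = card ?P" using card_image[OF inj] by simp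
  then show ?thesis by (simp add: card_PiE)
qed

section \<open>Irreducible polynomials and reciprocity\<close>

definition irr_polys :: "nat \<Rightarrow> 'a :: field poly set" where
  "irr_polys d = {p. monic p \<and> irreducible p \<and> degree p = d}"

text \<open>\<open>reflect_poly p\<close> need not be monic, so equality up to a scalar is expressed
  by divisibility. The condition on the constant coefficient removes the polynomial x.\<close>

definition nonself_polys :: "nat \<Rightarrow> 'a :: field poly set" where
  "nonself_polys d = {p \<in> irr_polys d. coeff p 0 \<noteq> 0 \<and> \<not> p dvd reflect_poly p}"

text \<open>Indexed by half the degree, so that index d means weight q ^ - d here as well as in
  \<open>nonself_polys d\<close>.\<close>

definition self_polys :: "nat \<Rightarrow> 'a :: field poly set" where
  "self_polys d = {p \<in> irr_polys (2 * d). reflect_poly p = p}"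

lemma irr_polys_subset: "irr_polys d \<subseteq> monic_polys d"
  by (auto simp: irr_polys_def monic_polys_def)

lemma finite_irr_polys: "finite (irr_polys d :: 'a :: {field, finite} poly set)"
  using irr_polys_subset by (rule finite_subset) (rule finite_monic_polys)

lemma card_irr_polys_le: "card (irr_polys d :: 'a :: {field, finite} poly set) \<le> CARD('a) ^ d"
  using card_mono[OF finite_monic_polys irr_polys_subset] by (simp add: card_monic_polys)

lemma self_polys_subset: "self_polys d \<subseteq> palindromes d"
  by (auto simp: irr_polys_def palindromes_def self_polys_def)

lemma finite_self_polys: "finite (self_polys d :: 'a :: {field, finite} poly set)"
  using self_polys_subset by (rule finite_subset) (rule finite_palindromes)

lemma card_self_polys_le: "card (self_polys d :: 'a :: {field, finite} poly set) \<le> CARD('a) ^ d"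
  using card_mono[OF finite_palindromes self_polys_subset] by (simp add: card_palindromes)

lemma nonself_polys_subset: "nonself_polys d \<subseteq> irr_polys d"
  by (auto simp: nonself_polys_def)

lemma finite_nonself_polys: "finite (nonself_polys d :: 'a :: {field, finite} poly set)"
  using nonself_polys_subset by (rule finite_subset) (rule finite_irr_polys)

lemma card_nonself_polys_le: "card (nonself_polys d :: 'a :: {field, finite} poly set) \<le> CARD('a) ^ d"
  using card_mono[OF finite_irr_polys nonself_polys_subset] card_irr_polys_le by (rule order_trans)

text \<open>If p divides its reflection, the two differ by a scalar c; comparing the outer
  coefficients gives c^2 = 1. For c = -1 the value at 1 vanishes, and for c = 1 in odd degree the
  value at -1 vanishes, because 2 is invertible. What remains has even degree and equals its
  reflection.\<close>

lemma irr_polys_cases: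
  fixes p :: "'a :: field poly"
  assumes p: "p \<in> irr_polys d" and two: "(2 :: 'a) \<noteq> 0"
  obtains "p = [:0, 1:]" | "p = [:-1, 1:]" | "p = [:1, 1:]" | "p \<in> nonself_polys d"
    | e where "d = 2 * e" "p \<in> self_polys e"
proof -
  have irr: "irreducible p" "monic p" "degree p = d" using p by (auto simp: irr_polys_def)
  have lin: "p = [:- a, 1:]" if "poly p a = 0" for a
  proof -
    have "[:- a, 1:] dvd p" using that by (simp only: poly_eq_0_iff_dvd)
    moreover have "irreducible [:- a, 1:]" by (rule irreducible_linear_field_poly) simp
    ultimately show ?thesis using monic_irreducible_dvd_eq[of "[:- a, 1:]" p] irr by simp
  qed
  show ?thesis
  proof (cases "coeff p 0 = 0")
    case True
    then have "poly p 0 = 0" by (simp add: poly_0_coeff_0)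
    then show ?thesis using lin[of 0] that(1) by simp
  next
    case c0: False
    show ?thesis
    proof (cases "p dvd reflect_poly p")
      case False
      then show ?thesis using c0 p that(4) by (auto simp: nonself_polys_def)
    next
      case True
      then obtain r where r: "reflect_poly p = p * r" by blast
      have nz: "p \<noteq> 0" "reflect_poly p \<noteq> 0" using irr by auto
      then have "r \<noteq> 0" using r by auto
      have "degree (reflect_poly p) = degree p" using c0 by (rule degree_reflect_poly_eq)
      then have "degree r = 0" using r \<open>r \<noteq> 0\<close> nz by (simp add: degree_mult_eq)
      then obtain c where "r = [:c:]" by (elim degree_eq_zeroE)
      with r have rp: "reflect_poly p = Polynomial.smult c p" by simp
      have "coeff (reflect_poly p) d = coeff p 0" "coeff (reflect_poly p) 0 = 1"
        using irr by (simp_all add: coeff_reflect_poly)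
      then have "c = coeff p 0" "c * coeff p 0 = 1" using rp irr by auto
      then have "c ^ 2 = 1" by (simp add: power2_eq_square)
      then consider "c = 1" | "c = - 1" by (auto simp: power2_eq_1_iff)
      then show ?thesis
      proof cases
        case 2
        have "poly (reflect_poly p) 1 = poly p 1" by (simp add: poly_reflect_poly_nz)
        with rp 2 have "- poly p 1 = poly p 1" by simp
        then have "poly p 1 + poly p 1 = 0" by (simp only: neg_eq_iff_add_eq_0)
        then have "2 * poly p 1 = 0" by (simp only: mult_2)
        then show ?thesis using two lin[of 1] that(2) by simp
      next
        case 1
        then have rp: "reflect_poly p = p" using rp by simp
        show ?thesis
        proof (cases "even d")
          case True
          then obtain e where "d = 2 * e" by blast
          then show ?thesis using that(5)[of e] p rp by (auto simp: self_polys_def)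
        next
          case False
          have "poly (reflect_poly p) (-1) = (-1) ^ d * poly p (-1)" using irr by (simp add: poly_reflect_poly_nz)
          with rp False have "poly p (-1) = - poly p (-1)" by simp
          then have "poly p (-1) + poly p (-1) = 0" by (simp only: eq_neg_iff_add_eq_0)
          then have "2 * poly p (-1) = 0" by (simp only: mult_2)
          then show ?thesis using two lin[of "-1"] that(3) by simp
        qed
      qed
    qed
  qed
qed


section \<open>Counting irreducible polynomials by degree\<close>

lemma sum_linear_geometric: "(\<Sum>k=1..n. real k / 2 ^ k) \<le> 2"
proof -
  have "(\<Sum>k=1..n. real k / 2 ^ k) = 2 - (real n + 2) / 2 ^ n"
    by (induction n) (auto simp: field_simps)
  then show ?thesis by simp
qed

text \<open>Comparison with k / 2 ^ k after taking out x^2. The quadratic order in x is what makes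
  all contributions of higher powers of an irreducible summable.\<close>

lemma sum_linear_power_tail:
  fixes x :: real
  assumes "0 \<le> x" "x \<le> 1 / 2"
  shows "(\<Sum>k=2..n. real k * x ^ k) \<le> 8 * x\<^sup>2"
proof -
  have "(\<Sum>k=2..n. real k * x ^ k) \<le> (\<Sum>k=2..n. 4 * x\<^sup>2 * (real k / 2 ^ k))"
  proof (rule sum_mono)
    fix k assume k: "k \<in> {2..n}"
    have "x ^ k = x ^ (2 + (k - 2))" using k by (simp only: le_add_diff_inverse atLeastAtMost_iff)
    also have "\<dots> = x\<^sup>2 * x ^ (k - 2)" by (rule power_add)
    also have "\<dots> \<le> x\<^sup>2 * (1 / 2) ^ (k - 2)" using assms by (intro mult_left_mono power_mono) auto
    also have "\<dots> = 4 * x\<^sup>2 * (1 / 2 ^ k)" using k by (simp add: power_one_over power_diff)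
    finally have "real k * x ^ k \<le> real k * (4 * x\<^sup>2 * (1 / 2 ^ k))" by (rule mult_left_mono) simp
    then show "real k * x ^ k \<le> 4 * x\<^sup>2 * (real k / 2 ^ k)" by (simp add: mult_ac)
  qed
  also have "\<dots> = 4 * x\<^sup>2 * (\<Sum>k=2..n. real k / 2 ^ k)" by (simp add: sum_distrib_left)
  also have "\<dots> \<le> 4 * x\<^sup>2 * 2"
  proof (rule mult_left_mono)
    have "(\<Sum>k=2..n. real k / 2 ^ k) \<le> (\<Sum>k=1..n. real k / 2 ^ k)" by (rule sum_mono2) auto
    with sum_linear_geometric show "(\<Sum>k=2..n. real k / 2 ^ k) \<le> 2" by (rule order_trans[rotated])
  qed simp
  finally show ?thesis by simp
qed

lemma CARD_ge_2: "2 \<le> CARD('a :: {field, finite})"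
proof -
  have "card {0, 1 :: 'a} \<le> CARD('a)" by (intro card_mono) auto
  then show ?thesis by simp
qed

lemma sum_linear_inverse_power_le:
  assumes "2 \<le> q" shows "(\<Sum>k=1..n. real k / real q ^ k) \<le> 2"
proof -
  have "(\<Sum>k=1..n. real k / real q ^ k) \<le> (\<Sum>k=1..n. real k / 2 ^ k)"
    using assms by (intro sum_mono divide_left_mono power_mono) auto
  with sum_linear_geometric show ?thesis by (rule order_trans[rotated])
qed

definition irr_polys_upto :: "nat \<Rightarrow> 'a :: field poly set" where
  "irr_polys_upto n = (\<Union>d\<in>{1..n}. irr_polys d)"

lemma irr_polys_uptoD:
  "p \<in> irr_polys_upto n \<Longrightarrow> irreducible p \<and> monic p \<and> 1 \<le> degree p \<and> degree p \<le> n"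
  by (auto simp: irr_polys_upto_def irr_polys_def)

lemma irr_polys_uptoI:
  "irreducible p \<Longrightarrow> monic p \<Longrightarrow> degree p \<le> n \<Longrightarrow> p \<in> irr_polys_upto n"
  using irreducible_degree_pos[of p] by (auto simp: irr_polys_upto_def irr_polys_def)

lemma finite_irr_polys_upto: "finite (irr_polys_upto n :: 'a :: {field, finite} poly set)"
  by (simp add: irr_polys_upto_def finite_irr_polys)

lemma sum_UN_const:
  fixes g :: "nat \<Rightarrow> real"
  assumes "\<And>d. finite (P d)" "\<And>d p. p \<in> P d \<Longrightarrow> e p = d"
  shows "(\<Sum>p\<in>(\<Union>d\<in>{1..n}. P d). g (e p)) = (\<Sum>d=1..n. real (card (P d)) * g d)"
proof -
  have "(\<Sum>p\<in>(\<Union>d\<in>{1..n}. P d). g (e p)) = (\<Sum>d=1..n. \<Sum>p\<in>P d. g (e p))"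
    using assms by (intro sum.UNION_disjoint) (simp, blast, metis disjoint_iff)
  also have "\<dots> = (\<Sum>d=1..n. \<Sum>p\<in>P d. g d)" using assms by (intro sum.cong) auto
  finally show ?thesis by simp
qed

lemma sum_irr_polys_upto:
  fixes g :: "nat \<Rightarrow> real"
  shows "(\<Sum>p\<in>(irr_polys_upto n :: 'a :: {field, finite} poly set). g (degree p)) =
     (\<Sum>d=1..n. real (card (irr_polys d :: 'a poly set)) * g d)"
  unfolding irr_polys_upto_def
  by (rule sum_UN_const) (auto simp: finite_irr_polys, auto simp: irr_polys_def)

lemma sum_degree_mult_upto:
  fixes f :: "'a :: {field, finite} poly"
  assumes "f \<noteq> 0" "degree f \<le> n"
  shows "(\<Sum>p\<in>irr_polys_upto n. degree p * factor_mult p f) = degree f"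
proof (rule sum_degree_mult)
  show "p \<in> irr_polys_upto n" if "irreducible p" "monic p" "p dvd f" for p
    using that assms dvd_imp_degree_le[of p f] by (intro irr_polys_uptoI) auto
qed (use assms irr_polys_uptoD finite_irr_polys_upto in auto)

lemma factor_mult_eq_card:
  fixes f :: "'a :: field poly"
  assumes "irreducible p" "f \<noteq> 0" "degree f \<le> n"
  shows "factor_mult p f = card {k \<in> {1..n}. p ^ k dvd f}"
proof -
  have "factor_mult p f \<le> n"
    using pow_dvd_degree_le(2)[OF assms(1,2)] pow_dvd_iff_le_factor_mult[OF assms(1,2)] assms(3)
    by (meson order_refl order_trans)
  then have "{k \<in> {1..n}. p ^ k dvd f} = {1..factor_mult p f}"
    unfolding pow_dvd_iff_le_factor_mult[OF assms(1,2)] by force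
  then show ?thesis by simp
qed

lemma sum_card_flip:
  assumes "finite A" "finite B"
  shows "(\<Sum>x\<in>A. card {y \<in> B. R x y}) = (\<Sum>y\<in>B. card {x \<in> A. R x y})"
  using sum.swap_restrict[OF assms, of "\<lambda>_ _. 1 :: nat" R] by simp

lemma sum_mult_monic_polys:
  fixes p :: "'a :: {field, finite} poly"
  assumes "irreducible p" "monic p"
  shows "(\<Sum>f\<in>monic_polys n. factor_mult p f) =
    (\<Sum>k=1..n. if k * degree p \<le> n then CARD('a) ^ (n - k * degree p) else 0)"
proof -
  have "(\<Sum>f\<in>monic_polys n. factor_mult p f) = (\<Sum>f\<in>monic_polys n. card {k \<in> {1..n}. p ^ k dvd f})"
    by (intro sum.cong refl factor_mult_eq_card assms) (auto simp: monic_polys_def)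
  also have "\<dots> = (\<Sum>k=1..n. card {f \<in> monic_polys n. p ^ k dvd f})"
    by (rule sum_card_flip) (auto simp: finite_monic_polys)
  also have "\<dots> = (\<Sum>k=1..n. if k * degree p \<le> n then CARD('a) ^ (n - k * degree p) else 0)"
  proof (intro sum.cong refl)
    fix k
    have "p \<noteq> 0" using assms by auto
    then have "degree (p ^ k) = k * degree p" by (simp add: degree_power_eq)
    moreover have "monic (p ^ k)" using assms(2) by (simp add: lead_coeff_power)
    ultimately show "card {f \<in> monic_polys n. p ^ k dvd f} = (if k * degree p \<le> n then CARD('a) ^ (n - k * degree p) else 0)"
      using card_monic_multiples[of "p ^ k" n] by simp
  qed
  finally show ?thesis .
qed

text \<open>The degrees of all monic polynomials of degree n are added up in two ways; p ^ k divides
  q ^ (n - k * deg p) of these polynomials. This replaces the exact formula for the number of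
  irreducibles, since only averages over the degree are wanted.\<close>

lemma degree_identity_monic:
  defines "q \<equiv> real CARD('a :: {field, finite})"
  shows "real n = (\<Sum>p\<in>(irr_polys_upto n :: 'a poly set). real (degree p) *
     (\<Sum>k=1..n. if k * degree p \<le> n then 1 / q ^ (k * degree p) else 0))"
proof -
  have q: "q > 0" by (simp add: q_def)
  have "n * CARD('a) ^ n = (\<Sum>f\<in>(monic_polys n :: 'a poly set). degree f)"
    by (simp add: monic_polys_def card_monic_polys[unfolded monic_polys_def])
  also have "\<dots> = (\<Sum>f\<in>(monic_polys n :: 'a poly set). \<Sum>p\<in>irr_polys_upto n. degree p * factor_mult p f)"
    by (intro sum.cong refl sum_degree_mult_upto[symmetric]) (auto simp: monic_polys_def)
  also have "\<dots> = (\<Sum>p\<in>irr_polys_upto n. degree p * (\<Sum>f\<in>(monic_polys n :: 'a poly set). factor_mult p f))"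
    by (subst sum.swap) (simp add: sum_distrib_left)
  also have "\<dots> = (\<Sum>p\<in>(irr_polys_upto n :: 'a poly set). degree p * (\<Sum>k=1..n. if k * degree p \<le> n then CARD('a) ^ (n - k * degree p) else 0))"
    by (intro sum.cong refl arg_cong2[where f = "(*)"] sum_mult_monic_polys) (auto dest: irr_polys_uptoD)
  finally have "real (n * CARD('a) ^ n) = real (\<Sum>p\<in>(irr_polys_upto n :: 'a poly set). degree p * (\<Sum>k=1..n. if k * degree p \<le> n then CARD('a) ^ (n - k * degree p) else 0))"
    by (rule arg_cong)
  also have "\<dots> = (\<Sum>p\<in>(irr_polys_upto n :: 'a poly set). real (degree p) * (\<Sum>k=1..n. if k * degree p \<le> n then q ^ (n - k * degree p) else 0))"
    by (simp add: q_def if_distrib[of real] cong: if_cong)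
  also have "\<dots> = (\<Sum>p\<in>(irr_polys_upto n :: 'a poly set). real (degree p) * (\<Sum>k=1..n. q ^ n * (if k * degree p \<le> n then 1 / q ^ (k * degree p) else 0)))"
    using q by (intro sum.cong refl arg_cong2[where f = "(*)"]) (auto simp: power_diff)
  also have "\<dots> = q ^ n * (\<Sum>p\<in>(irr_polys_upto n :: 'a poly set). real (degree p) * (\<Sum>k=1..n. (if k * degree p \<le> n then 1 / q ^ (k * degree p) else 0)))"
    by (simp add: sum_distrib_left mult.left_commute)
  finally show ?thesis using q by (simp add: q_def)
qed

text \<open>Only the terms with k = 1 of the degree identity are kept.\<close>

lemma sum_irr_upper:
  "(\<Sum>d=1..n. real d * real (card (irr_polys d :: 'a :: {field, finite} poly set)) / real CARD('a) ^ d) \<le> real n"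
proof -
  let ?q = "real CARD('a)"
  have "(\<Sum>d=1..n. real d * real (card (irr_polys d :: 'a poly set)) / ?q ^ d) =
    (\<Sum>p\<in>(irr_polys_upto n :: 'a poly set). real (degree p) * (1 / ?q ^ degree p))"
    by (subst sum_irr_polys_upto[where g = "\<lambda>d. real d * (1 / ?q ^ d)"]) (simp add: mult_ac)
  also have "\<dots> \<le> real n"
    unfolding degree_identity_monic[of n, where 'a = 'a]
  proof (intro sum_mono mult_left_mono)
    fix p :: "'a poly" assume p: "p \<in> irr_polys_upto n"
    then have 1: "1 \<in> {1..n}" "degree p \<le> n" by (auto dest: irr_polys_uptoD)
    have "1 / ?q ^ degree p = (\<Sum>k\<in>{1}. if k * degree p \<le> n then 1 / ?q ^ (k * degree p) else 0)"
      using 1 by simp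
    also have "\<dots> \<le> (\<Sum>k=1..n. if k * degree p \<le> n then 1 / ?q ^ (k * degree p) else 0)"
      using 1 by (intro sum_mono2) auto
    finally show "1 / ?q ^ degree p \<le> (\<Sum>k=1..n. if k * degree p \<le> n then 1 / ?q ^ (k * degree p) else 0)" .
  qed simp
  finally show ?thesis .
qed

text \<open>The terms with k at least 2 cost 8 * x^2 for each p, where x = q ^ - deg p. As there are
  at most q ^ d irreducibles of degree d, their total is at most 8 * 2 = 16.\<close>

lemma sum_irr_lower:
  "real n - 16 \<le> (\<Sum>d=1..n. real d * real (card (irr_polys d :: 'a :: {field, finite} poly set)) / real CARD('a) ^ d)"
proof -
  let ?q = "real CARD('a)"
  let ?N = "\<lambda>d. real (card (irr_polys d :: 'a poly set))"
  have q: "2 \<le> ?q" using CARD_ge_2[where 'a = 'a] by simp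
  have "real n \<le> (\<Sum>p\<in>(irr_polys_upto n :: 'a poly set). real (degree p) * (1 / ?q ^ degree p + 8 * (1 / ?q ^ degree p)\<^sup>2))"
    unfolding degree_identity_monic[of n, where 'a = 'a]
  proof (intro sum_mono mult_left_mono)
    fix p :: "'a poly" assume p: "p \<in> irr_polys_upto n"
    then have 1: "1 \<le> n" "1 \<le> degree p" by (auto dest: irr_polys_uptoD)
    define x where "x = 1 / ?q ^ degree p"
    have "?q ^ 1 \<le> ?q ^ degree p" using 1 q by (intro power_increasing) auto
    then have "2 \<le> ?q ^ degree p" using q unfolding power_one_right by (rule order_trans[rotated])
    then have x: "0 \<le> x" "x \<le> 1 / 2" using q by (auto simp: x_def field_simps)
    have "(\<Sum>k=1..n. if k * degree p \<le> n then 1 / ?q ^ (k * degree p) else 0) \<le> (\<Sum>k=1..n. x ^ k)"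
      by (intro sum_mono) (auto simp: x_def power_one_over power_mult[symmetric] mult.commute)
    also have "\<dots> = x + (\<Sum>k=2..n. x ^ k)"
      using 1 by (subst sum.atLeast_Suc_atMost) (auto simp: numeral_2_eq_2)
    also have "(\<Sum>k=2..n. x ^ k) \<le> (\<Sum>k=2..n. real k * x ^ k)"
      using x by (intro sum_mono) (auto simp: mult_le_cancel_right1)
    also have "\<dots> \<le> 8 * x\<^sup>2" using x by (rule sum_linear_power_tail)
    finally show "(\<Sum>k=1..n. if k * degree p \<le> n then 1 / ?q ^ (k * degree p) else 0) \<le> 1 / ?q ^ degree p + 8 * (1 / ?q ^ degree p)\<^sup>2"
      by (simp add: x_def)
  qed simp
  also have "\<dots> = (\<Sum>d=1..n. ?N d * (real d * (1 / ?q ^ d + 8 * (1 / ?q ^ d)\<^sup>2)))"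
    by (rule sum_irr_polys_upto)
  also have "\<dots> = (\<Sum>d=1..n. real d * ?N d / ?q ^ d) + (\<Sum>d=1..n. 8 * (real d * (?N d / ?q ^ d) / ?q ^ d))"
    by (simp add: sum.distrib[symmetric] algebra_simps power2_eq_square)
  also have "(\<Sum>d=1..n. 8 * (real d * (?N d / ?q ^ d) / ?q ^ d)) \<le> (\<Sum>d=1..n. 8 * (real d / ?q ^ d))"
  proof (intro sum_mono mult_left_mono divide_right_mono)
    fix d
    have "?N d \<le> ?q ^ d" using card_irr_polys_le[of d, where 'a = 'a] by (metis of_nat_le_iff of_nat_power)
    then have "?N d / ?q ^ d \<le> 1" using q by simp
    then have "real d * (?N d / ?q ^ d) \<le> real d * 1" by (intro mult_left_mono) auto
    then show "real d * (?N d / ?q ^ d) \<le> real d" by simp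
  qed auto
  also have "\<dots> = 8 * (\<Sum>d=1..n. real d / ?q ^ d)" by (simp add: sum_distrib_left)
  also have "\<dots> \<le> 8 * 2" using sum_linear_inverse_power_le[OF CARD_ge_2[where 'a = 'a]] by simp
  finally show ?thesis by simp
qed

lemma card_irr_polys_le_split:
  assumes "(2 :: 'a :: {field, finite}) \<noteq> 0"
  shows "card (irr_polys d :: 'a poly set) \<le> card (nonself_polys d :: 'a poly set) +
    (if d = 1 then 3 else 0) + (if even d then CARD('a) ^ (d div 2) else 0)"
proof -
  let ?L = "if d = 1 then {[:0, 1:], [:-1, 1:], [:1, 1:]} else {} :: 'a poly set"
  let ?S = "if even d then self_polys (d div 2) else {} :: 'a poly set"
  have "irr_polys d \<subseteq> nonself_polys d \<union> ?L \<union> ?S"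
  proof
    fix p :: "'a poly" assume p: "p \<in> irr_polys d"
    then have "degree p = d" by (auto simp: irr_polys_def)
    then show "p \<in> nonself_polys d \<union> ?L \<union> ?S" by (cases rule: irr_polys_cases[OF p assms]) auto
  qed
  then have "card (irr_polys d :: 'a poly set) \<le> card (nonself_polys d \<union> ?L \<union> ?S)"
    by (rule card_mono[rotated]) (auto simp: finite_nonself_polys finite_self_polys)
  also have "\<dots> \<le> card (nonself_polys d :: 'a poly set) + card ?L + card ?S"
    by (meson add_le_mono card_Un_le le_trans order_refl)
  also have "card ?L \<le> (if d = 1 then 3 else 0)"
    by (auto intro: order_trans[OF card_insert_le_m1])
  also have "card ?S \<le> (if even d then CARD('a) ^ (d div 2) else 0)"
    using card_self_polys_le by auto
  finally show ?thesis by simp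
qed

lemma sum_nonself_upper:
  "(\<Sum>d=1..n. real d * real (card (nonself_polys d :: 'a :: {field, finite} poly set)) / real CARD('a) ^ d) \<le> real n"
proof -
  have "(\<Sum>d=1..n. real d * real (card (nonself_polys d :: 'a poly set)) / real CARD('a) ^ d) \<le>
    (\<Sum>d=1..n. real d * real (card (irr_polys d :: 'a poly set)) / real CARD('a) ^ d)"
    by (intro sum_mono divide_right_mono mult_left_mono) (auto intro!: card_mono finite_irr_polys nonself_polys_subset)
  with sum_irr_upper show ?thesis by (rule order_trans[rotated])
qed

text \<open>The constant is 16 + 3 + 4: the loss for all irreducibles, the three polynomials x, x -
  1 and x + 1, and the self-reciprocal ones, of which there are at most q ^ (d / 2) in even degree
  d.\<close>

lemma sum_nonself_lower:
  assumes "(2 :: 'a :: {field, finite}) \<noteq> 0"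
  shows "real n - 23 \<le> (\<Sum>d=1..n. real d * real (card (nonself_polys d :: 'a poly set)) / real CARD('a) ^ d)"
proof -
  let ?q = "real CARD('a)"
  let ?A = "\<lambda>d. real (card (nonself_polys d :: 'a poly set))"
  have q: "2 \<le> ?q" using CARD_ge_2[where 'a = 'a] by simp
  have "real n - 16 \<le> (\<Sum>d=1..n. real d * real (card (irr_polys d :: 'a poly set)) / ?q ^ d)"
    by (rule sum_irr_lower)
  also have "\<dots> \<le> (\<Sum>d=1..n. real d * (?A d + (if d = 1 then 3 else 0) + (if even d then ?q ^ (d div 2) else 0)) / ?q ^ d)"
  proof (intro sum_mono divide_right_mono mult_left_mono)
    fix d
    have "real (card (irr_polys d :: 'a poly set)) \<le> real (card (nonself_polys d :: 'a poly set) +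
       (if d = 1 then 3 else 0) + (if even d then CARD('a) ^ (d div 2) else 0))"
      using card_irr_polys_le_split[OF assms] by (simp only: of_nat_le_iff)
    then show "real (card (irr_polys d :: 'a poly set)) \<le> ?A d + (if d = 1 then 3 else 0) + (if even d then ?q ^ (d div 2) else 0)"
      by (simp split: if_splits)
  qed auto
  also have "\<dots> = (\<Sum>d=1..n. real d * ?A d / ?q ^ d) + (\<Sum>d=1..n. if d = 1 then 3 / ?q else 0)
     + (\<Sum>d=1..n. if even d then real d * (?q ^ (d div 2) / ?q ^ d) else 0)"
    unfolding sum.distrib[symmetric] by (intro sum.cong) (auto simp: algebra_simps add_divide_distrib)
  also have "(\<Sum>d=1..n. if d = 1 then 3 / ?q else 0) \<le> 3"
    using q by (simp add: sum.delta divide_le_eq)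
  also have "(\<Sum>d=1..n. if even d then real d * (?q ^ (d div 2) / ?q ^ d) else 0) \<le> 4"
  proof -
    have "(\<Sum>d=1..n. if even d then real d * (?q ^ (d div 2) / ?q ^ d) else 0)
      = (\<Sum>d\<in>{d\<in>{1..n}. even d}. real d * (?q ^ (d div 2) / ?q ^ d))"
      by (rule sum.inter_filter[symmetric]) simp
    also have "\<dots> \<le> (\<Sum>d\<in>(*) 2 ` {1..n}. real d * (?q ^ (d div 2) / ?q ^ d))"
    proof (rule sum_mono2)
      show "{d \<in> {1..n}. even d} \<subseteq> (*) 2 ` {1..n}"
      proof
        fix d assume "d \<in> {d \<in> {1..n}. even d}"
        then have "d = 2 * (d div 2)" "d div 2 \<in> {1..n}" by auto
        then show "d \<in> (*) 2 ` {1..n}" by blast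
      qed
    qed auto
    also have "\<dots> = (\<Sum>e=1..n. real (2 * e) * (?q ^ (2 * e div 2) / ?q ^ (2 * e)))"
      by (subst sum.reindex) (simp_all add: inj_on_def)
    also have "\<dots> = (\<Sum>e=1..n. 2 * (real e / ?q ^ e))"
    proof (intro sum.cong refl)
      fix e
      have "?q ^ (2 * e) = ?q ^ e * ?q ^ e" by (simp only: mult_2 power_add)
      then show "real (2 * e) * (?q ^ (2 * e div 2) / ?q ^ (2 * e)) = 2 * (real e / ?q ^ e)"
        using q by simp
    qed
    also have "\<dots> \<le> 2 * 2"
      unfolding sum_distrib_left[symmetric] using sum_linear_inverse_power_le[OF CARD_ge_2[where 'a = 'a]] by simp
    finally show ?thesis by simp
  qed
  finally show ?thesis by simp
qed

section \<open>Palindromic multiples and the joint upper bound for both classes\<close>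

lemma palindromes_mult:
  "f \<in> palindromes a \<Longrightarrow> g \<in> palindromes b \<Longrightarrow> f * g \<in> palindromes (a + b)"
proof -
  assume f: "f \<in> palindromes a" and g: "g \<in> palindromes b"
  then have "f \<noteq> 0" "g \<noteq> 0" by (auto simp: palindromes_def)
  then have "degree (f * g) = 2 * (a + b)" using f g by (simp add: palindromes_def degree_mult_eq)
  moreover have "monic f" "monic g" "reflect_poly f = f" "reflect_poly g = g" using f g by (auto simp: palindromes_def)
  then have "monic (f * g)" "reflect_poly (f * g) = f * g" by (simp_all only: lead_coeff_mult reflect_poly_mult mult_1)
  ultimately show ?thesis by (simp add: palindromes_def)
qed

lemma card_palindrome_multiples:
  fixes g p :: "'a :: {field, finite} poly"
  assumes "g \<in> palindromes a" "p dvd g" "a \<le> n"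
  shows "CARD('a) ^ (n - a) \<le> card {f \<in> palindromes n. p dvd f}"
proof -
  have "g \<noteq> 0" using assms(1) by (auto simp: palindromes_def)
  then have "inj_on ((*) g) (palindromes (n - a))" by (auto simp: inj_on_def)
  moreover have "(*) g ` palindromes (n - a) \<subseteq> {f \<in> palindromes n. p dvd f}"
    using palindromes_mult[OF assms(1), of _ "n - a"] assms(2,3) by auto
  ultimately have "card (palindromes (n - a) :: 'a poly set) \<le> card {f \<in> palindromes n. p dvd f}"
    by (intro card_inj_on_le) (auto simp: finite_palindromes)
  then show ?thesis by (simp add: card_palindromes)
qed

text \<open>The product of p with its reflection is unchanged by reflection; dividing by the
  constant coefficient of p makes it monic.\<close>

lemma mult_reflect_palindrome:
  assumes "p \<in> nonself_polys d"
  obtains g where "g \<in> palindromes d" "p dvd g"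
proof
  let ?c = "coeff p 0"
  have p: "monic p" "degree p = d" "?c \<noteq> 0" using assms by (auto simp: nonself_polys_def irr_polys_def)
  then have p0: "p \<noteq> 0" "reflect_poly p \<noteq> 0" by auto
  let ?g = "p * Polynomial.smult (inverse ?c) (reflect_poly p)"
  have dr: "degree (reflect_poly p) = d" using p by (simp add: degree_reflect_poly_eq)
  have "degree ?g = 2 * d" using p p0 dr by (simp add: degree_mult_eq)
  moreover have "monic ?g"
    unfolding lead_coeff_mult using p dr by (simp add: coeff_reflect_poly)
  moreover have "reflect_poly ?g = ?g"
    using p by (simp add: reflect_poly_mult reflect_poly_smult mult.commute)
  ultimately show "?g \<in> palindromes d" by (simp add: palindromes_def)
  show "p dvd ?g" by (rule dvd_triv_left)
qed

text \<open>The degrees of all palindromes of degree 2 * n are added up. A self-reciprocal p of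
  degree 2 * d divides at least q ^ (n - d) of them, and so does any other p of degree d, through
  its product with its reflection. A polynomial and its reciprocal are both summed over, each
  contributing its own degree d.\<close>

lemma sum_nonself_self_upper:
  "(\<Sum>d=1..n. real d * real (card (nonself_polys d :: 'a :: {field, finite} poly set)) / real CARD('a) ^ d) +
   (\<Sum>d=1..n. 2 * real d * real (card (self_polys d :: 'a poly set)) / real CARD('a) ^ d) \<le> 2 * real n"
proof -
  let ?q = "real CARD('a)"
  let ?PA = "\<Union>d\<in>{1..n}. nonself_polys d :: 'a poly set"
  let ?PM = "\<Union>d\<in>{1..n}. self_polys d :: 'a poly set"
  have fin: "finite ?PA" "finite ?PM" by (auto simp: finite_nonself_polys finite_self_polys)
  have sub: "?PA \<union> ?PM \<subseteq> irr_polys_upto (2 * n)"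
  proof
    fix p assume "p \<in> ?PA \<union> ?PM"
    then show "p \<in> irr_polys_upto (2 * n)"
      by (auto simp: nonself_polys_def self_polys_def irr_polys_def intro!: irr_polys_uptoI)
  qed
  have disj: "?PA \<inter> ?PM = {}" by (auto simp: nonself_polys_def self_polys_def)
  have q: "?q > 0" by simp
  have A: "real (CARD('a) ^ n) * (real (degree p) / ?q ^ degree p) \<le> real (degree p * card {f \<in> palindromes n. p dvd f})"
    if p: "p \<in> ?PA" for p :: "'a poly"
  proof -
    obtain d where d: "d \<in> {1..n}" "p \<in> nonself_polys d" using p by blast
    then have dp: "degree p = d" by (auto simp: nonself_polys_def irr_polys_def)
    obtain g where "g \<in> palindromes d" "p dvd g" using mult_reflect_palindrome d by blast
    then have "CARD('a) ^ (n - d) \<le> card {f \<in> palindromes n. p dvd f}" using card_palindrome_multiples d by auto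
    then have "real (d * CARD('a) ^ (n - d)) \<le> real (degree p * card {f \<in> palindromes n. p dvd f})"
      unfolding dp of_nat_le_iff by (rule mult_le_mono2)
    then show ?thesis using d q by (simp add: dp power_diff mult_ac)
  qed
  have M: "real (CARD('a) ^ n) * (2 * real (degree p div 2) / ?q ^ (degree p div 2)) \<le> real (degree p * card {f \<in> palindromes n. p dvd f})"
    if p: "p \<in> ?PM" for p :: "'a poly"
  proof -
    obtain d where d: "d \<in> {1..n}" "p \<in> self_polys d" using p by blast
    then have dp: "degree p = 2 * d" by (auto simp: self_polys_def irr_polys_def)
    have "p \<in> palindromes d" using d self_polys_subset by blast
    then have "CARD('a) ^ (n - d) \<le> card {f \<in> palindromes n. p dvd f}"
      using d by (intro card_palindrome_multiples[of p]) auto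
    then have "real (2 * d * CARD('a) ^ (n - d)) \<le> real (degree p * card {f \<in> palindromes n. p dvd f})"
      unfolding dp of_nat_le_iff by (rule mult_le_mono2)
    moreover have "real (2 * d * CARD('a) ^ (n - d)) = real (CARD('a) ^ n) * (2 * real (degree p div 2) / ?q ^ (degree p div 2))"
      unfolding dp of_nat_mult of_nat_power using d q by (simp add: power_diff)
    ultimately show ?thesis by simp
  qed
  have "real (CARD('a) ^ n) * ((\<Sum>p\<in>?PA. real (degree p) / ?q ^ degree p) + (\<Sum>p\<in>?PM. 2 * real (degree p div 2) / ?q ^ (degree p div 2)))
     \<le> (\<Sum>p\<in>?PA. real (degree p * card {f \<in> palindromes n. p dvd f})) + (\<Sum>p\<in>?PM. real (degree p * card {f \<in> palindromes n. p dvd f}))"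
    unfolding distrib_left sum_distrib_left by (intro add_mono sum_mono A M)
  also have "\<dots> = (\<Sum>p\<in>?PA \<union> ?PM. real (degree p * card {f \<in> palindromes n. p dvd f}))"
    using fin disj by (rule sum.union_disjoint[symmetric])
  also have "\<dots> \<le> (\<Sum>p\<in>(irr_polys_upto (2 * n) :: 'a poly set). real (degree p * card {f \<in> palindromes n. p dvd f}))"
    by (rule sum_mono2[OF finite_irr_polys_upto sub]) (rule of_nat_0_le_iff)
  also have "\<dots> = real (\<Sum>p\<in>(irr_polys_upto (2 * n) :: 'a poly set). \<Sum>f\<in>palindromes n. if p dvd f then degree p else 0)"
    unfolding of_nat_sum[symmetric]
    by (subst sum.inter_filter[symmetric]) (simp_all add: finite_palindromes mult.commute)
  also have "\<dots> \<le> real (\<Sum>p\<in>(irr_polys_upto (2 * n) :: 'a poly set). \<Sum>f\<in>palindromes n. degree p * factor_mult p f)"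
    unfolding of_nat_le_iff
  proof (intro sum_mono)
    fix p f :: "'a poly" assume p: "p \<in> irr_polys_upto (2 * n)" and f: "f \<in> palindromes n"
    have "f \<noteq> 0" using f by (auto simp: palindromes_def)
    then have "p dvd f \<Longrightarrow> factor_mult p f \<noteq> 0" using factor_mult_eq_0_iff p irr_polys_uptoD by blast
    then show "(if p dvd f then degree p else 0) \<le> degree p * factor_mult p f" by auto
  qed
  also have "(\<Sum>p\<in>(irr_polys_upto (2 * n) :: 'a poly set). \<Sum>f\<in>palindromes n. degree p * factor_mult p f) = (\<Sum>f\<in>(palindromes n :: 'a poly set). degree f)"
    by (subst sum.swap, intro sum.cong refl sum_degree_mult_upto) (auto simp: palindromes_def)
  also have "\<dots> = 2 * n * CARD('a) ^ n"
    by (simp add: palindromes_def card_palindromes[unfolded palindromes_def])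
  finally have "(\<Sum>p\<in>?PA. real (degree p) / ?q ^ degree p) + (\<Sum>p\<in>?PM. 2 * real (degree p div 2) / ?q ^ (degree p div 2)) \<le> 2 * real n"
    using q by (simp add: mult.commute)
  also have "(\<Sum>p\<in>?PA. real (degree p) / ?q ^ degree p) = (\<Sum>d=1..n. real (card (nonself_polys d :: 'a poly set)) * (real d / ?q ^ d))"
    by (rule sum_UN_const) (auto simp: finite_nonself_polys, auto simp: nonself_polys_def irr_polys_def)
  also have "(\<Sum>p\<in>?PM. 2 * real (degree p div 2) / ?q ^ (degree p div 2)) = (\<Sum>d=1..n. real (card (self_polys d :: 'a poly set)) * (2 * real d / ?q ^ d))"
    by (rule sum_UN_const[where e = "\<lambda>p. degree p div 2"]) (auto simp: finite_self_polys, auto simp: self_polys_def irr_polys_def)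
  finally show ?thesis by (simp add: mult_ac)
qed


section \<open>Witt's extension theorem\<close>

text \<open>The form is bilinear on the whole type, while only \<open>V\<close> is finite and
  carries non-degeneracy. In the application the type is that of all functions from
  \<open>nat\<close> to the field, and \<open>V\<close> consists of those supported below n.\<close>

locale quad_space = vector_space scale
  for scale :: "'a :: {field, finite} \<Rightarrow> 'v :: ab_group_add \<Rightarrow> 'v" (infixr \<open>*s\<close> 75) +
  fixes V :: "'v set" and B :: "'v \<Rightarrow> 'v \<Rightarrow> 'a"
  assumes subspace_V: "subspace V" and finite_V: "finite V"
    and B_add_left: "B (x + y) z = B x z + B y z"
    and B_scale_left: "B (c *s x) z = c * B x z"
    and B_sym: "B x y = B y x"
    and nondegenerate: "v \<in> V \<Longrightarrow> v \<noteq> 0 \<Longrightarrow> \<exists>w\<in>V. B v w \<noteq> 0"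
    and two_neq_0: "(2 :: 'a) \<noteq> 0"
begin

lemma B_add_right: "B x (y + z) = B x y + B x z"
  by (metis B_add_left B_sym)

lemma B_scale_right: "B x (c *s y) = c * B x y"
  by (metis B_scale_left B_sym)

lemma B_0_left: "B 0 y = 0"
  using B_scale_left[of 0 0 y] by simp

lemma B_0_right: "B x 0 = 0"
  using B_0_left B_sym by metis

lemma B_minus_left: "B (- x) y = - B x y"
  using B_scale_left[of "-1" x y] by simp

lemma B_minus_right: "B x (- y) = - B x y"
  using B_minus_left B_sym by metis

lemma B_diff_left: "B (x - y) z = B x z - B y z"
  using B_add_left[of x "- y" z] B_minus_left by simp

lemma B_diff_right: "B x (y - z) = B x y - B x z"
  using B_add_right[of x y "- z"] B_minus_right by simp

lemma B_sum_left: "B (\<Sum>i\<in>I. f i) y = (\<Sum>i\<in>I. B (f i) y)"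
  by (induction I rule: infinite_finite_induct) (auto simp: B_add_left B_0_left)

lemma B_sum_right: "B x (\<Sum>i\<in>I. f i) = (\<Sum>i\<in>I. B x (f i))"
  by (induction I rule: infinite_finite_induct) (auto simp: B_add_right B_0_right)

lemmas B_simps = B_add_left B_add_right B_scale_left B_scale_right B_0_left B_0_right
  B_minus_left B_minus_right B_diff_left B_diff_right B_sum_left B_sum_right

lemmas V_closed = subspace_add[OF subspace_V] subspace_scale[OF subspace_V] subspace_diff[OF subspace_V]
  subspace_0[OF subspace_V] subspace_neg[OF subspace_V]

lemma V_sum: "(\<And>i. i \<in> I \<Longrightarrow> f i \<in> V) \<Longrightarrow> sum f I \<in> V"
  by (rule subspace_sum[OF subspace_V])

definition indep_upto :: "(nat \<Rightarrow> 'v) \<Rightarrow> nat \<Rightarrow> bool" where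
  "indep_upto u k \<longleftrightarrow> (\<forall>c. (\<Sum>i<k. c i *s u i) = 0 \<longrightarrow> (\<forall>i<k. c i = 0))"

lemma indep_uptoD: "indep_upto u k \<Longrightarrow> (\<Sum>i<k. c i *s u i) = 0 \<Longrightarrow> i < k \<Longrightarrow> c i = 0"
  by (auto simp: indep_upto_def)

lemma indep_upto_SucD: "indep_upto u (Suc k) \<Longrightarrow> indep_upto u k"
  unfolding indep_upto_def
proof (intro allI impI)
  fix c i
  assume ind: "\<forall>c. (\<Sum>i<Suc k. c i *s u i) = 0 \<longrightarrow> (\<forall>i<Suc k. c i = 0)"
    and eq: "(\<Sum>i<k. c i *s u i) = 0" and i: "i < k"
  have "(\<Sum>i<Suc k. (c(k := 0)) i *s u i) = (\<Sum>i<k. c i *s u i)" by simp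
  with ind eq have "(c(k := 0)) i = 0" using i by (metis less_Suc_eq)
  with i show "c i = 0" by simp
qed

lemma indep_upto_cong: "(\<And>i. i < k \<Longrightarrow> u i = w i) \<Longrightarrow> indep_upto u k = indep_upto w k"
  by (simp add: indep_upto_def)

lemma indep_upto_Suc_cases:
  assumes "indep_upto u k" "\<not> indep_upto (u(k := z)) (Suc k)"
  obtains a where "z = (\<Sum>i<k. a i *s u i)"
proof -
  obtain c j where c: "(\<Sum>i<Suc k. c i *s (u(k := z)) i) = 0" "j < Suc k" "c j \<noteq> 0"
    using assms(2) by (auto simp: indep_upto_def)
  have s: "(\<Sum>i<k. c i *s u i) + c k *s z = 0" using c(1) by simp
  have "c k \<noteq> 0"
  proof
    assume "c k = 0"
    with s have "(\<Sum>i<k. c i *s u i) = 0" by simp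
    then have "\<forall>i<k. c i = 0" using assms(1) by (auto simp: indep_upto_def)
    with \<open>c k = 0\<close> c show False by (auto simp: less_Suc_eq)
  qed
  have "c k *s z = - (\<Sum>i<k. c i *s u i)" using s by (simp add: eq_neg_iff_add_eq_0 add.commute)
  then have "inverse (c k) *s (c k *s z) = inverse (c k) *s (- (\<Sum>i<k. c i *s u i))" by simp
  then have "z = (\<Sum>i<k. (- inverse (c k) * c i) *s u i)"
    using \<open>c k \<noteq> 0\<close> by (simp add: scale_sum_right sum_negf)
  then show ?thesis by (rule that)
qed

text \<open>A step of Gram-Schmidt type. Subtracting from \<open>u k\<close> its components along
  the earlier vectors leaves \<open>u'\<close>, non-zero by independence, which pairs non-trivially
  with some x. Making x orthogonal to the earlier \<open>u j\<close> is the transposed correction,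
  so \<open>B x' (u k) = B u' x\<close>. Finally the old dual vectors are made orthogonal to
  \<open>u k\<close>.\<close>

lemma dual_family:
  assumes "indep_upto u k" "\<And>i. i < k \<Longrightarrow> u i \<in> V"
  shows "\<exists>y. (\<forall>i<k. y i \<in> V) \<and> (\<forall>i<k. \<forall>j<k. B (y i) (u j) = (if i = j then 1 else 0))"
  using assms
proof (induction k)
  case (Suc k)
  then obtain y where yV: "\<And>i. i < k \<Longrightarrow> y i \<in> V"
    and y: "\<And>i j. i < k \<Longrightarrow> j < k \<Longrightarrow> B (y i) (u j) = (if i = j then 1 else 0)"
    using indep_upto_SucD by (metis less_Suc_eq)
  define u' where "u' = u k - (\<Sum>j<k. B (y j) (u k) *s u j)"
  have "u' \<noteq> 0"
  proof
    assume "u' = 0"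
    let ?c = "\<lambda>i. if i = k then 1 else - B (y i) (u k)"
    have "(\<Sum>i<Suc k. ?c i *s u i) = (\<Sum>i<k. - B (y i) (u k) *s u i) + u k" by simp
    also have "\<dots> = u'" by (simp add: u'_def sum_negf)
    finally have "?c k = 0" using \<open>u' = 0\<close> indep_uptoD[OF Suc.prems(1), of ?c k] by simp
    then show False by simp
  qed
  moreover have "u' \<in> V" unfolding u'_def using Suc.prems(2) by (intro V_closed V_sum) auto
  ultimately obtain x where x: "x \<in> V" "B u' x \<noteq> 0" using nondegenerate by blast
  define x' where "x' = x - (\<Sum>j<k. B x (u j) *s y j)"
  have x'V: "x' \<in> V" unfolding x'_def using x yV by (intro V_closed V_sum) auto
  have x'u: "B x' (u j) = 0" if "j < k" for j
  proof -
    have "(\<Sum>i<k. B x (u i) * B (y i) (u j)) = (\<Sum>i<k. if i = j then B x (u j) else 0)"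
      using that y by (intro sum.cong) auto
    also have "\<dots> = B x (u j)" using that by simp
    finally show ?thesis by (simp add: x'_def B_simps)
  qed
  have "B x' (u k) = B u' x"
    by (simp add: x'_def u'_def B_simps B_sym[of x] mult.commute)
  then have a: "B x' (u k) \<noteq> 0" using x by simp
  define yk where "yk = inverse (B x' (u k)) *s x'"
  have yk: "yk \<in> V" "B yk (u k) = 1" "\<And>j. j < k \<Longrightarrow> B yk (u j) = 0"
    using a x'V x'u by (auto simp: yk_def B_simps intro: V_closed)
  define y' where "y' i = (if i = k then yk else y i - B (y i) (u k) *s yk)" for i
  show ?case
  proof (intro exI conjI allI impI)
    show "y' i \<in> V" if "i < Suc k" for i
      using that yk yV by (auto simp: y'_def less_Suc_eq intro: V_closed)
    show "B (y' i) (u j) = (if i = j then 1 else 0)" if "i < Suc k" "j < Suc k" for i j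
      using that yk y by (auto simp: y'_def less_Suc_eq B_simps)
  qed
qed simp

lemma dual_vector:
  assumes "indep_upto u (Suc k)" "\<And>i. i < Suc k \<Longrightarrow> u i \<in> V"
  obtains y where "y \<in> V" "\<And>i. i < k \<Longrightarrow> B y (u i) = 0" "B y (u k) = 1"
proof -
  obtain y where "\<forall>i<Suc k. y i \<in> V" "\<forall>i<Suc k. \<forall>j<Suc k. B (y i) (u j) = (if i = j then 1 else 0)"
    using dual_family[OF assms] by blast
  then show ?thesis by (intro that[of "y k"]) auto
qed

section \<open>Isometries: reflections, Eichler transformations, scalings of hyperbolic
  pairs\<close>

definition isom :: "('v \<Rightarrow> 'v) \<Rightarrow> bool" where
  "isom h \<longleftrightarrow> (\<forall>x y. h (x + y) = h x + h y) \<and> (\<forall>c x. h (c *s x) = c *s h x) \<and>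
     (\<forall>x\<in>V. h x \<in> V) \<and> (\<forall>x\<in>V. \<forall>y\<in>V. B (h x) (h y) = B x y)"

lemma isom_add: "isom h \<Longrightarrow> h (x + y) = h x + h y"
  and isom_scale: "isom h \<Longrightarrow> h (c *s x) = c *s h x"
  and isom_V: "isom h \<Longrightarrow> x \<in> V \<Longrightarrow> h x \<in> V"
  and isom_B: "isom h \<Longrightarrow> x \<in> V \<Longrightarrow> y \<in> V \<Longrightarrow> B (h x) (h y) = B x y"
  by (auto simp: isom_def)

lemma isom_0: "isom h \<Longrightarrow> h 0 = 0"
  using isom_scale[of h 0 0] by simp

lemma isom_minus: "isom h \<Longrightarrow> h (- x) = - h x"
  using isom_scale[of h "-1" x] by simp

lemma isom_diff: "isom h \<Longrightarrow> h (x - y) = h x - h y"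
  using isom_add[of h x "- y"] isom_minus[of h y] by simp

lemma isom_sum: "isom h \<Longrightarrow> h (\<Sum>i\<in>I. f i) = (\<Sum>i\<in>I. h (f i))"
  by (induction I rule: infinite_finite_induct) (auto simp: isom_0 isom_add)

lemma isom_id: "isom (\<lambda>x. x)"
  by (simp add: isom_def)

lemma isom_comp: "isom g \<Longrightarrow> isom h \<Longrightarrow> isom (\<lambda>x. g (h x))"
  by (simp add: isom_def)

lemma isom_inj_on: "isom h \<Longrightarrow> inj_on h V"
proof (rule inj_onI)
  fix x y assume h: "isom h" and xy: "x \<in> V" "y \<in> V" "h x = h y"
  show "x = y"
  proof (rule ccontr)
    assume "x \<noteq> y"
    then obtain w where w: "w \<in> V" "B (x - y) w \<noteq> 0" using nondegenerate[of "x - y"] xy V_closed by auto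
    have "B (x - y) w = B (h (x - y)) (h w)" using isom_B[OF h] xy w V_closed by simp
    also have "h (x - y) = 0" using xy h by (simp add: isom_diff)
    finally show False using w by (simp add: B_simps)
  qed
qed

lemma isom_surj: "isom h \<Longrightarrow> h ` V = V"
  using endo_inj_surj[OF finite_V _ isom_inj_on] isom_V by blast

lemma isom_reflection:
  assumes "z \<in> V" "B z z \<noteq> 0"
  shows "isom (\<lambda>x. x - (2 * B x z / B z z) *s z)"
  unfolding isom_def
proof (intro conjI allI ballI)
  let ?h = "\<lambda>x. x - (2 * B x z / B z z) *s z"
  show "?h (x + y) = ?h x + ?h y" for x y
    by (simp add: B_simps scale_left_distrib[symmetric] add_divide_distrib[symmetric] algebra_simps)
  show "?h (c *s x) = c *s ?h x" for c x
    by (simp add: B_simps scale_right_diff_distrib mult_ac)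
  show "?h x \<in> V" if "x \<in> V" for x using that assms by (intro V_closed)
  show "B (?h x) (?h y) = B x y" for x y
  proof -
    define r where "r w = 2 * B w z / B z z" for w
    have "r y * B z z = 2 * B y z" using assms(2) by (simp add: r_def)
    moreover have "r y * B x z = r x * B y z" by (simp add: r_def)
    moreover have "B (x - r x *s z) (y - r y *s z) = B x y - r y * B x z - r x * B y z + r x * (r y * B z z)"
      by (simp add: B_simps B_sym[of z y] algebra_simps)
    ultimately show ?thesis by (simp add: r_def[symmetric])
  qed
qed

text \<open>This is the Eichler (or Siegel) transformation of a singular vector z and a vector y
  orthogonal to it. The term with \<open>B y y / 2\<close> compensates the length of y.\<close>

lemma isom_eichler:
  assumes "z \<in> V" "y \<in> V" "B z z = 0" "B y z = 0"
  shows "isom (\<lambda>x. x + B x z *s y - (B x y + B y y / 2 * B x z) *s z)"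
  unfolding isom_def
proof (intro conjI allI ballI)
  let ?h = "\<lambda>x. x + B x z *s y - (B x y + B y y / 2 * B x z) *s z"
  show "?h (x + w) = ?h x + ?h w" for x w
    by (simp add: B_simps scale_left_distrib distrib_left add_divide_distrib algebra_simps)
  show "?h (c *s x) = c *s ?h x" for c x
    by (simp add: B_simps scale_right_diff_distrib scale_right_distrib distrib_left mult_ac)
  show "?h x \<in> V" if "x \<in> V" for x using that assms by (intro V_closed)
  show "B (?h x) (?h w) = B x w" for x w
  proof -
    have [simp]: "B z y = 0" using assms(4) B_sym by metis
    define b where "b = B y y / 2"
    have byy: "B y y = b + b" using two_neq_0 by (simp add: b_def field_simps)
    have s: "B z x = B x z" "B y x = B x y" "B z w = B w z" "B y w = B w y" by (rule B_sym)+
    show ?thesis unfolding b_def[symmetric]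
      by (simp add: B_simps assms(3,4) byy s algebra_simps)
  qed
qed

text \<open>The map multiplies z by c and y by the inverse of c, and fixes the orthogonal complement
  of this hyperbolic pair.\<close>

lemma isom_hyperbolic:
  assumes "z \<in> V" "y \<in> V" "B z z = 0" "B y y = 0" "B y z = 1" "c \<noteq> 0"
  shows "isom (\<lambda>x. x + ((c - 1) * B x y) *s z + ((inverse c - 1) * B x z) *s y)"
  unfolding isom_def
proof (intro conjI allI ballI)
  let ?h = "\<lambda>x. x + ((c - 1) * B x y) *s z + ((inverse c - 1) * B x z) *s y"
  show "?h (x + w) = ?h x + ?h w" for x w
    by (simp add: B_simps scale_left_distrib distrib_left algebra_simps)
  show "?h (a *s x) = a *s ?h x" for a x
    by (simp add: B_simps scale_right_distrib mult_ac)
  show "?h x \<in> V" if "x \<in> V" for x using that assms by (intro V_closed)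
  show "B (?h x) (?h w) = B x w" for x w
  proof -
    have [simp]: "B z y = 1" using assms(5) B_sym by metis
    have s: "B z x = B x z" "B y x = B x y" "B z w = B w z" "B y w = B w y" by (rule B_sym)+
    have "(c - 1) + (inverse c - 1) + (c - 1) * (inverse c - 1) = 0"
      using assms(6) by (simp add: field_simps)
    then have "((c - 1) + (inverse c - 1) + (c - 1) * (inverse c - 1)) * (B x y * B w z + B x z * B w y) = 0" by simp
    then show ?thesis
      by (simp add: B_simps assms(3,4,5) s algebra_simps)
  qed
qed

text \<open>The difference z = v - w is orthogonal to all \<open>u i\<close>. If z is non-singular,
  the reflection in z works. If z is singular, an Eichler transformation works as soon as some y is
  orthogonal to z and all \<open>u i\<close> with \<open>B y v = 1\<close>. A dual vector provides
  it when z lies in the span of the \<open>u i\<close>, or when v lies outside the span of the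
  \<open>u i\<close> and z. In the remaining case v and w are s + a z and s + (a - 1) z with s in
  the span of the \<open>u i\<close>, and z is rescaled inside a hyperbolic pair.\<close>

lemma witt_step:
  assumes uV: "\<And>i. i < k \<Longrightarrow> u i \<in> V" and v: "v \<in> V" and w: "w \<in> V"
    and indv: "indep_upto (u(k := v)) (Suc k)" and indw: "indep_upto (u(k := w)) (Suc k)"
    and eq: "B v v = B w w" and equ: "\<And>i. i < k \<Longrightarrow> B v (u i) = B w (u i)"
  shows "\<exists>h. isom h \<and> (\<forall>i<k. h (u i) = u i) \<and> h v = w"
proof -
  define z where "z = v - w"
  have zV: "z \<in> V" using v w by (simp add: z_def V_closed)
  have zu: "B (u i) z = 0" if "i < k" for i using equ[OF that] by (simp add: z_def B_simps B_sym[of "u i"])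
  have indu: "indep_upto u k"
    using indep_upto_SucD[OF indv] by (subst indep_upto_cong[of k u "u(k := v)"]) auto
  have vz: "2 * B v z = B z z" using eq by (simp add: z_def B_simps B_sym[of w v])
  have vw: "v - z = w" by (simp add: z_def)
  have eichler: ?thesis if y: "y \<in> V" "\<And>i. i < k \<Longrightarrow> B y (u i) = 0" "B y z = 0" "B y v = 1" and zz: "B z z = 0" for y
  proof (intro exI conjI allI impI)
    let ?h = "\<lambda>x. x + B x z *s y - (B x y + B y y / 2 * B x z) *s z"
    show "isom ?h" by (rule isom_eichler) fact+
    have "B v z = 0" using vz zz two_neq_0 by simp
    moreover have "B v y = 1" using y B_sym by metis
    ultimately show "?h v = w" by (simp add: vw)
    show "?h (u i) = u i" if "i < k" for i
      using y(2)[OF that] zu[OF that] by (simp add: B_sym[of "u i" y])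
  qed
  show ?thesis
  proof (cases "B z z = 0")
    case False
    let ?h = "\<lambda>x. x - (2 * B x z / B z z) *s z"
    have "?h v = w" using False vz by (simp add: vw)
    moreover have "\<forall>i<k. ?h (u i) = u i" using zu by simp
    ultimately show ?thesis using isom_reflection[OF zV False] by blast
  next
    case zz: True
    show ?thesis
    proof (cases "indep_upto (u(k := z)) (Suc k)")
      case False
      obtain a where a: "z = (\<Sum>i<k. a i *s u i)" using indep_upto_Suc_cases[OF indu False] by blast
      obtain y where "y \<in> V" "\<And>i. i < k \<Longrightarrow> B y ((u(k := v)) i) = 0" "B y ((u(k := v)) k) = 1"
        by (rule dual_vector[OF indv]) (use uV v in \<open>auto simp: less_Suc_eq\<close>)
      then have y: "y \<in> V" "\<And>i. i < k \<Longrightarrow> B y (u i) = 0" "B y v = 1" by auto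
      have "B y z = 0" using y by (simp add: a B_simps)
      with y zz show ?thesis by (intro eichler)
    next
      case indz: True
      show ?thesis
      proof (cases "indep_upto ((u(k := z))(Suc k := v)) (Suc (Suc k))")
        case True
        obtain y where y: "y \<in> V" "\<And>i. i < Suc k \<Longrightarrow> B y (((u(k := z))(Suc k := v)) i) = 0"
          "B y (((u(k := z))(Suc k := v)) (Suc k)) = 1"
          by (rule dual_vector[OF True]) (use uV v zV in \<open>auto simp: less_Suc_eq\<close>)
        have "B y (u i) = 0" if "i < k" for i using y(2)[of i] that by simp
        moreover have "B y z = 0" using y(2)[of k] by simp
        ultimately show ?thesis using y zz by (intro eichler) auto
      next
        case False
        obtain a where "v = (\<Sum>i<Suc k. a i *s (u(k := z)) i)"
          using indep_upto_Suc_cases[OF indz False] by blast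
        then have va: "v = (\<Sum>i<k. a i *s u i) + a k *s z" by simp
        define s where "s = (\<Sum>i<k. a i *s u i)"
        have ws: "w = s + (a k - 1) *s z" using va vw by (simp add: s_def scale_left_diff_distrib) (metis add_diff_eq)
        have notspan: "x \<noteq> s" if "indep_upto (u(k := x)) (Suc k)" for x
        proof
          assume "x = s"
          let ?c = "\<lambda>i. if i = k then - 1 else a i"
          have "(\<Sum>i<Suc k. ?c i *s (u(k := x)) i) = 0" using \<open>x = s\<close> by (simp add: s_def)
          then have "?c k = 0" using indep_uptoD[OF that, of ?c k] by simp
          then show False by simp
        qed
        \<comment> \<open>Neither v nor w lies in the span of the \<open>u i\<close>, so the scaling
          factor (a - 1) / a is defined and non-zero.\<close>
        have "a k \<noteq> 0" using notspan[OF indv] va by (auto simp: s_def)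
        moreover have "a k \<noteq> 1" using notspan[OF indw] ws by auto
        ultimately have c: "(a k - 1) / a k \<noteq> 0" by simp
        obtain y where "y \<in> V" "\<And>i. i < k \<Longrightarrow> B y ((u(k := z)) i) = 0" "B y ((u(k := z)) k) = 1"
          by (rule dual_vector[OF indz]) (use uV zV in \<open>auto simp: less_Suc_eq\<close>)
        then have y: "y \<in> V" "\<And>i. i < k \<Longrightarrow> B y (u i) = 0" "B y z = 1" by auto
        \<comment> \<open>This correction makes the partner of z singular and keeps its pairing with
          z and its orthogonality to all \<open>u i\<close>.\<close>
        define y' where "y' = y - (B y y / 2) *s z"
        have y'V: "y' \<in> V" using y zV by (simp add: y'_def V_closed)
        have zy: "B z y = 1" using y B_sym by metis
        have y'z: "B y' z = 1" using y zz by (simp add: y'_def B_simps)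
        have y'y': "B y' y' = 0"
          using two_neq_0 by (simp add: y'_def B_simps y zz zy)
        have y'u: "B (u i) y' = 0" if "i < k" for i
          using y(2)[OF that] zu[OF that] by (simp add: y'_def B_simps B_sym[of "u i" y])
        let ?c = "(a k - 1) / a k"
        let ?h = "\<lambda>x. x + ((?c - 1) * B x y') *s z + ((inverse ?c - 1) * B x z) *s y'"
        have h: "isom ?h" by (rule isom_hyperbolic) fact+
        have hu: "?h (u i) = u i" if "i < k" for i using zu[OF that] y'u[OF that] by simp
        have hz: "?h z = ?c *s z" using zz y'z by (simp add: B_sym[of z y'] scale_left_diff_distrib)
        have "?h v = (\<Sum>i<k. a i *s ?h (u i)) + a k *s ?h z"
          unfolding va isom_add[OF h] isom_sum[OF h] isom_scale[OF h] ..
        also have "(\<Sum>i<k. a i *s ?h (u i)) = s"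
          unfolding s_def by (intro sum.cong refl) (simp only: hu lessThan_iff)
        also have "s + a k *s ?h z = s + a k *s (?c *s z)" by (simp only: hz)
        also have "\<dots> = w" using \<open>a k \<noteq> 0\<close> by (simp add: ws)
        finally show ?thesis using h hu by blast
      qed
    qed
  qed
qed

text \<open>An isometry that is right on the first k vectors is followed by one that fixes their
  images and moves the image of the next vector to its target.\<close>

theorem witt:
  assumes "\<And>i. i < k \<Longrightarrow> u i \<in> V" "\<And>i. i < k \<Longrightarrow> w i \<in> V"
    and "indep_upto u k" "indep_upto w k"
    and "\<And>i j. i < k \<Longrightarrow> j < k \<Longrightarrow> B (u i) (u j) = B (w i) (w j)"
  shows "\<exists>h. isom h \<and> (\<forall>i<k. h (u i) = w i)"
  using assms
proof (induction k)
  case 0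
  show ?case using isom_id by blast
next
  case (Suc k)
  have "indep_upto u k" "indep_upto w k" using Suc.prems(3,4) by (auto dest: indep_upto_SucD)
  with Suc obtain h where h: "isom h" "\<And>i. i < k \<Longrightarrow> h (u i) = w i" by (metis less_SucI)
  have hu: "B (h (u i)) (h (u j)) = B (w i) (w j)" if "i < Suc k" "j < Suc k" for i j
    using isom_B[OF h(1)] Suc.prems that by simp
  have inj: "h x = 0 \<Longrightarrow> x \<in> V \<Longrightarrow> x = 0" for x
    using isom_inj_on[OF h(1)] isom_0[OF h(1)] V_closed by (metis inj_on_eq_iff)
  have "indep_upto (\<lambda>i. h (u i)) (Suc k)"
    unfolding indep_upto_def
  proof (intro allI impI)
    fix c i assume c: "(\<Sum>i<Suc k. c i *s h (u i)) = 0" and i: "i < Suc k"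
    have "h (\<Sum>i<Suc k. c i *s u i) = 0" using c by (simp only: isom_sum[OF h(1)] isom_scale[OF h(1)])
    moreover have "(\<Sum>i<Suc k. c i *s u i) \<in> V" using Suc.prems by (intro V_sum V_closed) auto
    ultimately have "(\<Sum>i<Suc k. c i *s u i) = 0" by (rule inj)
    then show "c i = 0" using indep_uptoD[OF Suc.prems(3)] i by blast
  qed
  then have 1: "indep_upto (w(k := h (u k))) (Suc k)"
    using h(2) by (subst indep_upto_cong[of _ _ "\<lambda>i. h (u i)"]) auto
  have 2: "indep_upto (w(k := w k)) (Suc k)" using Suc.prems(4) by simp
  have "\<exists>h'. isom h' \<and> (\<forall>i<k. h' (w i) = w i) \<and> h' (h (u k)) = w k"
  proof (rule witt_step[OF _ _ _ 1 2])
    show "B (h (u k)) (w i) = B (w k) (w i)" if "i < k" for i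
      using hu[of k i] h(2)[OF that] that by simp
  qed (use Suc.prems hu isom_V[OF h(1)] in auto)
  then obtain h' where h': "isom h'" "\<forall>i<k. h' (w i) = w i" "h' (h (u k)) = w k" by blast
  have "isom (\<lambda>x. h' (h x))" using h'(1) h(1) by (rule isom_comp)
  moreover have "\<forall>i<Suc k. h' (h (u i)) = w i" using h(2) h'(2,3) by (auto simp: less_Suc_eq)
  ultimately show ?case by blast
qed

end


section \<open>Vectors with prescribed annihilator\<close>

context quad_space
begin

section \<open>Polynomials acting through a linear map; annihilators\<close>

definition pact :: "('v \<Rightarrow> 'v) \<Rightarrow> 'a poly \<Rightarrow> 'v \<Rightarrow> 'v" where
  "pact T p v = (\<Sum>i\<le>degree p. scale (coeff p i) ((T ^^ i) v))"

definition lin :: "('v \<Rightarrow> 'v) \<Rightarrow> bool" where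
  "lin h \<longleftrightarrow> (\<forall>x y. h (x + y) = h x + h y) \<and> (\<forall>c x. h (scale c x) = scale c (h x))"

lemma lin_add: "lin h \<Longrightarrow> h (x + y) = h x + h y"
  by (simp add: lin_def)

lemma lin_scale: "lin h \<Longrightarrow> h (scale c x) = scale c (h x)"
  by (simp add: lin_def)

lemma lin_0: "lin h \<Longrightarrow> h 0 = 0"
  using lin_scale[of h 0 0] by simp

lemma lin_sum: "lin h \<Longrightarrow> h (\<Sum>i\<in>I. f i) = (\<Sum>i\<in>I. h (f i))"
  by (induction I rule: infinite_finite_induct) (auto simp: lin_0 lin_add)

lemma pact_upto: "degree p \<le> n \<Longrightarrow> pact T p v = (\<Sum>i\<le>n. scale (coeff p i) ((T ^^ i) v))"
  unfolding pact_def by (rule sum.mono_neutral_left) (auto simp: coeff_eq_0)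

lemma pact_0 [simp]: "pact T 0 v = 0"
  by (simp add: pact_def)

lemma pact_1 [simp]: "pact T 1 v = v"
  by (simp add: pact_def)

lemma pact_add: "pact T (p + r) v = pact T p v + pact T r v"
  using pact_upto[of p "max (degree p) (degree r)" T v] pact_upto[of r "max (degree p) (degree r)" T v]
    pact_upto[of "p + r" "max (degree p) (degree r)" T v] degree_add_le_max[of p r]
  by (simp add: scale_left_distrib sum.distrib)

lemma pact_smult: "pact T (Polynomial.smult c p) v = scale c (pact T p v)"
  using pact_upto[of "Polynomial.smult c p" "degree p" T v] degree_smult_le[of c p]
  by (simp add: pact_def scale_sum_right)

lemma pact_minus: "pact T (- p) v = - pact T p v"
  using pact_smult[of T "-1" p v] by simp

lemma pact_diff: "pact T (p - r) v = pact T p v - pact T r v"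
  using pact_add[of T p "- r" v] by (simp add: pact_minus)

lemma pact_pCons:
  assumes "lin T"
  shows "pact T (pCons a p) v = scale a v + T (pact T p v)"
proof -
  have "pact T (pCons a p) v = (\<Sum>i\<le>Suc (degree p). scale (coeff (pCons a p) i) ((T ^^ i) v))"
    by (rule pact_upto) (simp add: degree_pCons_le)
  also have "\<dots> = scale a v + (\<Sum>i\<le>degree p. scale (coeff p i) (T ((T ^^ i) v)))"
    by (subst sum.atMost_Suc_shift) simp
  also have "(\<Sum>i\<le>degree p. scale (coeff p i) (T ((T ^^ i) v))) = T (pact T p v)"
    by (simp add: pact_def lin_sum[OF assms] lin_scale[OF assms])
  finally show ?thesis .
qed

lemma pact_mult:
  assumes "lin T"
  shows "pact T (p * r) v = pact T p (pact T r v)"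
  by (induction p) (simp_all add: pact_add pact_smult pact_pCons[OF assms] assms)

lemma lin_pact:
  assumes "lin T"
  shows "lin (pact T p)"
proof (induction p)
  case (pCons a p)
  then show ?case
    by (simp add: lin_def pact_pCons[OF assms] lin_add[OF assms] lin_scale[OF assms] scale_right_distrib mult.commute)
qed (simp add: lin_def)

lemma pact_in_subspace:
  assumes "subspace W" "\<And>x. x \<in> W \<Longrightarrow> T x \<in> W" "v \<in> W"
  shows "pact T p v \<in> W"
proof -
  have "(T ^^ i) v \<in> W" for i by (induction i) (use assms in auto)
  then show ?thesis unfolding pact_def using assms by (intro subspace_sum subspace_scale)
qed

definition annihilator :: "('v \<Rightarrow> 'v) \<Rightarrow> 'v \<Rightarrow> 'a poly \<Rightarrow> bool" where
  "annihilator T v f \<longleftrightarrow> (\<forall>p. pact T p v = 0 \<longleftrightarrow> f dvd p)"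

lemma annihilator_eq_iff:
  assumes "annihilator T v f"
  shows "pact T r v = pact T s v \<longleftrightarrow> f dvd r - s"
proof -
  have "f dvd r - s \<longleftrightarrow> pact T (r - s) v = 0" using assms unfolding annihilator_def by blast
  then show ?thesis by (simp add: pact_diff)
qed

text \<open>A non-zero polynomial of least degree killing v divides every polynomial that kills v,
  hence divides p ^ (k + 1) and is a scalar multiple of some p ^ j. An exponent j below k + 1 would
  let p ^ k kill v.\<close>

lemma annihilator_prime_power:
  assumes T: "lin T" and p: "irreducible p" "monic p"
    and kill: "pact T (p ^ Suc k) v = 0" and nkill: "pact T (p ^ k) v \<noteq> 0"
  shows "annihilator T v (p ^ Suc k)"
  unfolding annihilator_def
proof (intro allI iffI)
  fix r
  show "pact T r v = 0" if d: "p ^ Suc k dvd r"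
  proof -
    obtain h where "r = p ^ Suc k * h" using d by (elim dvdE)
    then have "r = h * p ^ Suc k" by (simp only: mult.commute)
    then show ?thesis using kill by (simp only: pact_mult[OF T] lin_0[OF lin_pact[OF T]])
  qed
next
  fix r assume r: "pact T r v = 0"
  have p0: "p ^ Suc k \<noteq> 0" using p by auto
  obtain a where a: "a \<noteq> 0" "pact T a v = 0"
    and min: "\<And>b. b \<noteq> 0 \<Longrightarrow> pact T b v = 0 \<Longrightarrow> degree a \<le> degree b"
    using p0 kill arg_min_nat_lemma[of "\<lambda>a. a \<noteq> 0 \<and> pact T a v = 0" "p ^ Suc k" degree] by blast
  have dvd: "a dvd b" if "pact T b v = 0" for b
  proof -
    have "pact T (b mod a) v = pact T b v - pact T (b div a * a) v"
      unfolding pact_diff[symmetric] by (simp add: minus_div_mult_eq_mod)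
    also have "\<dots> = 0" using that a by (simp add: pact_mult[OF T] lin_0[OF lin_pact[OF T]])
    finally have "b mod a = 0"
      using min[of "b mod a"] degree_mod_less[OF a(1), of b] by fastforce
    then show ?thesis by (simp add: mod_eq_0_iff_dvd)
  qed
  define j where "j = factor_mult p a"
  have jiff: "p ^ m dvd a \<longleftrightarrow> m \<le> j" for m unfolding j_def by (rule pow_dvd_iff_le_factor_mult[OF p(1) a(1)])
  then obtain s where s: "a = p ^ j * s" by (meson dvdE order_refl)
  have "\<not> p dvd s"
  proof
    assume "p dvd s"
    then have "p ^ Suc j dvd a" by (simp add: s mult_dvd_mono)
    then show False unfolding jiff by simp
  qed
  have "degree s = 0"
  proof (rule ccontr)
    assume "degree s \<noteq> 0"
    then obtain t where t: "irreducible t" "monic t" "t dvd s" using monic_irreducible_divisor by blast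
    then have "t dvd p ^ Suc k" using dvd[OF kill] s by (metis dvd_mult dvd_trans)
    then have "t dvd p" using field_poly_irreducible_imp_prime[OF t(1)] prime_elem_dvd_power by blast
    then have "t = p" using monic_irreducible_dvd_eq t p by blast
    then show False using t(3) \<open>\<not> p dvd s\<close> by simp
  qed
  then obtain c where c: "s = [:c:]" by (elim degree_eq_zeroE)
  then have "c \<noteq> 0" using a s by auto
  have "a = Polynomial.smult c (p ^ j)" using s c by simp
  then have "pact T (p ^ j) v = 0" using a \<open>c \<noteq> 0\<close> by (simp add: pact_smult)
  then have "Suc k \<le> j"
  proof (rule contrapos_pp)
    assume "\<not> Suc k \<le> j"
    then have "p ^ k = p ^ (k - j) * p ^ j" by (simp add: power_add[symmetric])
    then have "pact T (p ^ k) v = pact T (p ^ (k - j)) (pact T (p ^ j) v)" by (simp add: pact_mult[OF T])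
    then show "pact T (p ^ j) v \<noteq> 0" using nkill lin_0[OF lin_pact[OF T]] by auto
  qed
  then have "p ^ Suc k dvd a" using jiff by blast
  then show "p ^ Suc k dvd r" using dvd[OF r] by (rule dvd_trans)
qed

text \<open>The monic polynomials of degree deg f are a system of representatives modulo f, so the
  cyclic module generated by v has at least q ^ deg f elements.\<close>

lemma pact_inj_on_monic_polys:
  assumes "lin T" "annihilator T v f"
  shows "inj_on (\<lambda>r. pact T r v) (monic_polys (degree f))"
proof (rule inj_onI)
  fix r s assume rs: "r \<in> monic_polys (degree f)" "s \<in> monic_polys (degree f)" "pact T r v = pact T s v"
  then have "f dvd r - s" using annihilator_eq_iff[OF assms(2)] by blast
  moreover have "r - s \<noteq> 0 \<Longrightarrow> degree (r - s) < degree f"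
  proof -
    assume "r - s \<noteq> 0"
    show ?thesis
    proof (cases "degree f = 0")
      case True
      then have "r = 1" "s = 1" using rs by (auto simp: monic_polys_def elim!: degree_eq_zeroE)
      with \<open>r - s \<noteq> 0\<close> show ?thesis by simp
    next
      case False
      have "degree (r - s) \<le> degree f" using rs degree_diff_le[of r "degree f" s] by (simp add: monic_polys_def)
      moreover have "coeff (r - s) (degree f) = 0" using rs by (auto simp: monic_polys_def)
      then have "degree (r - s) \<noteq> degree f" using \<open>r - s \<noteq> 0\<close> by (metis leading_coeff_0_iff)
      ultimately show ?thesis by simp
    qed
  qed
  ultimately show "r = s" using dvd_imp_degree_le[of f "r - s"] by fastforce
qed


section \<open>Gram data of a vector under an isometry\<close>

lemma isom_lin: "isom h \<Longrightarrow> lin h"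
  by (simp add: isom_def lin_def)

lemma isom_pow_V: "isom g \<Longrightarrow> v \<in> V \<Longrightarrow> (g ^^ i) v \<in> V"
  by (induction i) (auto simp: isom_V)

lemma isom_pow_B: "isom g \<Longrightarrow> v \<in> V \<Longrightarrow> w \<in> V \<Longrightarrow> B ((g ^^ i) v) ((g ^^ i) w) = B v w"
  by (induction i) (auto simp: isom_B isom_pow_V)

lemma isom_pow_B_add:
  assumes "isom g" "v \<in> V"
  shows "B ((g ^^ (i + j)) v) ((g ^^ i) v) = B ((g ^^ j) v) v"
  using isom_pow_B[OF assms(1) isom_pow_V[OF assms, of j] assms(2), of i] by (simp add: funpow_add)

definition gram :: "('v \<Rightarrow> 'v) \<Rightarrow> 'v \<Rightarrow> nat \<Rightarrow> 'a" where
  "gram g v i = B ((g ^^ i) v) v"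

lemma B_pow_pow:
  assumes "isom g" "v \<in> V"
  shows "B ((g ^^ i) v) ((g ^^ j) v) = gram g v (if j \<le> i then i - j else j - i)"
proof (cases "j \<le> i")
  case True
  then show ?thesis using isom_pow_B_add[OF assms, of j "i - j"] by (simp add: gram_def)
next
  case False
  then show ?thesis using isom_pow_B_add[OF assms, of i "j - i"] B_sym by (simp add: gram_def)
qed

lemma pact_V: "isom g \<Longrightarrow> v \<in> V \<Longrightarrow> pact g p v \<in> V"
  by (rule pact_in_subspace[OF subspace_V]) (auto simp: isom_V)

lemma indep_of_annihilator:
  assumes "annihilator g v f" "f \<noteq> 0"
  shows "indep_upto (\<lambda>i. (g ^^ i) v) (degree f)"
  unfolding indep_upto_def
proof (intro allI impI)
  fix c i assume c: "(\<Sum>i<degree f. c i *s (g ^^ i) v) = 0" and i: "i < degree f"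
  define p where "p = Poly (map c [0..<degree f])"
  have cp: "coeff p j = (if j < degree f then c j else 0)" for j by (simp add: p_def nth_default_def)
  have deg: "degree p < degree f" if "p \<noteq> 0"
  proof -
    have "degree p \<le> degree f - 1" by (rule degree_le) (auto simp: cp)
    then show ?thesis using i by simp
  qed
  have "pact g p v = (\<Sum>j\<le>degree f. coeff p j *s (g ^^ j) v)"
    by (rule pact_upto) (use deg in \<open>cases "p = 0"; simp\<close>)
  also have "\<dots> = (\<Sum>j<degree f. c j *s (g ^^ j) v)"
    by (rule sum.mono_neutral_cong_right) (auto simp: cp)
  finally have "f dvd p" using assms(1) c by (simp add: annihilator_def)
  then have "p = 0" using deg dvd_imp_degree_le[of f p] by fastforce
  then show "c i = 0" using cp[of i] i by simp
qed

text \<open>The relation \<open>B (f(g) v) (g ^ (K - m) v) = 0\<close> expresses the \<open>m\<close>-th Gram entry through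
  entries of smaller index; at \<open>2 * m = K\<close> the leading and the constant coefficient contribute equally.\<close>

lemma gram_recursion:
  assumes g: "isom g" and v: "v \<in> V" and f: "monic f" "degree f = K" "pact g f v = 0"
    and m: "K \<le> 2 * m" "m < K"
  shows "(\<Sum>i\<in>{0<..<K}. coeff f i * gram g v (if K - m \<le> i then i - (K - m) else K - m - i))
    + gram g v m + coeff f 0 * gram g v (K - m) = 0"
proof -
  let ?F = "\<lambda>i. coeff f i * gram g v (if K - m \<le> i then i - (K - m) else K - m - i)"
  have "0 = B (pact g f v) ((g ^^ (K - m)) v)" using f by (simp add: B_0_left)
  also have "\<dots> = (\<Sum>i\<le>K. ?F i)"
    unfolding pact_def f(2) B_sum_left B_scale_left B_pow_pow[OF g v] ..
  also have "{..K} = insert 0 (insert K {0<..<K})" using m by auto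
  also have "(\<Sum>i\<in>insert 0 (insert K {0<..<K}). ?F i) = ?F 0 + (?F K + (\<Sum>i\<in>{0<..<K}. ?F i))"
    using m by simp
  also have "?F K = gram g v m" using f m by auto
  also have "?F 0 = coeff f 0 * gram g v (K - m)" using m by auto
  finally show ?thesis by (simp add: algebra_simps)
qed

text \<open>Each entry from index K / 2 on follows from earlier ones. For even K the middle entry
  meets itself in the relation with factor 1 + \<open>coeff f 0\<close>; that factor must not
  vanish, which is the origin of the parity and sign condition. It is what makes K / 2 entries
  suffice for even K.\<close>

lemma gram_determined:
  assumes g: "isom g" "isom g'" and v: "v \<in> V" "v' \<in> V" and f: "monic f" "degree f = K"
    and kill: "pact g f v = 0" "pact g' f v' = 0"
    and odd: "odd K \<or> coeff f 0 \<noteq> - 1"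
    and eq: "\<And>i. i < (K + 1) div 2 \<Longrightarrow> gram g v i = gram g' v' i"
    and i: "i < K"
  shows "gram g v i = gram g' v' i"
  using i
proof (induction i rule: less_induct)
  case (less m)
  show ?case
  proof (cases "m < (K + 1) div 2")
    case False
    then have m: "K \<le> 2 * m" "m < K" using less.prems by auto
    let ?S = "\<lambda>g v. \<Sum>i\<in>{0<..<K}. coeff f i * gram g v (if K - m \<le> i then i - (K - m) else K - m - i)"
    have S: "?S g v = ?S g' v'"
      using m less by (intro sum.cong refl arg_cong2[where f = "(*)"]) auto
    have 1: "?S g v + gram g v m + coeff f 0 * gram g v (K - m) = 0"
      using gram_recursion[OF g(1) v(1) f kill(1) m] .
    have 2: "?S g' v' + gram g' v' m + coeff f 0 * gram g' v' (K - m) = 0"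
      using gram_recursion[OF g(2) v(2) f kill(2) m] .
    have alg: "(1 + c) * x = (1 + c) * y" if "s + x + c * x = 0" "s + y + c * y = 0" for s x y c :: 'a
    proof -
      have "s + x + c * x = s + y + c * y" using that by simp
      then show ?thesis by (simp add: distrib_right add.assoc)
    qed
    have alg': "x = y" if "s + x + z = 0" "s + y + z = 0" for s x y z :: 'a
    proof -
      have "s + x + z = s + y + z" using that by simp
      then show ?thesis by simp
    qed
    show ?thesis
    proof (cases "K = 2 * m")
      case True
      then have km: "K - m = m" by simp
      have "(1 + coeff f 0) * gram g v m = (1 + coeff f 0) * gram g' v' m"
        using 1 2 unfolding S unfolding km by (rule alg)
      moreover have "1 + coeff f 0 \<noteq> 0" using odd True by (auto simp: add_eq_0_iff)
      ultimately show ?thesis by simp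
    next
      case False
      then have "gram g v (K - m) = gram g' v' (K - m)" using m by (intro less.IH) auto
      with 1 have 1: "?S g' v' + gram g v m + coeff f 0 * gram g' v' (K - m) = 0" unfolding S by simp
      then show ?thesis using 2 by (rule alg')
    qed
  qed (rule eq)
qed

text \<open>The reflection \<open>?r\<close> of f = p ^ k is prime to f, so it acts bijectively on
  the cyclic module of v, and g^i v is \<open>?r\<close>(g) u for some u in that module. As g is an
  isometry, \<open>?r\<close>(g) is adjoint to f(g) up to a power of g; pairing with v thus produces
  f(g) v = 0.\<close>

lemma gram_nonself:
  assumes g: "isom g" and v: "v \<in> V" and p: "irreducible p" "\<not> p dvd reflect_poly p"
    and ann: "annihilator g v (p ^ k)"
  shows "gram g v i = 0"
proof -
  let ?f = "p ^ k"
  let ?r = "reflect_poly ?f"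
  let ?U = "range (\<lambda>r. pact g r v)"
  note lin = isom_lin[OF g]
  have UV: "?U \<subseteq> V" using pact_V[OF g v] by auto
  have kill: "pact g ?f u = 0" if "u \<in> ?U" for u
    using that ann by (auto simp: pact_mult[OF lin, symmetric] annihilator_def)
  have inj: "inj_on (pact g ?r) ?U"
  proof (rule inj_onI, clarify)
    fix a b assume "pact g ?r (pact g a v) = pact g ?r (pact g b v)"
    then have "pact g (?r * (a - b)) v = 0" by (simp add: pact_mult[OF lin] pact_diff right_diff_distrib)
    then have "?f dvd ?r * (a - b)" using ann by (simp add: annihilator_def)
    moreover have "\<not> p dvd ?r"
      using p field_poly_irreducible_imp_prime[OF p(1)] prime_elem_dvd_power
      by (auto simp: reflect_poly_power)
    ultimately have "?f dvd a - b"
      using prime_elem_power_dvd_cancel field_poly_irreducible_imp_prime[OF p(1)] by blast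
    then show "pact g a v = pact g b v" using annihilator_eq_iff[OF ann] by blast
  qed
  have "pact g ?r ` ?U \<subseteq> ?U" by (auto simp: pact_mult[OF lin, symmetric])
  then have "pact g ?r ` ?U = ?U" using inj UV finite_V finite_subset endo_inj_surj by metis
  moreover have "pact g (monom 1 i) v \<in> ?U" by blast
  ultimately obtain u where u: "u \<in> ?U" "pact g (monom 1 i) v = pact g ?r u" by blast
  have "pact g (monom 1 i) v = (g ^^ i) v"
    using pact_upto[of "monom 1 i" i g v] by (simp add: degree_monom_le if_distrib[of "\<lambda>c. c *s _"] cong: if_cong)
  with u have gi: "(g ^^ i) v = pact g ?r u" by simp
  have uV: "u \<in> V" using u UV by blast
  let ?n = "degree ?f"
  have "v \<in> ?U" by (rule range_eqI[of _ _ 1]) simp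
  \<comment> \<open>Applying g^j to both arguments moves the exponent across and turns the reflected
    coefficients back into those of f.\<close>
  have shift: "B ((g ^^ (?n - j)) u) v = B ((g ^^ ?n) u) ((g ^^ j) v)" if "j \<le> ?n" for j
    using isom_pow_B[OF g isom_pow_V[OF g uV, of "?n - j"] v, of j] that
    by (simp add: funpow_add[symmetric, THEN fun_cong, simplified o_def])
  have "gram g v i = B (pact g ?r u) v" by (simp add: gram_def gi)
  also have "pact g ?r u = (\<Sum>j\<le>?n. coeff ?f (?n - j) *s (g ^^ j) u)"
    by (subst pact_upto[OF degree_reflect_poly_le]) (simp add: coeff_reflect_poly)
  also have "\<dots> = (\<Sum>j\<le>?n. coeff ?f j *s (g ^^ (?n - j)) u)"
    by (rule sum.reindex_bij_witness[of _ "\<lambda>j. ?n - j" "\<lambda>j. ?n - j"]) auto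
  also have "B \<dots> v = (\<Sum>j\<le>?n. coeff ?f j * B ((g ^^ ?n) u) ((g ^^ j) v))"
    by (simp add: B_sum_left B_scale_left shift)
  also have "\<dots> = B ((g ^^ ?n) u) (pact g ?f v)" by (simp add: pact_def B_sum_right B_scale_right)
  also have "\<dots> = 0" using kill[OF \<open>v \<in> ?U\<close>] by (simp add: B_0_right)
  finally show ?thesis .
qed

text \<open>The vectors v, g v, ... span a totally isotropic subspace of dimension deg f. Pairing
  with it recovers the coefficients at a dual family, so together they give 2 * deg f independent
  vectors.\<close>

lemma isotropic_degree_bound:
  assumes g: "isom g" and v: "v \<in> V" and f: "f \<noteq> 0" "annihilator g v f" and z: "\<And>i. gram g v i = 0"
  shows "CARD('a) ^ (2 * degree f) \<le> card V"
proof -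
  let ?D = "degree f"
  let ?u = "\<lambda>i. (g ^^ i) v"
  have ind: "indep_upto ?u ?D" by (rule indep_of_annihilator[OF f(2,1)])
  have uV: "?u i \<in> V" for i using isom_pow_V[OF g v] .
  have uu: "B (?u i) (?u j) = 0" for i j using B_pow_pow[OF g v] z by simp
  obtain y where yV: "\<forall>i<?D. y i \<in> V" and y: "\<forall>i<?D. \<forall>j<?D. B (y i) (?u j) = (if i = j then 1 else 0)"
    using dual_family[OF ind] uV by blast
  let ?P = "PiE {..<?D} (\<lambda>_. UNIV :: 'a set)"
  let ?h = "\<lambda>(a, b). (\<Sum>i<?D. a i *s ?u i) + (\<Sum>i<?D. b i *s y i)"
  have "inj_on ?h (?P \<times> ?P)"
  proof (rule inj_onI, clarify)
    fix a b a' b'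
    assume mem: "a \<in> ?P" "a' \<in> ?P" "b \<in> ?P" "b' \<in> ?P"
      and eq: "(\<Sum>i<?D. a i *s ?u i) + (\<Sum>i<?D. b i *s y i) = (\<Sum>i<?D. a' i *s ?u i) + (\<Sum>i<?D. b' i *s y i)"
    have bb: "b j = b' j" if "j < ?D" for j
    proof -
      have *: "B ((\<Sum>i<?D. a i *s ?u i) + (\<Sum>i<?D. b i *s y i)) (?u j) = b j" for a b
      proof -
        have "(\<Sum>i<?D. b i * B (y i) (?u j)) = (\<Sum>i<?D. if i = j then b j else 0)"
          using y that by (intro sum.cong) auto
        also have "\<dots> = b j" using that by simp
        finally show ?thesis by (simp add: B_add_left B_sum_left B_scale_left uu)
      qed
      show ?thesis using arg_cong[OF eq, of "\<lambda>x. B x (?u j)"] unfolding * .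
    qed
    then have "(\<Sum>i<?D. b i *s y i) = (\<Sum>i<?D. b' i *s y i)" by simp
    with eq have "(\<Sum>i<?D. (a i - a' i) *s ?u i) = 0" by (simp add: scale_left_diff_distrib sum_subtractf)
    then have aa: "a j = a' j" if "j < ?D" for j using indep_uptoD[OF ind, of "\<lambda>i. a i - a' i"] that by simp
    show "a = a' \<and> b = b'"
      by (intro conjI PiE_ext[OF mem(1,2)] PiE_ext[OF mem(3,4)]) (simp_all add: aa bb)
  qed
  moreover have "?h ` (?P \<times> ?P) \<subseteq> V" using uV yV by (auto intro!: V_closed V_sum)
  ultimately have "card (?P \<times> ?P) \<le> card V" using finite_V by (rule card_inj_on_le)
  then show ?thesis by (simp add: card_cartesian_product card_PiE mult_2 power_add)
qed

end

text \<open>Maps satisfying \<open>isom\<close> may agree on \<open>V\<close> and differ outside, so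
  they cannot be counted themselves. \<open>G\<close> represents each of them on \<open>V\<close>,
  by \<open>act_complete\<close>, and by exactly one element, by
  \<open>act_faithful\<close>.\<close>

locale isom_group = quad_space +
  fixes G :: "'g set" and act :: "'g \<Rightarrow> 'b \<Rightarrow> 'b"
  assumes finite_G: "finite G"
    and act_isom: "g \<in> G \<Longrightarrow> isom (act g)"
    and act_complete: "isom h \<Longrightarrow> \<exists>g\<in>G. \<forall>x\<in>V. act g x = h x"
    and act_faithful: "g \<in> G \<Longrightarrow> g' \<in> G \<Longrightarrow> (\<And>x. x \<in> V \<Longrightarrow> act g x = act g' x) \<Longrightarrow> g = g'"
begin

lemma G_nonempty: "G \<noteq> {}"
  using act_complete[OF isom_id] by blast

definition ann_pairs :: "'a poly \<Rightarrow> ('g \<times> 'b) set" where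
  "ann_pairs f = {(g, v). g \<in> G \<and> v \<in> V \<and> annihilator (act g) v f}"

lemma finite_ann_pairs: "finite (ann_pairs f)"
  by (rule finite_subset[of _ "G \<times> V"]) (auto simp: ann_pairs_def finite_G finite_V)

text \<open>By Witt's theorem pairs with equal Gram data lie over one orbit of tuples
  \<open>(v, g v, g^2 v, \<dots>)\<close>, and the stabiliser of a tuple has order \<open>|G|\<close> divided by
  the length of that orbit.\<close>

lemma card_gram_fiber_le:
  assumes f: "monic f" "coeff f 0 \<noteq> 0"
  shows "card {(g, v) \<in> ann_pairs f. \<forall>i<degree f. gram (act g) v i = b i} \<le> card G"
proof -
  let ?K = "degree f"
  let ?X = "{(g, v) \<in> ann_pairs f. \<forall>i<?K. gram (act g) v i = b i}"
  have f0: "f \<noteq> 0" using f by auto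
  let ?t = "\<lambda>(g, v). restrict (\<lambda>i. (act g ^^ i) v) {..<?K}"
  show ?thesis
  proof (cases "?X = {}")
    case False
    then obtain g0 v0 where 0: "(g0, v0) \<in> ?X" by auto
    then have g0: "g0 \<in> G" "v0 \<in> V" "annihilator (act g0) v0 f" "\<And>i. i < ?K \<Longrightarrow> gram (act g0) v0 i = b i"
      by (auto simp: ann_pairs_def)
    have i0: "isom (act g0)" using act_isom g0 by blast
    \<comment> \<open>The chosen isometry depends on the tuple alone and not on the pair that
      produced it; injectivity of \<open>y\<close> below rests on this.\<close>
    define H where "H t = (SOME h. isom h \<and> (\<forall>i<?K. h ((act g0 ^^ i) v0) = t i))" for t
    have H: "isom (H (?t x)) \<and> (\<forall>i<?K. H (?t x) ((act g0 ^^ i) v0) = ?t x i)" if "x \<in> ?X" for x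
    proof -
      obtain g v where x: "x = (g, v)" by fastforce
      have gv: "g \<in> G" "v \<in> V" "annihilator (act g) v f" "\<And>i. i < ?K \<Longrightarrow> gram (act g) v i = b i"
        using that x by (auto simp: ann_pairs_def)
      have ig: "isom (act g)" using act_isom gv by blast
      have "\<exists>h. isom h \<and> (\<forall>i<?K. h ((act g0 ^^ i) v0) = (act g ^^ i) v)"
      proof (rule witt)
        show "B ((act g0 ^^ i) v0) ((act g0 ^^ j) v0) = B ((act g ^^ i) v) ((act g ^^ j) v)"
          if "i < ?K" "j < ?K" for i j
          using that g0(4) gv(4) unfolding B_pow_pow[OF i0 g0(2)] B_pow_pow[OF ig gv(2)] by simp
      qed (use isom_pow_V i0 ig g0 gv f0 in \<open>auto intro: indep_of_annihilator\<close>)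
      then have "\<exists>h. isom h \<and> (\<forall>i<?K. h ((act g0 ^^ i) v0) = ?t x i)" by (auto simp: x)
      then show ?thesis unfolding H_def by (rule someI_ex)
    qed
    \<comment> \<open>The pair x = (g, v) is encoded by the group element g H, where H carries the
      base tuple to that of x. It sends the base tuple to g v, g^2 v, ..., g^K v. These vectors give
      back v, hence the tuple and H, and finally g.\<close>
    define y where "y x = (SOME y. y \<in> G \<and> (\<forall>w\<in>V. act y w = act (fst x) (H (?t x) w)))" for x
    have y: "y x \<in> G \<and> (\<forall>w\<in>V. act (y x) w = act (fst x) (H (?t x) w))" if "x \<in> ?X" for x
    proof -
      have "isom (\<lambda>w. act (fst x) (H (?t x) w))"
      proof (rule isom_comp[of "act (fst x)" "H (?t x)"])
        show "isom (act (fst x))" using that by (intro act_isom) (auto simp: ann_pairs_def)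
        show "isom (H (?t x))" using H[OF that] by blast
      qed
      from act_complete[OF this] have "\<exists>y. y \<in> G \<and> (\<forall>w\<in>V. act y w = act (fst x) (H (?t x) w))" by blast
      then show ?thesis unfolding y_def by (rule someI_ex)
    qed
    have "inj_on y ?X"
    proof (rule inj_onI)
      fix x x' assume x: "x \<in> ?X" and x': "x' \<in> ?X" and eq: "y x = y x'"
      obtain g v where xe: "x = (g, v)" by fastforce
      obtain g' v' where xe': "x' = (g', v')" by fastforce
      have yt: "act (y (g, v)) ((act g0 ^^ i) v0) = (act g ^^ Suc i) v" if "(g, v) \<in> ?X" "i < ?K" for g v i
        using y[OF that(1)] H[OF that(1)] that(2) isom_pow_V[OF i0 g0(2), of i] by simp
      have pw: "(act g ^^ i) v = (act g' ^^ i) v'" if "0 < i" "i \<le> ?K" for i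
        using yt[of g v "i - 1"] yt[of g' v' "i - 1"] x x' eq that by (simp add: xe xe')
      \<comment> \<open>Since f(g) v = 0 and the constant coefficient is non-zero, v is a
        combination of its images under the positive powers of g.\<close>
      have kv: "v = - inverse (coeff f 0) *s (\<Sum>i\<in>{0<..?K}. coeff f i *s (act g ^^ i) v)"
        if "annihilator (act g) v f" for g v
      proof -
        have "pact (act g) f v = 0" using that by (simp add: annihilator_def)
        moreover have "{..?K} = insert 0 {0<..?K}" by auto
        ultimately have "coeff f 0 *s v + (\<Sum>i\<in>{0<..?K}. coeff f i *s (act g ^^ i) v) = 0"
          by (simp add: pact_def)
        then have "coeff f 0 *s v = - (\<Sum>i\<in>{0<..?K}. coeff f i *s (act g ^^ i) v)"
          by (simp add: eq_neg_iff_add_eq_0)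
        then have "inverse (coeff f 0) *s (coeff f 0 *s v) = inverse (coeff f 0) *s (- (\<Sum>i\<in>{0<..?K}. coeff f i *s (act g ^^ i) v))"
          by simp
        then show ?thesis using f(2) by simp
      qed
      have ann: "annihilator (act g) v f" "annihilator (act g') v' f" "g \<in> G" "g' \<in> G"
        using x x' by (auto simp: xe xe' ann_pairs_def)
      have "(\<Sum>i\<in>{0<..?K}. coeff f i *s (act g ^^ i) v) = (\<Sum>i\<in>{0<..?K}. coeff f i *s (act g' ^^ i) v')"
        by (intro sum.cong refl) (simp add: pw)
      then have vv: "v = v'" using kv[OF ann(1)] kv[OF ann(2)] by simp
      have tt: "?t x = ?t x'"
      proof
        fix i
        show "?t x i = ?t x' i" using pw[of i] vv by (cases "i = 0") (auto simp: xe xe')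
      qed
      have "g = g'"
      proof (rule act_faithful)
        fix w assume "w \<in> V"
        then obtain u where u: "u \<in> V" "w = H (?t x) u"
          using isom_surj[of "H (?t x)"] H[OF x] by blast
        have "act g w = act (y x) u" using y[OF x] u by (simp add: xe)
        also have "\<dots> = act g' w" using y[OF x'] u eq tt by (simp add: xe xe')
        finally show "act g w = act g' w" .
      qed (use ann in auto)
      with vv show "x = x'" by (simp add: xe xe')
    qed
    then show ?thesis using y finite_G by (intro card_inj_on_le[of y]) auto
  qed (simp only: card.empty)
qed

text \<open>\<open>key\<close> is any invariant of the pair that determines all Gram data; each of
  its values accounts for at most |G| pairs.\<close>

lemma card_ann_pairs_le:
  fixes key :: "'g \<times> 'b \<Rightarrow> 'k"
  assumes f: "monic f" "coeff f 0 \<noteq> 0"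
    and key: "\<And>g v g' v'. (g, v) \<in> ann_pairs f \<Longrightarrow> (g', v') \<in> ann_pairs f \<Longrightarrow> key (g, v) = key (g', v') \<Longrightarrow>
      (\<forall>i<degree f. gram (act g) v i = gram (act g') v' i)"
  shows "card (ann_pairs f) \<le> card (key ` ann_pairs f) * card G"
proof -
  have eq: "ann_pairs f = (\<Union>k\<in>key ` ann_pairs f. {x \<in> ann_pairs f. key x = k})" by auto
  have "card (ann_pairs f) = card (\<Union>k\<in>key ` ann_pairs f. {x \<in> ann_pairs f. key x = k})"
    by (rule arg_cong[OF eq])
  also have "\<dots> \<le> (\<Sum>k\<in>key ` ann_pairs f. card {x \<in> ann_pairs f. key x = k})"
    by (rule card_UN_le) (rule finite_imageI[OF finite_ann_pairs])
  also have "\<dots> \<le> (\<Sum>k\<in>key ` ann_pairs f. card G)"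
  proof (rule sum_mono)
    fix k assume "k \<in> key ` ann_pairs f"
    then obtain g0 v0 where k: "k = key (g0, v0)" "(g0, v0) \<in> ann_pairs f" by auto
    have "{x \<in> ann_pairs f. key x = k} \<subseteq> {(g, v) \<in> ann_pairs f. \<forall>i<degree f. gram (act g) v i = gram (act g0) v0 i}"
    proof
      fix x assume x: "x \<in> {x \<in> ann_pairs f. key x = k}"
      obtain g v where gv: "x = (g, v)" by fastforce
      then have "(g, v) \<in> ann_pairs f" "key (g, v) = key (g0, v0)" using x k by auto
      then show "x \<in> {(g, v) \<in> ann_pairs f. \<forall>i<degree f. gram (act g) v i = gram (act g0) v0 i}"
        using key[OF _ k(2), of g v] by (simp add: gv)
    qed
    then have "card {x \<in> ann_pairs f. key x = k} \<le> card {(g, v) \<in> ann_pairs f. \<forall>i<degree f. gram (act g) v i = gram (act g0) v0 i}"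
      by (rule card_mono[rotated]) (rule finite_subset[OF _ finite_ann_pairs[of f]], auto)
    also have "\<dots> \<le> card G" by (rule card_gram_fiber_le[OF f])
    finally show "card {x \<in> ann_pairs f. key x = k} \<le> card G" .
  qed
  finally show ?thesis by simp
qed

lemma card_ann_pairs_nonself:
  assumes "irreducible p" "monic p" "coeff p 0 \<noteq> 0" "\<not> p dvd reflect_poly p"
  shows "card (ann_pairs (p ^ k)) \<le> card G"
proof -
  have "card (ann_pairs (p ^ k)) \<le> card ((\<lambda>_. ()) ` ann_pairs (p ^ k)) * card G"
  proof (rule card_ann_pairs_le)
    show "monic (p ^ k)" using assms(2) by (simp add: lead_coeff_power)
    show "coeff (p ^ k) 0 \<noteq> 0" using assms(3) by (simp add: poly_0_coeff_0[symmetric])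
    show "\<forall>i<degree (p ^ k). gram (act g) v i = gram (act g') v' i"
      if "(g, v) \<in> ann_pairs (p ^ k)" "(g', v') \<in> ann_pairs (p ^ k)" for g v g' v'
      using that act_isom gram_nonself[OF _ _ assms(1,4)] by (auto simp: ann_pairs_def)
  qed
  also have "card ((\<lambda>_. ()) ` ann_pairs (p ^ k)) \<le> 1" by (rule order_trans[OF card_mono[of "{()}"]]) auto
  finally show ?thesis by simp
qed

lemma card_ann_pairs_self:
  assumes "monic f" "coeff f 0 \<noteq> 0" "odd (degree f) \<or> coeff f 0 \<noteq> - 1"
  shows "card (ann_pairs f) \<le> CARD('a) ^ ((degree f + 1) div 2) * card G"
proof -
  let ?n = "(degree f + 1) div 2"
  let ?key = "\<lambda>(g, v). restrict (gram (act g) v) {..<?n}"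
  have "card (ann_pairs f) \<le> card (?key ` ann_pairs f) * card G"
  proof (rule card_ann_pairs_le[OF assms(1,2)])
    fix g v g' v'
    assume *: "(g, v) \<in> ann_pairs f" "(g', v') \<in> ann_pairs f" "?key (g, v) = ?key (g', v')"
    have eq: "gram (act g) v i = gram (act g') v' i" if "i < ?n" for i
      using fun_cong[OF *(3), of i] that by simp
    have mem: "g \<in> G" "g' \<in> G" "v \<in> V" "v' \<in> V" using * by (auto simp: ann_pairs_def)
    have "annihilator (act g) v f" "annihilator (act g') v' f" using * by (auto simp: ann_pairs_def)
    then have kill: "pact (act g) f v = 0" "pact (act g') f v' = 0" unfolding annihilator_def by simp_all
    show "\<forall>i<degree f. gram (act g) v i = gram (act g') v' i"
      using gram_determined[OF act_isom[OF mem(1)] act_isom[OF mem(2)] mem(3,4) assms(1) refl kill assms(3) eq]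
      by blast
  qed
  also have "card (?key ` ann_pairs f) \<le> card (PiE {..<?n} (\<lambda>_. UNIV :: 'a set))"
    by (rule card_mono) (auto intro!: finite_PiE split: if_splits)
  finally show ?thesis by (simp add: card_PiE)
qed

end


section \<open>Multiplicity and primary components\<close>

lemma sum_linear_two_thirds: "(\<Sum>k=1..n. real k * (2 / 3) ^ k) \<le> 6"
proof -
  have "(\<Sum>k=1..n. real k * (2 / 3) ^ k) = 6 - (2 * real n + 6) * (2 / 3) ^ n"
    by (induction n) (auto simp: field_simps)
  then show ?thesis by simp
qed

context quad_space
begin

definition kernel_of :: "('v \<Rightarrow> 'v) \<Rightarrow> 'a poly \<Rightarrow> 'v set" where
  "kernel_of g f = {v \<in> V. pact g f v = 0}"

definition primary_part :: "('v \<Rightarrow> 'v) \<Rightarrow> 'a poly \<Rightarrow> 'v set" where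
  "primary_part g p = (\<Union>k. kernel_of g (p ^ k))"

definition ann_vectors :: "('v \<Rightarrow> 'v) \<Rightarrow> 'a poly \<Rightarrow> 'v set" where
  "ann_vectors g f = {v \<in> V. annihilator g v f}"

lemma kernel_of_subset: "kernel_of g f \<subseteq> V"
  by (auto simp: kernel_of_def)

lemma finite_kernel_of: "finite (kernel_of g f)"
  using kernel_of_subset finite_V by (rule finite_subset)

lemma finite_ann_vectors: "finite (ann_vectors g f)"
  by (rule finite_subset[OF _ finite_V]) (auto simp: ann_vectors_def)

lemma kernel_of_dvd:
  assumes "isom g" "f dvd h" shows "kernel_of g f \<subseteq> kernel_of g h"
proof
  fix v assume v: "v \<in> kernel_of g f"
  obtain r where "h = f * r" using assms(2) by (elim dvdE)
  then have "h = r * f" by (simp only: mult.commute)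
  then show "v \<in> kernel_of g h"
    using v by (simp add: kernel_of_def pact_mult[OF isom_lin[OF assms(1)]] lin_0[OF lin_pact[OF isom_lin[OF assms(1)]]])
qed

lemma kernel_of_add: "isom g \<Longrightarrow> x \<in> kernel_of g f \<Longrightarrow> y \<in> kernel_of g f \<Longrightarrow> x + y \<in> kernel_of g f"
  by (simp add: kernel_of_def V_closed lin_add[OF lin_pact[OF isom_lin]])

lemma kernel_of_scale: "isom g \<Longrightarrow> x \<in> kernel_of g f \<Longrightarrow> c *s x \<in> kernel_of g f"
  by (simp add: kernel_of_def V_closed lin_scale[OF lin_pact[OF isom_lin]])

lemma primary_part_eq_kernel:
  assumes "isom g"
  shows "\<exists>k. primary_part g p = kernel_of g (p ^ k)"
proof -
  have fin: "finite (primary_part g p)"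
    by (rule finite_subset[OF _ finite_V]) (auto simp: primary_part_def kernel_of_def)
  have "\<forall>v\<in>primary_part g p. \<exists>k. v \<in> kernel_of g (p ^ k)" by (auto simp: primary_part_def)
  then obtain e where e: "\<forall>v\<in>primary_part g p. v \<in> kernel_of g (p ^ e v)" by (rule bchoice[THEN exE])
  let ?k = "\<Sum>v\<in>primary_part g p. e v"
  have "primary_part g p \<subseteq> kernel_of g (p ^ ?k)"
  proof
    fix v assume v: "v \<in> primary_part g p"
    then have "e v \<le> ?k" using fin by (intro member_le_sum) auto
    then have "kernel_of g (p ^ e v) \<subseteq> kernel_of g (p ^ ?k)" by (intro kernel_of_dvd assms le_imp_power_dvd)
    then show "v \<in> kernel_of g (p ^ ?k)" using e v by blast
  qed
  then show ?thesis by (intro exI[of _ ?k]) (auto simp: primary_part_def)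
qed

text \<open>The whole cyclic module generated by v is killed by f.\<close>

lemma card_monic_le_kernel:
  assumes g: "isom g" and v: "v \<in> V" "annihilator g v f"
  shows "CARD('a) ^ degree f \<le> card (kernel_of g f)"
proof -
  have "(\<lambda>r. pact g r v) ` monic_polys (degree f) \<subseteq> kernel_of g f"
  proof clarify
    fix r :: "'a poly"
    have "pact g (f * r) v = 0" using v(2) by (simp add: annihilator_def)
    then show "pact g r v \<in> kernel_of g f"
      using pact_V[OF g v(1)] by (simp add: kernel_of_def pact_mult[OF isom_lin[OF g]])
  qed
  then have "card (monic_polys (degree f) :: 'a poly set) \<le> card (kernel_of g f)"
    using pact_inj_on_monic_polys[OF isom_lin[OF g] v(2)] finite_kernel_of by (intro card_inj_on_le)
  then show ?thesis by (simp add: card_monic_polys)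
qed

text \<open>With k the least exponent for which the kernel of p ^ k is the whole primary part, every
  vector outside the kernel of p ^ (k - 1) has annihilator p ^ k. A translate of that smaller kernel
  lies outside it, so these vectors make up at least half. Applying p ^ (k - 1) to one of them gives
  a vector with annihilator p; the kernel of p therefore has at least q ^ deg p elements, and the
  non-zero ones all have annihilator p.\<close>

lemma primary_part_cases:
  assumes g: "isom g" and p: "irreducible p" "monic p" and nz: "1 < card (primary_part g p)"
  obtains k where "1 \<le> k" "card (primary_part g p) \<le> 2 * card (ann_vectors g (p ^ k))"
    "CARD('a) ^ (degree p * k) \<le> card (primary_part g p)"
    "CARD('a) ^ degree p - 1 \<le> card (ann_vectors g p)"
proof -
  note lin = isom_lin[OF g]
  define k where "k = (LEAST k. primary_part g p = kernel_of g (p ^ k))"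
  have k: "primary_part g p = kernel_of g (p ^ k)"
    unfolding k_def using primary_part_eq_kernel[OF g] by (rule LeastI_ex)
  have "k \<noteq> 0"
  proof
    assume "k = 0"
    then have "primary_part g p \<subseteq> {0}" using k by (auto simp: kernel_of_def)
    then have "card (primary_part g p) \<le> 1" using card_mono[of "{0}" "primary_part g p"] by simp
    with nz show False by simp
  qed
  then obtain j where j: "k = Suc j" using not0_implies_Suc by blast
  have "primary_part g p \<noteq> kernel_of g (p ^ j)"
    using not_less_Least[of j "\<lambda>k. primary_part g p = kernel_of g (p ^ k)"] j k_def by simp
  moreover have sub: "kernel_of g (p ^ j) \<subseteq> kernel_of g (p ^ k)" using g j by (intro kernel_of_dvd) auto
  ultimately obtain v where v: "v \<in> kernel_of g (p ^ k)" "v \<notin> kernel_of g (p ^ j)" using k by blast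
  have ann: "annihilator g w (p ^ k)" if "w \<in> kernel_of g (p ^ k)" "w \<notin> kernel_of g (p ^ j)" for w
    using that annihilator_prime_power[OF lin p, of j w] j by (simp add: kernel_of_def)
  have vV: "v \<in> V" using v by (simp add: kernel_of_def)
  have p0: "p \<noteq> 0" using p by auto
  have 1: "CARD('a) ^ (degree p * k) \<le> card (primary_part g p)"
    using card_monic_le_kernel[OF g vV ann[OF v]] p0 by (simp add: k degree_power_eq mult.commute)
  have "(+) v ` kernel_of g (p ^ j) \<subseteq> kernel_of g (p ^ k) - kernel_of g (p ^ j)"
  proof clarify
    fix x assume x: "x \<in> kernel_of g (p ^ j)"
    have "v + x \<in> kernel_of g (p ^ k)" using kernel_of_add[OF g v(1)] x sub by blast
    moreover have "v + x \<notin> kernel_of g (p ^ j)"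
    proof
      assume "v + x \<in> kernel_of g (p ^ j)"
      then have "v + x + (-1) *s x \<in> kernel_of g (p ^ j)" using kernel_of_add[OF g] kernel_of_scale[OF g x] by blast
      then show False using v by simp
    qed
    ultimately show "v + x \<in> kernel_of g (p ^ k) - kernel_of g (p ^ j)" by blast
  qed
  then have "card (kernel_of g (p ^ j)) \<le> card (kernel_of g (p ^ k) - kernel_of g (p ^ j))"
    by (intro card_inj_on_le[of "(+) v"]) (auto simp: finite_kernel_of inj_on_def)
  also have "\<dots> = card (kernel_of g (p ^ k)) - card (kernel_of g (p ^ j))"
    by (rule card_Diff_subset[OF finite_kernel_of sub])
  finally have "card (kernel_of g (p ^ k)) \<le> 2 * card (kernel_of g (p ^ k) - kernel_of g (p ^ j))"
    using card_Diff_subset[OF finite_kernel_of sub] card_mono[OF finite_kernel_of sub] by linarith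
  also have "card (kernel_of g (p ^ k) - kernel_of g (p ^ j)) \<le> card (ann_vectors g (p ^ k))"
    using ann by (intro card_mono finite_ann_vectors) (auto simp: ann_vectors_def kernel_of_def)
  finally have 2: "card (primary_part g p) \<le> 2 * card (ann_vectors g (p ^ k))" using k by simp
  define v' where "v' = pact g (p ^ j) v"
  have v'V: "v' \<in> V" using pact_V[OF g vV] by (simp add: v'_def)
  have a1: "annihilator g w p" if "w \<in> V" "pact g p w = 0" "w \<noteq> 0" for w
    using annihilator_prime_power[OF lin p, of 0 w] that by simp
  have "pact g p v' = pact g (p ^ k) v" by (simp add: v'_def pact_mult[OF lin, symmetric] j)
  then have "annihilator g v' p" using v v'V vV by (intro a1) (auto simp: kernel_of_def v'_def)
  from card_monic_le_kernel[OF g v'V this] have "CARD('a) ^ degree p \<le> card (kernel_of g p)" .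
  moreover have "kernel_of g p - {0} \<subseteq> ann_vectors g p" using a1 by (auto simp: kernel_of_def ann_vectors_def)
  then have "card (kernel_of g p - {0}) \<le> card (ann_vectors g p)" by (intro card_mono finite_ann_vectors)
  moreover have "card (kernel_of g p) - 1 \<le> card (kernel_of g p - {0})" 
    using V_closed(4) lin_0[OF lin_pact[OF lin]] by (subst card_Diff_singleton) (auto simp: kernel_of_def)
  ultimately have 3: "CARD('a) ^ degree p - 1 \<le> card (ann_vectors g p)" by linarith
  show ?thesis using that[OF _ 2 1 3] j by simp
qed

text \<open>A weighted count of vectors with prescribed annihilator dominates the multiplicity;
  it charges only order \<open>x^2\<close> to the event that the multiplicity exceeds \<open>1\<close>.\<close>

lemma multiplicity_le:
  assumes g: "isom g" and p: "irreducible p" "monic p" and n: "card V = CARD('a) ^ n"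
    and m: "CARD('a) ^ (degree p * m) \<le> card (primary_part g p)"
  defines "x \<equiv> 1 / real CARD('a) ^ degree p"
  shows "real m \<le> real (card (ann_vectors g p)) / (real CARD('a) ^ degree p - 1)
    + 4 * x\<^sup>2 * real (card (ann_vectors g p)) + (\<Sum>k=2..n. 2 * real k * x ^ k * real (card (ann_vectors g (p ^ k))))"
    (is "_ \<le> ?A + ?B + ?C")
proof -
  let ?q = "real CARD('a)"
  let ?D = "degree p"
  let ?N = "\<lambda>k. real (card (ann_vectors g (p ^ k)))"
  have q: "2 \<le> ?q" using CARD_ge_2[where 'a = 'a] by simp
  have D: "0 < ?D" using p by (intro irreducible_degree_pos)
  have "?q ^ 1 \<le> ?q ^ ?D" using D q by (intro power_increasing) auto
  then have qD: "2 \<le> ?q ^ ?D" using q unfolding power_one_right by (rule order_trans[rotated])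
  have x: "0 < x" "x \<le> 1 / 2" using qD by (auto simp: x_def field_simps)
  have A0: "0 \<le> ?A" using qD by simp
  have B0: "0 \<le> ?B" by simp
  have C0: "0 \<le> ?C" using x by (intro sum_nonneg) auto
  show ?thesis
  proof (cases "m = 0")
    case True
    then have "real m = 0" by simp
    then show ?thesis using A0 B0 C0 by linarith
  next
    case False
    have "?D * m \<noteq> 0" using False D by simp
    then have "1 < CARD('a) ^ (?D * m)" using CARD_ge_2[where 'a = 'a] by (intro one_less_power) auto
    then have "1 < card (primary_part g p)" using m by linarith
    then obtain k where k: "1 \<le> k" "card (primary_part g p) \<le> 2 * card (ann_vectors g (p ^ k))"
      "CARD('a) ^ (?D * k) \<le> card (primary_part g p)" "CARD('a) ^ ?D - 1 \<le> card (ann_vectors g p)"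
      by (rule primary_part_cases[OF g p])
    have "real (CARD('a) ^ ?D) - 1 \<le> real (card (ann_vectors g p))" using k(4) by linarith
    \<comment> \<open>The first summand alone settles m = 1; the other two are needed only for
      larger m.\<close>
    then have A1: "1 \<le> ?A" using qD by (simp add: le_divide_eq)
    let ?M = "real (card (primary_part g p))"
    have M: "?M \<le> 2 * ?N k" using k(2) by linarith
    have xM: "1 \<le> x ^ j * ?M" if "CARD('a) ^ (?D * j) \<le> card (primary_part g p)" for j
    proof -
      have "?q ^ (?D * j) \<le> ?M" using that by (metis of_nat_le_iff of_nat_power)
      moreover have "x ^ j = 1 / ?q ^ (?D * j)" by (simp only: x_def power_one_over power_mult)
      moreover have "0 < ?q ^ (?D * j)" using q by simp
      ultimately show ?thesis by (simp only: times_divide_eq_left mult_1 le_divide_eq_1_pos)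
    qed
    have xm: "1 \<le> x ^ m * ?M" and xk: "1 \<le> x ^ k * ?M" using xM m k(3) by auto
    show ?thesis
    proof (cases "m = 1")
      case True
      then have "real m = 1" by simp
      then show ?thesis using A1 B0 C0 by linarith
    next
      case m1: False
      \<comment> \<open>From x ^ m * M \<ge> 1 and x \<le> 1/2 follows x ^ k * M \<ge> 2 ^ (m - k),
        while k * 2 ^ (m - k) \<ge> k * (m - k + 1) \<ge> m.\<close>
      have pow: "real m \<le> real k * (x ^ k * ?M)" if "k \<le> m"
      proof -
        have "real m \<le> real k * 2 ^ (m - k)"
        proof -
          have "m - k + 1 \<le> 2 ^ (m - k)" using less_exp[of "m - k"] by linarith
          then have "k * (m - k + 1) \<le> k * 2 ^ (m - k)" by (rule mult_le_mono2)
          moreover have "1 * (m - k) \<le> k * (m - k)" using k(1) by (rule mult_le_mono1)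
          then have "m \<le> k * (m - k + 1)" using that unfolding distrib_left mult_1_right by linarith
          ultimately have "m \<le> k * 2 ^ (m - k)" by linarith
          then show ?thesis by (metis of_nat_le_iff of_nat_mult of_nat_numeral of_nat_power)
        qed
        also have "2 ^ (m - k) \<le> x ^ k * ?M"
        proof -
          have "(2 :: real) ^ (m - k) * 1 \<le> 2 ^ (m - k) * (x ^ m * ?M)" using xm by (intro mult_left_mono) auto
          also have "x ^ m = x ^ (m - k) * x ^ k" using that by (simp add: power_add[symmetric])
          also have "2 ^ (m - k) * (x ^ (m - k) * x ^ k * ?M) = (2 * x) ^ (m - k) * (x ^ k * ?M)"
            by (simp add: power_mult_distrib mult_ac)
          also have "\<dots> \<le> 1 * (x ^ k * ?M)" using x by (intro mult_right_mono power_le_one) auto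
          finally show ?thesis by simp
        qed
        finally show ?thesis by (simp add: mult_left_mono)
      qed
      show ?thesis
      proof (cases "k = 1")
        case True
        have m2: "m - 2 + 2 = m" using m1 \<open>m \<noteq> 0\<close> by linarith
        \<comment> \<open>For k = 1 the sum in \<open>?C\<close>, which starts at 2, gives nothing.
          Here m \<ge> 2, and comparing M with x ^ - m while keeping two factors x yields the
          quadratic term \<open>?B\<close>.\<close>
        have "real m \<le> 2 * (x\<^sup>2 * ?M)"
        proof -
          have "m - 2 + 1 \<le> 2 ^ (m - 2)" using less_exp[of "m - 2"] by linarith
          then have "m \<le> 2 * 2 ^ (m - 2)" using m1 False by linarith
          then have "real m \<le> real (2 * 2 ^ (m - 2))" by (simp only: of_nat_le_iff)
          also have "\<dots> = 2 * 2 ^ (m - 2)" by simp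
          also have "(2 :: real) ^ (m - 2) \<le> x\<^sup>2 * ?M"
          proof -
            have "(2 :: real) ^ (m - 2) * 1 \<le> 2 ^ (m - 2) * (x ^ m * ?M)" using xm by (intro mult_left_mono) auto
            also have "x ^ m = x ^ (m - 2) * x\<^sup>2" by (simp only: power_add[symmetric] m2)
            also have "2 ^ (m - 2) * (x ^ (m - 2) * x\<^sup>2 * ?M) = (2 * x) ^ (m - 2) * (x\<^sup>2 * ?M)"
              by (simp add: power_mult_distrib mult_ac)
            also have "\<dots> \<le> 1 * (x\<^sup>2 * ?M)" using x by (intro mult_right_mono power_le_one) auto
            finally show ?thesis by simp
          qed
          finally show ?thesis by simp
        qed
        also have "\<dots> \<le> 2 * (x\<^sup>2 * (2 * ?N 1))" using M True by (intro mult_left_mono) auto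
        finally have "real m \<le> ?B" by (simp add: mult_ac)
        then show ?thesis using A0 C0 by linarith
      next
        case False
        then have k2: "2 \<le> k" using k(1) by simp
        \<comment> \<open>The index k must be shown to lie in the range of the sum
          \<open>?C\<close>.\<close>
        have "CARD('a) ^ (?D * k) \<le> CARD('a) ^ n"
          unfolding n[symmetric] using k(3)
          by (rule order_trans) (rule card_mono[OF finite_V], auto simp: primary_part_def kernel_of_def)
        then have "?D * k \<le> n" using CARD_ge_2[where 'a = 'a] by (subst (asm) power_increasing_iff) auto
        moreover have "1 * k \<le> ?D * k" using D by (intro mult_le_mono1) simp
        ultimately have kn: "k \<le> n" by linarith
        have "real m \<le> real k * (x ^ k * ?M)"
        proof (cases "k \<le> m")
          case False
          have "real m \<le> real k * 1" using False by simp
          also have "\<dots> \<le> real k * (x ^ k * ?M)" using xk by (intro mult_left_mono) auto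
          finally show ?thesis .
        qed (rule pow)
        also have "\<dots> \<le> real k * (x ^ k * (2 * ?N k))" using M x by (intro mult_left_mono) auto
        also have "\<dots> = (\<Sum>k\<in>{k}. 2 * real k * x ^ k * ?N k)" by simp
        also have "\<dots> \<le> ?C" using k2 kn x by (intro sum_mono2) auto
        finally show ?thesis using A0 B0 by linarith
      qed
    qed
  qed
qed

end


section \<open>Irreducible factors of characteristic polynomials\<close>

lemma dvd_prod_diff:
  fixes p :: "'a :: comm_ring_1"
  assumes "\<And>i. i \<in> I \<Longrightarrow> p dvd f i - g i"
  shows "p dvd prod f I - prod g I"
  using assms
proof (induction I rule: infinite_finite_induct)
  case (insert i I)
  have "prod f (insert i I) - prod g (insert i I) = f i * (prod f I - prod g I) + (f i - g i) * prod g I"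
    using insert.hyps by (simp add: algebra_simps)
  then show ?case using insert by (metis dvd_add dvd_mult dvd_mult2 insertCI)
qed simp_all

lemma dvd_det_diff:
  fixes p :: "'a :: comm_ring_1"
  assumes A: "A \<in> carrier_mat n n" and B: "B \<in> carrier_mat n n"
    and dvd: "\<And>i j. i < n \<Longrightarrow> j < n \<Longrightarrow> p dvd A $$ (i, j) - B $$ (i, j)"
  shows "p dvd det A - det B"
proof -
  have "det A - det B = (\<Sum>\<sigma> | \<sigma> permutes {0..<n}.
      signof \<sigma> * ((\<Prod>i = 0..<n. A $$ (i, \<sigma> i)) - (\<Prod>i = 0..<n. B $$ (i, \<sigma> i))))"
    unfolding det_def'[OF A] det_def'[OF B] by (simp add: sum_subtractf[symmetric] right_diff_distrib)
  moreover have "p dvd \<dots>"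
  proof (intro dvd_sum dvd_mult dvd_prod_diff)
    fix \<sigma> i assume "\<sigma> \<in> {\<sigma>. \<sigma> permutes {0..<n}}" "i \<in> {0..<n}"
    then show "p dvd A $$ (i, \<sigma> i) - B $$ (i, \<sigma> i)"
      using permutes_in_image[of \<sigma> "{0..<n}" i] by (intro dvd) auto
  qed
  ultimately show ?thesis by simp
qed

text \<open>Horner evaluation of p at the matrix A, in a form that unfolds along
  \<open>pCons\<close>.\<close>

definition pmat :: "nat \<Rightarrow> 'a :: field poly \<Rightarrow> 'a mat \<Rightarrow> 'a mat" where
  "pmat n p A = fold_coeffs (\<lambda>a M. a \<cdot>\<^sub>m 1\<^sub>m n + A * M) p (0\<^sub>m n n)"

lemma pmat_0: "pmat n 0 A = 0\<^sub>m n n"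
  by (simp add: pmat_def)

lemma pmat_pCons:
  assumes A: "A \<in> carrier_mat n n"
  shows "pmat n (pCons a p) A = a \<cdot>\<^sub>m 1\<^sub>m n + A * pmat n p A"
proof (cases "p = 0 \<and> a = 0")
  case True
  then show ?thesis using A by (simp add: pmat_def) (rule eq_matI, auto)
next
  case False
  then show ?thesis by (auto simp: pmat_def fold_coeffs_pCons_not_0_0_eq fold_coeffs_pCons_coeff_not_0_eq)
qed

lemma pmat_carrier: "A \<in> carrier_mat n n \<Longrightarrow> pmat n p A \<in> carrier_mat n n"
  by (induction p) (auto simp: pmat_0 pmat_pCons)

text \<open>The remainder theorem for matrices: x I - A divides r(x) I - r(A). Along Horner's scheme
  the quotient Q for r becomes x Q + r(A).\<close>

lemma char_poly_matrix_divides: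
  fixes A :: "'a :: field mat"
  assumes A: "A \<in> carrier_mat n n"
  shows "\<exists>Q \<in> carrier_mat n n. char_poly_matrix A * Q = r \<cdot>\<^sub>m 1\<^sub>m n - map_mat (\<lambda>a. [:a:]) (pmat n r A)"
proof (induction r)
  case 0
  show ?case
  proof (intro bexI[of _ "0\<^sub>m n n"])
    have "char_poly_matrix A \<in> carrier_mat n n" using A by simp
    then have "char_poly_matrix A * 0\<^sub>m n n = 0\<^sub>m n n" by simp
    also have "\<dots> = 0 \<cdot>\<^sub>m 1\<^sub>m n - map_mat (\<lambda>a. [:a:]) (pmat n 0 A)"
      by (intro eq_matI) (auto simp: pmat_0)
    finally show "char_poly_matrix A * 0\<^sub>m n n = 0 \<cdot>\<^sub>m 1\<^sub>m n - map_mat (\<lambda>a. [:a:]) (pmat n 0 A)" .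
  qed simp
next
  case (pCons a r)
  let ?X = "char_poly_matrix A"
  let ?P = "pmat n r A"
  let ?L = "map_mat (\<lambda>a. [:a:] :: 'a poly)"
  let ?x = "[:0, 1:] :: 'a poly"
  obtain Q where Q: "Q \<in> carrier_mat n n" "?X * Q = r \<cdot>\<^sub>m 1\<^sub>m n - ?L ?P"
    using pCons.IH by blast
  have P: "?P \<in> carrier_mat n n" using A by (rule pmat_carrier)
  have X: "?X \<in> carrier_mat n n" using A by simp
  have XL: "?X * ?L ?P = ?x \<cdot>\<^sub>m ?L ?P - ?L (A * ?P)"
  proof (rule eq_matI)
    fix i j assume "i < dim_row (?x \<cdot>\<^sub>m ?L ?P - ?L (A * ?P))" "j < dim_col (?x \<cdot>\<^sub>m ?L ?P - ?L (A * ?P))"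
    then have ij: "i < n" "j < n" using A P by auto
    have "(?X * ?L ?P) $$ (i, j) = (\<Sum>k\<in>{0..<n}. ?X $$ (i, k) * [:?P $$ (k, j):])"
      using ij carrier_matD[OF X] carrier_matD[OF P] by (simp add: scalar_prod_def)
    also have "\<dots> = (\<Sum>k\<in>{0..<n}. (if k = i then ?x * [:?P $$ (k, j):] else 0) - [:A $$ (i, k) * ?P $$ (k, j):])"
      using ij A by (intro sum.cong refl) (auto simp: char_poly_matrix_def algebra_simps)
    also have "\<dots> = ?x * [:?P $$ (i, j):] - [:\<Sum>k\<in>{0..<n}. A $$ (i, k) * ?P $$ (k, j):]"
      using ij by (simp add: sum_subtractf sum_to_poly)
    also have "\<dots> = (?x \<cdot>\<^sub>m ?L ?P - ?L (A * ?P)) $$ (i, j)"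
      using ij A P by (simp add: scalar_prod_def)
    finally show "(?X * ?L ?P) $$ (i, j) = (?x \<cdot>\<^sub>m ?L ?P - ?L (A * ?P)) $$ (i, j)" .
  qed (use A P carrier_matD(1)[OF X] in auto)
  have "?X * (?x \<cdot>\<^sub>m Q + ?L ?P) = ?X * (?x \<cdot>\<^sub>m Q) + ?X * ?L ?P"
    using X Q P by (intro mult_add_distrib_mat) auto
  also have "?X * (?x \<cdot>\<^sub>m Q) = ?x \<cdot>\<^sub>m (r \<cdot>\<^sub>m 1\<^sub>m n - ?L ?P)"
    using X Q by (simp add: mult_smult_distrib)
  also have "?x \<cdot>\<^sub>m (r \<cdot>\<^sub>m 1\<^sub>m n - ?L ?P) + ?X * ?L ?P = pCons a r \<cdot>\<^sub>m 1\<^sub>m n - ?L (pmat n (pCons a r) A)"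
    unfolding XL pmat_pCons[OF A] using A P
    by (intro eq_matI) (auto simp: algebra_simps)
  finally show ?case using Q P by (intro bexI[of _ "?x \<cdot>\<^sub>m Q + ?L ?P"]) auto
qed

text \<open>If p(A) had an inverse, multiplying the remainder identity by it would make the
  determinant of x I - A, and with it p, divide the determinant of p(x) p(A)^-1 - I. Modulo p the
  latter is a power of -1. No eigenvalues in an extension field are involved.\<close>

lemma irreducible_factor_char_poly_singular:
  fixes A :: "'a :: field mat"
  assumes A: "A \<in> carrier_mat n n" and p: "irreducible p" "p dvd char_poly A"
  obtains w where "w \<in> carrier_vec n" "w \<noteq> 0\<^sub>v n" "pmat n p A *\<^sub>v w = 0\<^sub>v n"
proof -
  let ?M = "pmat n p A"
  let ?L = "map_mat (\<lambda>a. [:a:] :: 'a poly)"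
  have M: "?M \<in> carrier_mat n n" using A by (rule pmat_carrier)
  have "det ?M = 0"
  proof (rule ccontr)
    assume "det ?M \<noteq> 0"
    from det_non_zero_imp_unit[OF M this, of undefined]
    obtain M' where M': "M' \<in> carrier_mat n n" "?M * M' = 1\<^sub>m n"
      unfolding Units_def ring_mat_def by auto
    obtain Q where Q: "Q \<in> carrier_mat n n" "char_poly_matrix A * Q = p \<cdot>\<^sub>m 1\<^sub>m n - ?L ?M"
      using char_poly_matrix_divides[OF A] by blast
    have X: "char_poly_matrix A \<in> carrier_mat n n" using A by simp
    have LM: "?L M' \<in> carrier_mat n n" using M' by simp
    have "char_poly_matrix A * (Q * ?L M') = (p \<cdot>\<^sub>m 1\<^sub>m n - ?L ?M) * ?L M'"
      unfolding Q(2)[symmetric] using X Q LM by (intro assoc_mult_mat[symmetric])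
    then have "char_poly A * det (Q * ?L M') = det ((p \<cdot>\<^sub>m 1\<^sub>m n - ?L ?M) * ?L M')"
      unfolding char_poly_def using X Q LM by (metis det_mult mult_carrier_mat)
    with p(2) have 1: "p dvd det ((p \<cdot>\<^sub>m 1\<^sub>m n - ?L ?M) * ?L M')" by (metis dvd_mult2)
    have LL: "?L ?M * ?L M' = 1\<^sub>m n"
    proof -
      have "?L ?M * ?L M' = ?L (?M * M')"
        using M M'(1) by (intro eq_matI) (auto simp: scalar_prod_def sum_to_poly mult.commute)
      then show ?thesis using M' by (intro eq_matI) (auto simp: one_pCons)
    qed
    have eq: "(p \<cdot>\<^sub>m 1\<^sub>m n - ?L ?M) * ?L M' = p \<cdot>\<^sub>m ?L M' - 1\<^sub>m n"
      using M LM minus_mult_distrib_mat[of "p \<cdot>\<^sub>m 1\<^sub>m n" n n "?L ?M" "?L M'" n]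
        mult_smult_assoc_mat[of "1\<^sub>m n" n n "?L M'" n p] by (simp add: LL)
    have "p dvd det (p \<cdot>\<^sub>m ?L M' - 1\<^sub>m n) - det (- 1 \<cdot>\<^sub>m 1\<^sub>m n)"
      using LM by (intro dvd_det_diff[of _ n]) (auto intro: dvd_smult)
    from dvd_diff[OF 1[unfolded eq] this] have "p dvd det (- 1 \<cdot>\<^sub>m 1\<^sub>m n :: 'a poly mat)" by simp
    then have "p dvd (- 1) ^ n" by (simp add: det_smult)
    then have "p dvd (- 1) ^ n * (- 1) ^ n" by (rule dvd_mult2)
    then have "p dvd 1" by (simp add: power_mult_distrib[symmetric])
    then show False using p(1) by (simp add: irreducible_def)
  qed
  then show ?thesis using det_0_iff_vec_prod_zero_field[OF M] that by auto
qed


section \<open>Bases, and vectors as functions\<close>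

context quad_space
begin

definition comb :: "(nat \<Rightarrow> 'a) \<Rightarrow> (nat \<Rightarrow> 'v) \<Rightarrow> nat \<Rightarrow> 'v" where
  "comb a u n = (\<Sum>i<n. a i *s u i)"

lemma comb_in: "subspace W \<Longrightarrow> (\<And>i. i < n \<Longrightarrow> u i \<in> W) \<Longrightarrow> comb a u n \<in> W"
  unfolding comb_def by (intro subspace_sum subspace_scale) auto

lemma comb_unique:
  assumes "indep_upto u n" "comb a u n = comb b u n" "i < n"
  shows "a i = b i"
proof -
  have "(\<Sum>i<n. (a i - b i) *s u i) = 0"
    using assms(2) by (simp add: comb_def scale_left_diff_distrib sum_subtractf)
  then show ?thesis using indep_uptoD[OF assms(1), of "\<lambda>i. a i - b i"] assms(3) by simp
qed

lemma inj_on_comb: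
  assumes "indep_upto u n"
  shows "inj_on (\<lambda>a. comb a u n) (PiE {..<n} (\<lambda>_. UNIV))"
proof (rule inj_onI)
  fix a b assume ab: "a \<in> PiE {..<n} (\<lambda>_. UNIV)" "b \<in> PiE {..<n} (\<lambda>_. UNIV)" "comb a u n = comb b u n"
  show "a = b" using ab(1,2) by (rule PiE_ext) (use comb_unique[OF assms ab(3)] in simp)
qed

lemma card_ge_of_indep:
  assumes "indep_upto u n" "subspace W" "finite W" "\<And>i. i < n \<Longrightarrow> u i \<in> W"
  shows "CARD('a) ^ n \<le> card W"
proof -
  have "card (PiE {..<n} (\<lambda>_. UNIV :: 'a set)) \<le> card W"
    using inj_on_comb[OF assms(1)] _ assms(3) by (rule card_inj_on_le) (use comb_in assms in blast)
  then show ?thesis by (simp add: card_PiE)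
qed

lemma card_of_basis:
  assumes "indep_upto u n" "subspace W" "\<And>i. i < n \<Longrightarrow> u i \<in> W" "\<And>z. z \<in> W \<Longrightarrow> \<exists>a. z = comb a u n"
  shows "card W = CARD('a) ^ n"
proof -
  have "W = (\<lambda>a. comb a u n) ` PiE {..<n} (\<lambda>_. UNIV)"
  proof (intro equalityI subsetI)
    fix z assume "z \<in> W"
    then obtain a where "z = comb a u n" using assms(4) by blast
    then have "z = comb (restrict a {..<n}) u n" by (simp add: comb_def)
    then show "z \<in> (\<lambda>a. comb a u n) ` PiE {..<n} (\<lambda>_. UNIV)" by (rule image_eqI[where f = "\<lambda>a. comb a u n"]) simp
  next
    fix z assume "z \<in> (\<lambda>a. comb a u n) ` PiE {..<n} (\<lambda>_. UNIV)"
    then show "z \<in> W" using comb_in[OF assms(2,3)] by auto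
  qed
  then have "card W = card (PiE {..<n} (\<lambda>_. UNIV :: 'a set))"
    using card_image[OF inj_on_comb[OF assms(1)]] by simp
  then show ?thesis by (simp add: card_PiE)
qed

lemma extend_to_basis:
  assumes "indep_upto u r" "subspace W" "finite W" "\<And>i. i < r \<Longrightarrow> u i \<in> W"
  shows "\<exists>N w. r \<le> N \<and> (\<forall>i<r. w i = u i) \<and> indep_upto w N \<and> (\<forall>i<N. w i \<in> W) \<and> (\<forall>z\<in>W. \<exists>a. z = comb a w N)"
  using assms(1,4)
proof (induction "card W - r" arbitrary: u r rule: less_induct)
  case less
  show ?case
  proof (cases "\<forall>z\<in>W. \<exists>a. z = comb a u r")
    case True
    then show ?thesis using less.prems by blast
  next
    case False
    then obtain z where z: "z \<in> W" "\<And>a. z \<noteq> comb a u r" by blast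
    have ind: "indep_upto (u(r := z)) (Suc r)"
    proof (rule ccontr)
      assume "\<not> ?thesis"
      with less.prems(1) obtain a where "z = (\<Sum>i<r. a i *s u i)" by (rule indep_upto_Suc_cases)
      then show False using z(2)[of a] by (simp add: comb_def)
    qed
    \<comment> \<open>An independent family in W is shorter than |W|, so the measure |W| - r
      decreases.\<close>
    have "r < 2 ^ r" by (rule less_exp)
    also have "\<dots> \<le> CARD('a) ^ r" using CARD_ge_2 by (intro power_mono) auto
    also have "\<dots> \<le> card W" using less.prems assms(2,3) by (intro card_ge_of_indep) auto
    finally have "card W - Suc r < card W - r" by simp
    moreover have "(u(r := z)) i \<in> W" if "i < Suc r" for i
      using z(1) less.prems(2) that by (auto simp: less_Suc_eq)
    ultimately obtain N w where Nw: "Suc r \<le> N" "\<forall>i<Suc r. w i = (u(r := z)) i" "indep_upto w N"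
      "\<forall>i<N. w i \<in> W" "\<forall>z\<in>W. \<exists>a. z = comb a w N"
      using less.hyps[OF _ ind] by blast
    have "\<forall>i<r. w i = u i"
    proof (intro allI impI)
      fix i assume "i < r"
      then show "w i = u i" using Nw(2)[rule_format, of i] by simp
    qed
    with Nw show ?thesis by (intro exI[of _ N] exI[of _ w] conjI) simp_all
  qed
qed

lemma pact_commute: "lin T \<Longrightarrow> pact T p (T v) = T (pact T p v)"
proof -
  assume T: "lin T"
  have X: "pact T [:0, 1:] w = T w" for w by (simp add: pact_pCons[OF T] lin_0[OF T] one_pCons[symmetric])
  have "pact T (p * [:0, 1:]) v = pact T ([:0, 1:] * p) v" by (simp only: mult.commute)
  then show ?thesis by (simp only: pact_mult[OF T] X)
qed

lemma subspace_kernel_of: "isom g \<Longrightarrow> subspace (kernel_of g f)"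
  by (rule subspaceI) (auto simp: kernel_of_add kernel_of_scale, auto simp: kernel_of_def V_closed lin_0[OF lin_pact[OF isom_lin]])

text \<open>The last property says that p(g) is injective on the quotient of \<open>V\<close> by the
  primary part.\<close>

lemma primary_part_props:
  assumes "isom g"
  shows "subspace (primary_part g p)" "primary_part g p \<subseteq> V" "finite (primary_part g p)"
    "\<And>x. x \<in> primary_part g p \<Longrightarrow> g x \<in> primary_part g p"
    "\<And>x. x \<in> V \<Longrightarrow> pact g p x \<in> primary_part g p \<Longrightarrow> x \<in> primary_part g p"
proof -
  obtain k where k: "primary_part g p = kernel_of g (p ^ k)" using primary_part_eq_kernel[OF assms] by blast
  show "subspace (primary_part g p)" "primary_part g p \<subseteq> V" "finite (primary_part g p)"
    unfolding k by (rule subspace_kernel_of[OF assms] kernel_of_subset finite_kernel_of)+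
  show "g x \<in> primary_part g p" if "x \<in> primary_part g p" for x
    using that isom_V[OF assms] isom_0[OF assms] unfolding k
    by (simp add: kernel_of_def pact_commute[OF isom_lin[OF assms]])
  show "x \<in> primary_part g p" if "x \<in> V" "pact g p x \<in> primary_part g p" for x
  proof -
    have "pact g (p ^ k * p) x = 0"
      using that(2) unfolding k by (simp add: kernel_of_def pact_mult[OF isom_lin[OF assms]])
    then have "x \<in> kernel_of g (p ^ Suc k)" using that(1) by (simp add: kernel_of_def mult.commute)
    then show ?thesis unfolding primary_part_def by blast
  qed
qed

end

section \<open>Coordinate vectors and forms given by matrices\<close>

definition fscale :: "'a :: times \<Rightarrow> (nat \<Rightarrow> 'a) \<Rightarrow> nat \<Rightarrow> 'a" where
  "fscale c f = (\<lambda>i. c * f i)"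

text \<open>Vectors of length \<open>n\<close> are functions vanishing from \<open>n\<close> on, since the type of such
  functions is an additive group and \<open>'a vec\<close> is not.\<close>

definition fspace :: "nat \<Rightarrow> (nat \<Rightarrow> 'a :: zero) set" where
  "fspace n = {f. \<forall>i\<ge>n. f i = 0}"

definition fform :: "nat \<Rightarrow> 'a :: comm_semiring_0 mat \<Rightarrow> (nat \<Rightarrow> 'a) \<Rightarrow> (nat \<Rightarrow> 'a) \<Rightarrow> 'a" where
  "fform n J f g = (\<Sum>i<n. \<Sum>j<n. f i * J $$ (i, j) * g j)"

definition mat_act :: "nat \<Rightarrow> 'a :: comm_semiring_0 mat \<Rightarrow> (nat \<Rightarrow> 'a) \<Rightarrow> nat \<Rightarrow> 'a" where
  "mat_act n A f = (\<lambda>i. if i < n then \<Sum>j<n. A $$ (i, j) * f j else 0)"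

definition funit :: "nat \<Rightarrow> nat \<Rightarrow> 'a :: zero_neq_one" where
  "funit j = (\<lambda>i. if i = j then 1 else 0)"

lemma sum_fun_apply: "(\<Sum>i\<in>I. f i) x = (\<Sum>i\<in>I. f i x :: 'a :: comm_monoid_add)"
  by (induction I rule: infinite_finite_induct) auto

lemma invertible_of_inj:
  fixes A :: "'a :: field mat"
  assumes A: "A \<in> carrier_mat n n" and inj: "\<And>v. v \<in> carrier_vec n \<Longrightarrow> A *\<^sub>v v = 0\<^sub>v n \<Longrightarrow> v = 0\<^sub>v n"
  obtains B where "B \<in> carrier_mat n n" "A * B = 1\<^sub>m n" "B * A = 1\<^sub>m n"
proof -
  have "det A \<noteq> 0" using inj det_0_iff_vec_prod_zero_field[OF A] by blast
  from det_non_zero_imp_unit[OF A this, of undefined] show ?thesis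
    using that unfolding Units_def ring_mat_def by auto
qed

lemma vec_mat_act:
  "A \<in> carrier_mat n n \<Longrightarrow> vec n (mat_act n A f) = A *\<^sub>v vec n f"
  by (intro eq_vecI) (auto simp: mat_act_def scalar_prod_def lessThan_atLeast0)

lemma fform_eq:
  assumes "J \<in> carrier_mat n n"
  shows "fform n J f g = bilin_form J (vec n f) (vec n g)"
  using assms by (simp add: fform_def bilin_form_def scalar_prod_def lessThan_atLeast0 sum_distrib_left mult.assoc)

lemma fspace_expand:
  fixes f :: "nat \<Rightarrow> 'a :: comm_ring_1"
  assumes "f \<in> fspace n" shows "f = (\<Sum>j<n. fscale (f j) (funit j))"
proof
  fix i
  have "(\<Sum>j<n. fscale (f j) (funit j)) i = (\<Sum>j<n. if j = i then f i else 0)"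
    unfolding sum_fun_apply by (intro sum.cong) (auto simp: fscale_def funit_def)
  also have "\<dots> = f i" using assms by (auto simp: fspace_def)
  finally show "f i = (\<Sum>j<n. fscale (f j) (funit j)) i" by simp
qed

lemma
  shows finite_fspace: "finite (fspace n :: (nat \<Rightarrow> 'a :: {zero, finite}) set)"
    and card_fspace: "card (fspace n :: (nat \<Rightarrow> 'a) set) = CARD('a) ^ n"
proof -
  let ?P = "PiE {..<n} (\<lambda>_. UNIV :: 'a set)"
  let ?h = "\<lambda>(c :: nat \<Rightarrow> 'a) i. if i < n then c i else 0"
  have im: "fspace n = ?h ` ?P"
  proof (intro equalityI subsetI)
    fix f :: "nat \<Rightarrow> 'a" assume "f \<in> fspace n"
    then have "f = ?h (restrict f {..<n})" by (auto simp: fspace_def fun_eq_iff)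
    then show "f \<in> ?h ` ?P" by (rule image_eqI[where f = ?h]) (auto simp: PiE_def extensional_def)
  next
    fix f assume "f \<in> ?h ` ?P"
    then obtain c where "f = ?h c" by (rule imageE)
    then show "f \<in> fspace n" by (simp add: fspace_def)
  qed
  have "inj_on ?h ?P"
  proof (rule inj_onI)
    fix c d assume cd: "c \<in> ?P" "d \<in> ?P" and eq: "?h c = ?h d"
    show "c = d" using cd
    proof (rule PiE_ext)
      show "c i = d i" if "i \<in> {..<n}" for i using fun_cong[OF eq, of i] that by simp
    qed
  qed
  then show "card (fspace n :: (nat \<Rightarrow> 'a) set) = CARD('a) ^ n"
    unfolding im by (simp add: card_image card_PiE)
  show "finite (fspace n :: (nat \<Rightarrow> 'a) set)" unfolding im by (intro finite_imageI finite_PiE) auto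
qed

lemma vector_space_fscale: "vector_space (fscale :: 'a :: field \<Rightarrow> _)"
  by unfold_locales (auto simp: fscale_def distrib_left distrib_right)

locale orthogonal_mat =
  fixes n :: nat and J :: "'a :: {field, finite} mat"
  assumes J: "J \<in> carrier_mat n n"
    and J_sym: "\<And>i j. i < n \<Longrightarrow> j < n \<Longrightarrow> J $$ (i, j) = J $$ (j, i)"
    and J_nondegenerate: "\<And>v. v \<in> carrier_vec n \<Longrightarrow> J *\<^sub>v v = 0\<^sub>v n \<Longrightarrow> v = 0\<^sub>v n"
    and two: "(2 :: 'a) \<noteq> 0"
begin

sublocale quad_space fscale "fspace n" "fform n J"
proof (intro quad_space.intro quad_space_axioms.intro vector_space_fscale)
  interpret vs: vector_space "fscale :: 'a \<Rightarrow> _" by (rule vector_space_fscale)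
  show "vs.subspace (fspace n)" by (rule vs.subspaceI) (auto simp: fspace_def fscale_def)
  show "finite (fspace n :: (nat \<Rightarrow> 'a) set)" by (rule finite_fspace)
  show "fform n J (x + y) z = fform n J x z + fform n J y z" for x y z
    by (simp add: fform_def distrib_right sum.distrib)
  show "fform n J (fscale c x) z = c * fform n J x z" for c x z
    by (simp add: fform_def fscale_def sum_distrib_left mult.assoc)
  show "fform n J x y = fform n J y x" for x y
    unfolding fform_def by (subst sum.swap, intro sum.cong refl) (use J_sym in \<open>auto simp: mult_ac\<close>)
  show "\<exists>w\<in>fspace n. fform n J v w \<noteq> 0" if v: "v \<in> fspace n" "v \<noteq> 0" for v
  proof -
    have "vec n v \<noteq> 0\<^sub>v n"
    proof
      assume "vec n v = 0\<^sub>v n"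
      then have "v i = 0" if "i < n" for i using that by (metis index_vec index_zero_vec(1))
      with v show False by (auto simp: fspace_def fun_eq_iff) (meson not_less)
    qed
    then have "J *\<^sub>v vec n v \<noteq> 0\<^sub>v n" using J_nondegenerate[of "vec n v"] by auto
    then obtain i where i: "i < n" "(J *\<^sub>v vec n v) $ i \<noteq> 0"
      using J by (metis carrier_matD(1) dim_mult_mat_vec eq_vecI index_zero_vec)
    have "fform n J v (funit i) = (\<Sum>k<n. v k * J $$ (k, i))"
      unfolding fform_def funit_def using i(1) by (intro sum.cong refl) (simp add: if_distrib cong: if_cong)
    also have "\<dots> = (J *\<^sub>v vec n v) $ i"
      using i(1) J by (auto simp: scalar_prod_def lessThan_atLeast0 J_sym mult.commute intro!: sum.cong)
    finally show ?thesis using i by (intro bexI[of _ "funit i"]) (auto simp: fspace_def funit_def)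
  qed
  show "(2 :: 'a) \<noteq> 0" by (rule two)
qed

end


section \<open>The isometry group of a matrix\<close>

lemma finite_carrier_mat: "finite (carrier_mat n m :: 'a :: finite mat set)"
proof -
  let ?f = "\<lambda>c. mat n m (\<lambda>ij. c ij) :: 'a mat"
  have "carrier_mat n m \<subseteq> ?f ` PiE ({..<n} \<times> {..<m}) (\<lambda>_. UNIV)"
  proof
    fix A :: "'a mat" assume "A \<in> carrier_mat n m"
    then have "A = ?f (restrict (($$) A) ({..<n} \<times> {..<m}))" by (intro eq_matI) auto
    then show "A \<in> ?f ` PiE ({..<n} \<times> {..<m}) (\<lambda>_. UNIV)" by (rule image_eqI[where f = ?f]) (auto simp: PiE_def extensional_def)
  qed
  then show ?thesis by (rule finite_subset) (intro finite_imageI finite_PiE, auto)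
qed

lemma char_poly_four_block_lower_left_zero:
  fixes A1 :: "'a :: field mat"
  assumes A1: "A1 \<in> carrier_mat r r" and A2: "A2 \<in> carrier_mat r s" and A4: "A4 \<in> carrier_mat s s"
  shows "char_poly (four_block_mat A1 A2 (0\<^sub>m s r) A4) = char_poly A1 * char_poly A4"
proof -
  have "char_poly_matrix (four_block_mat A1 A2 (0\<^sub>m s r) A4) =
    four_block_mat (char_poly_matrix A1) (map_mat (\<lambda>a. [:- a:]) A2) (0\<^sub>m s r) (char_poly_matrix A4)"
    using assms by (intro eq_matI) (auto simp: char_poly_matrix_def)
  moreover have "det (four_block_mat (char_poly_matrix A1) (map_mat (\<lambda>a. [:- a:]) A2) (0\<^sub>m s r) (char_poly_matrix A4))
    = det (char_poly_matrix A1) * det (char_poly_matrix A4)"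
    using assms by (intro det_four_block_mat_lower_left_zero) auto
  ultimately show ?thesis by (simp add: char_poly_def)
qed

context orthogonal_mat
begin

lemma mat_act_lin: "lin (mat_act n A)"
  unfolding lin_def
proof (intro conjI allI)
  show "mat_act n A (x + y) = mat_act n A x + mat_act n A y" for x y
    by (rule ext) (simp add: mat_act_def distrib_left sum.distrib)
  show "mat_act n A (fscale c x) = fscale c (mat_act n A x)" for c x
    by (rule ext) (simp add: mat_act_def fscale_def sum_distrib_left mult.left_commute)
qed

lemma mat_act_fspace: "mat_act n A x \<in> fspace n"
  by (simp add: mat_act_def fspace_def)

lemma isom_mat_act:
  assumes "A \<in> isometry_group n J"
  shows "isom (mat_act n A)"
  unfolding isom_def
proof (intro conjI ballI allI)
  have A: "A \<in> carrier_mat n n" using assms by (simp add: isometry_group_def)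
  show "mat_act n A (x + y) = mat_act n A x + mat_act n A y" for x y by (rule lin_add[OF mat_act_lin])
  show "mat_act n A (fscale c x) = fscale c (mat_act n A x)" for c x by (rule lin_scale[OF mat_act_lin])
  show "mat_act n A x \<in> fspace n" for x by (rule mat_act_fspace)
  show "fform n J (mat_act n A x) (mat_act n A y) = fform n J x y" for x y
    using assms unfolding fform_eq[OF J] vec_mat_act[OF A] by (simp add: isometry_group_def)
qed

lemma mat_act_funit: "j < n \<Longrightarrow> i < n \<Longrightarrow> mat_act n (A :: 'a mat) (funit j) i = A $$ (i, j)"
  by (simp add: mat_act_def funit_def if_distrib cong: if_cong)

lemma funit_fspace: "j < n \<Longrightarrow> funit j \<in> fspace n"
  by (auto simp: funit_def fspace_def)

lemma lin_eq_mat_act: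
  assumes h: "lin h" "\<And>x. x \<in> fspace n \<Longrightarrow> h x \<in> fspace n" and x: "x \<in> fspace n"
  shows "mat_act n (mat n n (\<lambda>(i, j). h (funit j) i)) x = h x"
proof
  fix i
  have "h x = (\<Sum>j<n. fscale (x j) (h (funit j)))"
    using fspace_expand[OF x] by (metis (no_types, lifting) h(1) lin_scale lin_sum sum.cong)
  then have "h x i = (\<Sum>j<n. x j * h (funit j) i)" by (simp add: sum_fun_apply fscale_def)
  moreover have "h x i = 0" if "\<not> i < n" using h(2)[OF x] that by (simp add: fspace_def)
  ultimately show "mat_act n (mat n n (\<lambda>(i, j). h (funit j) i)) x i = h x i"
    by (simp add: mat_act_def mult.commute)
qed

lemma vec_surj: "v \<in> carrier_vec n \<Longrightarrow> \<exists>x\<in>fspace n. v = vec n x"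
  by (intro bexI[of _ "\<lambda>i. if i < n then v $ i else 0"]) (auto simp: fspace_def)

lemma vec_eq_0_iff: "x \<in> fspace n \<Longrightarrow> vec n x = 0\<^sub>v n \<longleftrightarrow> x = 0"
proof
  assume x: "x \<in> fspace n" "vec n x = 0\<^sub>v n"
  show "x = 0"
  proof
    fix i
    show "x i = 0 i" using x(1) arg_cong[OF x(2), of "\<lambda>v. v $ i"] by (cases "i < n") (auto simp: fspace_def)
  qed
qed auto

sublocale isom_group fscale "fspace n" "fform n J" "isometry_group n J" "mat_act n"
proof unfold_locales
  show "finite (isometry_group n J)"
    by (rule finite_subset[OF _ finite_carrier_mat[of n n]]) (auto simp: isometry_group_def)
  show "isom (mat_act n A)" if "A \<in> isometry_group n J" for A using that by (rule isom_mat_act)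
  show "\<exists>A\<in>isometry_group n J. \<forall>x\<in>fspace n. mat_act n A x = h x" if h: "isom h" for h
  proof
    let ?M = "mat n n (\<lambda>(i, j). h (funit j) i)"
    have M: "?M \<in> carrier_mat n n" by simp
    have eq: "mat_act n ?M x = h x" if "x \<in> fspace n" for x
      using isom_lin[OF h] isom_V[OF h] that by (rule lin_eq_mat_act)
    show "\<forall>x\<in>fspace n. mat_act n ?M x = h x" using eq by blast
    have "v = 0\<^sub>v n" if v: "v \<in> carrier_vec n" "?M *\<^sub>v v = 0\<^sub>v n" for v
    proof -
      obtain x where x: "x \<in> fspace n" "v = vec n x" using vec_surj[OF v(1)] by blast
      have "vec n (h x) = 0\<^sub>v n" using v(2) vec_mat_act[OF M, of x] eq[OF x(1)] x(2) by simp
      then have "h x = h 0" using vec_eq_0_iff isom_V[OF h x(1)] isom_0[OF h] by metis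
      then have "x = 0" using isom_inj_on[OF h] x(1) V_closed(4) by (metis inj_on_eq_iff)
      then show ?thesis using x vec_eq_0_iff by blast
    qed
    then obtain N where "N \<in> carrier_mat n n" "?M * N = 1\<^sub>m n" "N * ?M = 1\<^sub>m n"
      using invertible_of_inj[OF M] by blast
    then have "invertible_mat ?M"
      unfolding invertible_mat_def inverts_mat_def by (intro conjI exI[of _ N]) auto
    moreover have "bilin_form J (?M *\<^sub>v v) (?M *\<^sub>v w) = bilin_form J v w"
      if vw: "v \<in> carrier_vec n" "w \<in> carrier_vec n" for v w
    proof -
      obtain x where x: "x \<in> fspace n" "v = vec n x" using vec_surj[OF vw(1)] by blast
      obtain y where y: "y \<in> fspace n" "w = vec n y" using vec_surj[OF vw(2)] by blast
      show ?thesis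
        unfolding x(2) y(2) vec_mat_act[OF M, symmetric] fform_eq[OF J, symmetric] eq[OF x(1)] eq[OF y(1)]
        using x y by (intro isom_B[OF h])
    qed
    ultimately show "?M \<in> isometry_group n J" by (auto simp: isometry_group_def)
  qed
  show "A = A'" if "A \<in> isometry_group n J" "A' \<in> isometry_group n J"
    "\<And>x. x \<in> fspace n \<Longrightarrow> mat_act n A x = mat_act n A' x" for A A'
  proof (rule eq_matI)
    fix i j assume "i < dim_row A'" "j < dim_col A'"
    then have ij: "i < n" "j < n" using that(2) by (auto simp: isometry_group_def)
    show "A $$ (i, j) = A' $$ (i, j)"
      using fun_cong[OF that(3)[OF funit_fspace[OF ij(2)]], of i] ij by (simp add: mat_act_funit)
  qed (use that(1,2) in \<open>auto simp: isometry_group_def\<close>)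
qed

text \<open>In a basis that starts with a basis of the primary part K, the matrix is block
  triangular; \<open>B1\<close> acts on K and \<open>B4\<close> on the quotient. Since p(g) is
  injective on the quotient, p does not divide the characteristic polynomial of \<open>B4\<close>,
  so the full power of p divides that of \<open>B1\<close>, whose degree is dim K.\<close>

lemma card_primary_part_ge:
  assumes G: "A \<in> isometry_group n J" and p: "irreducible p" "monic p"
  shows "CARD('a) ^ (degree p * factor_mult p (char_poly A)) \<le> card (primary_part (mat_act n A) p)"
proof -
  let ?g = "mat_act n A"
  let ?K = "primary_part ?g p"
  have A: "A \<in> carrier_mat n n" using G by (simp add: isometry_group_def)
  have g: "isom ?g" using G by (rule isom_mat_act)
  note K = primary_part_props[OF g, where p = p]
  obtain r u0 where u0: "indep_upto u0 r" "\<And>i. i < r \<Longrightarrow> u0 i \<in> ?K" "\<And>z. z \<in> ?K \<Longrightarrow> \<exists>a. z = comb a u0 r"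
    using extend_to_basis[of "\<lambda>_. 0" 0 ?K] K by (auto simp: indep_upto_def)
  have "\<And>i. i < r \<Longrightarrow> u0 i \<in> fspace n" using u0(2) K(2) by blast
  from extend_to_basis[OF u0(1) subspace_V finite_V this]
  obtain N u where u: "r \<le> N" "\<forall>i<r. u i = u0 i" "indep_upto u N" "\<forall>i<N. u i \<in> fspace n"
    "\<forall>z\<in>fspace n. \<exists>a. z = comb a u N" by blast
  have "card (fspace n :: (nat \<Rightarrow> 'a) set) = CARD('a) ^ N"
    using u by (intro card_of_basis[OF u(3) subspace_V]) auto
  then have Nn: "N = n" using CARD_ge_2[where 'a = 'a] by (simp add: card_fspace)
  note u = u[unfolded Nn]
  have combr: "comb a u0 r = comb a u r" for a using u(2) by (simp add: comb_def)
  have uK: "u i \<in> ?K" if "i < r" for i using u(2) u0(2) that by simp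
  have spanK: "\<exists>a. z = comb a u r" if "z \<in> ?K" for z using u0(3)[OF that] combr by simp
  have cardK: "card ?K = CARD('a) ^ r"
    using u0 K by (intro card_of_basis[of u0]) auto
  have split: "comb c u n = comb c u r + (\<Sum>i<n - r. fscale (c (r + i)) (u (r + i)))" for c
  proof -
    have "{..<n} = {..<r} \<union> (+) r ` {..<n - r}"
    proof (intro equalityI subsetI)
      fix k assume k: "k \<in> {..<n}"
      show "k \<in> {..<r} \<union> (+) r ` {..<n - r}"
      proof (cases "k < r")
        case False
        with k have "k = r + (k - r)" "k - r \<in> {..<n - r}" by auto
        then show ?thesis by (intro UnI2) (rule image_eqI)
      qed simp
    qed (use u(1) in auto)
    then have "comb c u n = (\<Sum>i\<in>{..<r} \<union> (+) r ` {..<n - r}. fscale (c i) (u i))" by (simp add: comb_def)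
    also have "\<dots> = comb c u r + (\<Sum>i\<in>(+) r ` {..<n - r}. fscale (c i) (u i))"
      unfolding comb_def by (rule sum.union_disjoint) auto
    also have "(\<Sum>i\<in>(+) r ` {..<n - r}. fscale (c i) (u i)) = (\<Sum>i<n - r. fscale (c (r + i)) (u (r + i)))"
      by (subst sum.reindex) auto
    finally show ?thesis .
  qed
  have "\<exists>c. ?g (u j) = comb c u n \<and> (j < r \<longrightarrow> (\<forall>i\<ge>r. c i = 0))" if "j < n" for j
  proof (cases "j < r")
    case True
    then obtain a where a: "?g (u j) = comb a u r" using spanK[OF K(4)[OF uK]] by blast
    let ?c = "\<lambda>i. if i < r then a i else 0"
    have "comb ?c u n = comb a u r" unfolding split by (simp add: comb_def)
    then show ?thesis using a by (intro exI[of _ ?c]) auto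
  next
    case False
    then show ?thesis using u(5) mat_act_fspace by blast
  qed
  then obtain C where C: "\<And>j. j < n \<Longrightarrow> ?g (u j) = comb (C j) u n" "\<And>i j. j < n \<Longrightarrow> j < r \<Longrightarrow> r \<le> i \<Longrightarrow> C j i = 0"
    by metis
  define S where "S = mat n n (\<lambda>(i, j). u j i)"
  define Bm where "Bm = mat n n (\<lambda>(i, j). C j i)"
  have S: "S \<in> carrier_mat n n" and Bm: "Bm \<in> carrier_mat n n" by (simp_all add: S_def Bm_def)
  have AS: "A * S = S * Bm"
  proof (rule eq_matI)
    fix i j assume "i < dim_row (S * Bm)" "j < dim_col (S * Bm)"
    then have ij: "i < n" "j < n" by (simp_all add: S_def Bm_def)
    have "(A * S) $$ (i, j) = ?g (u j) i"
      using ij A by (simp add: S_def mat_act_def scalar_prod_def lessThan_atLeast0)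
    also have "\<dots> = (\<Sum>k<n. C j k * u k i)"
      using C(1)[OF ij(2)] by (simp add: comb_def sum_fun_apply fscale_def)
    also have "\<dots> = (S * Bm) $$ (i, j)"
      using ij by (simp add: S_def Bm_def scalar_prod_def lessThan_atLeast0 mult.commute)
    finally show "(A * S) $$ (i, j) = (S * Bm) $$ (i, j)" .
  qed (use A in \<open>auto simp: S_def Bm_def\<close>)
  have "w = 0\<^sub>v n" if w: "w \<in> carrier_vec n" "S *\<^sub>v w = 0\<^sub>v n" for w
  proof -
    have "(\<Sum>j<n. fscale (w $ j) (u j)) = 0"
    proof
      fix i
      show "(\<Sum>j<n. fscale (w $ j) (u j)) i = 0 i"
      proof (cases "i < n")
        case True
        then have "(S *\<^sub>v w) $ i = (\<Sum>j<n. fscale (w $ j) (u j)) i"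
          using w(1) by (simp add: S_def sum_fun_apply fscale_def scalar_prod_def lessThan_atLeast0 mult.commute)
        then show ?thesis using w True by simp
      next
        case False
        then show ?thesis using u(4) by (simp add: sum_fun_apply fscale_def fspace_def)
      qed
    qed
    then have "w $ j = 0" if "j < n" for j using indep_uptoD[OF u(3), of "\<lambda>j. w $ j"] that by blast
    then show ?thesis using w(1) by (intro eq_vecI) auto
  qed
  then obtain S' where S': "S' \<in> carrier_mat n n" "S * S' = 1\<^sub>m n" "S' * S = 1\<^sub>m n"
    using invertible_of_inj[OF S] by blast
  have "A = A * (S * S')" using A S' by simp
  also have "\<dots> = A * S * S'" by (rule assoc_mult_mat[symmetric, OF A S S'(1)])
  also have "A * S = S * Bm" by (rule AS)
  finally have "similar_mat A Bm" using A S S' Bm by (intro similar_matI[of A Bm S S' n]) auto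
  then have cp: "char_poly A = char_poly Bm" by (rule char_poly_similar)
  define B1 where "B1 = mat r r (\<lambda>(i, j). Bm $$ (i, j))"
  define B2 where "B2 = mat r (n - r) (\<lambda>(i, j). Bm $$ (i, r + j))"
  define B4 where "B4 = mat (n - r) (n - r) (\<lambda>(i, j). Bm $$ (r + i, r + j))"
  have B4: "B4 \<in> carrier_mat (n - r) (n - r)" by (simp add: B4_def)
  have "Bm = four_block_mat B1 B2 (0\<^sub>m (n - r) r) B4"
    using u(1) C(2) by (intro eq_matI) (auto simp: Bm_def B1_def B2_def B4_def)
  then have cpm: "char_poly A = char_poly B1 * char_poly B4"
    unfolding cp by (metis B1_def B2_def B4 char_poly_four_block_lower_left_zero mat_carrier)
  \<comment> \<open>\<open>L\<close> lifts coordinates in the quotient to the span of the added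
    basis vectors. The quotient itself is never formed; identities in it are stated as differences
    lying in K.\<close>
  define L where "L x = (\<Sum>i<n - r. fscale (x $ i) (u (r + i)))" for x
  have Ladd: "L (x + y) = L x + L y" if "x \<in> carrier_vec (n - r)" "y \<in> carrier_vec (n - r)" for x y
    using that by (simp add: L_def scale_left_distrib sum.distrib)
  have Lscale: "L (c \<cdot>\<^sub>v x) = fscale c (L x)" if "x \<in> carrier_vec (n - r)" for c x
    using that by (simp add: L_def scale_sum_right)
  have LV: "L x \<in> fspace n" for x unfolding L_def using u(4) by (intro V_sum V_closed) auto
  have L0: "L (0\<^sub>v (n - r)) = 0"
    unfolding L_def by (intro sum.neutral ballI) (simp add: fscale_def zero_fun_def)
  note Kadd = subspace_add[OF K(1)] and Kscale = subspace_scale[OF K(1)] and K0 = subspace_0[OF K(1)]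
  have gL: "?g (L y) - L (B4 *\<^sub>v y) \<in> ?K" if y: "y \<in> carrier_vec (n - r)" for y
  proof -
    let ?c = "\<lambda>k. \<Sum>i<n - r. C (r + i) k * y $ i"
    have "?g (L y) = (\<Sum>i<n - r. fscale (y $ i) (comb (C (r + i)) u n))"
      unfolding L_def lin_sum[OF mat_act_lin] lin_scale[OF mat_act_lin] using C(1) by (intro sum.cong refl) simp
    also have "\<dots> = comb ?c u n"
      unfolding comb_def scale_sum_right scale_sum_left by (subst sum.swap) (simp add: mult.commute)
    also have "\<dots> = comb ?c u r + L (B4 *\<^sub>v y)"
      unfolding split L_def
    proof (intro arg_cong2[where f = "(+)"] refl sum.cong)
      fix k assume "k \<in> {..<n - r}"
      then have "(B4 *\<^sub>v y) $ k = ?c (r + k)"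
        using y by (simp add: B4_def Bm_def scalar_prod_def lessThan_atLeast0)
      then show "fscale (?c (r + k)) (u (r + k)) = fscale ((B4 *\<^sub>v y) $ k) (u (r + k))" by simp
    qed
    finally show ?thesis using comb_in[where W = ?K and u = u and n = r and a = ?c, OF K(1) uK] by simp
  qed
  have pL: "pact ?g f (L x) - L (pmat (n - r) f B4 *\<^sub>v x) \<in> ?K" if x: "x \<in> carrier_vec (n - r)" for f x
  proof (induction f)
    case 0
    have "0\<^sub>m (n - r) (n - r) *\<^sub>v x = 0\<^sub>v (n - r)"
      using x by (intro eq_vecI) (auto simp: scalar_prod_def)
    then show ?case unfolding pmat_0 by (simp only: L0 pact_0 diff_zero K0)
  next
    case (pCons a f)
    let ?P = "pmat (n - r) f B4"
    let ?y = "?P *\<^sub>v x"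
    have P: "?P \<in> carrier_mat (n - r) (n - r)" using B4 by (rule pmat_carrier)
    have y: "?y \<in> carrier_vec (n - r)" using P x by simp
    have one: "(a \<cdot>\<^sub>m 1\<^sub>m (n - r)) *\<^sub>v x = a \<cdot>\<^sub>v x"
    proof (rule eq_vecI)
      fix i assume "i < dim_vec (a \<cdot>\<^sub>v x)"
      then have i: "i < n - r" using x by simp
      have "((a \<cdot>\<^sub>m 1\<^sub>m (n - r)) *\<^sub>v x) $ i = (\<Sum>j\<in>{0..<n - r}. a * (if j = i then 1 else 0) * x $ j)"
        using i x by (simp add: scalar_prod_def)
      also have "\<dots> = (\<Sum>j\<in>{0..<n - r}. if j = i then a * x $ i else 0)"
        by (rule sum.cong) auto
      also have "\<dots> = (a \<cdot>\<^sub>v x) $ i" using i x by simp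
      finally show "((a \<cdot>\<^sub>m 1\<^sub>m (n - r)) *\<^sub>v x) $ i = (a \<cdot>\<^sub>v x) $ i" .
    qed (use x in simp)
    have "(a \<cdot>\<^sub>m 1\<^sub>m (n - r) + B4 * ?P) *\<^sub>v x = (a \<cdot>\<^sub>m 1\<^sub>m (n - r)) *\<^sub>v x + (B4 * ?P) *\<^sub>v x"
      using P B4 x by (intro add_mult_distrib_mat_vec[of _ "n - r" "n - r"]) auto
    also have "(B4 * ?P) *\<^sub>v x = B4 *\<^sub>v ?y" by (rule assoc_mult_mat_vec[OF B4 P x])
    finally have "pmat (n - r) (pCons a f) B4 *\<^sub>v x = a \<cdot>\<^sub>v x + B4 *\<^sub>v ?y"
      unfolding pmat_pCons[OF B4] one .
    then have eqL: "L (pmat (n - r) (pCons a f) B4 *\<^sub>v x) = fscale a (L x) + L (B4 *\<^sub>v ?y)"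
      using x y B4 Ladd[of "a \<cdot>\<^sub>v x" "B4 *\<^sub>v ?y"] Lscale by simp
    have "pact ?g (pCons a f) (L x) = fscale a (L x) + ?g (pact ?g f (L x))"
      by (rule pact_pCons[OF mat_act_lin])
    then have "pact ?g (pCons a f) (L x) - L (pmat (n - r) (pCons a f) B4 *\<^sub>v x)
      = ?g (pact ?g f (L x) - L ?y) + (?g (L ?y) - L (B4 *\<^sub>v ?y))"
      unfolding eqL isom_diff[OF g] by simp
    then show ?case using Kadd[OF K(4)[OF pCons.IH] gL[OF y]] by (simp only:)
  qed
  have nd: "\<not> p dvd char_poly B4"
  proof
    assume "p dvd char_poly B4"
    then obtain w where w: "w \<in> carrier_vec (n - r)" "w \<noteq> 0\<^sub>v (n - r)" "pmat (n - r) p B4 *\<^sub>v w = 0\<^sub>v (n - r)"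
      using irreducible_factor_char_poly_singular[OF B4 p(1)] by blast
    have "pact ?g p (L w) \<in> ?K" using pL[OF w(1), of p] unfolding w(3) L0 diff_zero .
    then have "L w \<in> ?K" using K(5) LV by blast
    then obtain a where a: "L w = comb a u r" using spanK by blast
    \<comment> \<open>If \<open>L w\<close> lies in K, these are the coefficients of a linear
      relation in the full basis, which forces w = 0.\<close>
    let ?c = "\<lambda>i. if i < r then a i else - w $ (i - r)"
    have "comb ?c u n = comb a u r - L w"
      unfolding split by (simp add: comb_def L_def sum_negf)
    then have "(\<Sum>i<n. fscale (?c i) (u i)) = 0" using a by (simp add: comb_def)
    then have c0: "?c i = 0" if "i < n" for i using indep_uptoD[OF u(3), of ?c] that by blast
    have "w $ i = 0" if "i < n - r" for i using c0[of "r + i"] that by simp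
    then show False using w(1,2) by (metis eq_vecI carrier_vecD index_zero_vec)
  qed
  have cp0: "char_poly A \<noteq> 0" "char_poly B1 \<noteq> 0" "degree (char_poly B1) = r"
    using degree_monic_char_poly[OF A] degree_monic_char_poly[of B1 r] by (auto simp: B1_def)
  have "p ^ factor_mult p (char_poly A) dvd char_poly B4 * char_poly B1"
    using pow_dvd_iff_le_factor_mult[OF p(1) cp0(1)] cpm by (simp add: mult.commute)
  then have "p ^ factor_mult p (char_poly A) dvd char_poly B1"
    using prime_elem_power_dvd_cancel[OF field_poly_irreducible_imp_prime[OF p(1)] nd] by blast
  then have "factor_mult p (char_poly A) * degree p \<le> r"
    using pow_dvd_degree_le(1)[OF p(1) cp0(2)] cp0(3) by simp
  then show ?thesis
    unfolding cardK using CARD_ge_2[where 'a = 'a] by (intro power_increasing) (auto simp: mult.commute)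
qed

end


section \<open>Average multiplicities\<close>

context isom_group
begin

lemma sum_card_ann_vectors: "(\<Sum>g\<in>G. card (ann_vectors (act g) f)) = card (ann_pairs f)"
proof -
  have "ann_pairs f = Sigma G (\<lambda>g. ann_vectors (act g) f)"
    by (auto simp: ann_pairs_def ann_vectors_def)
  then show ?thesis using finite_G finite_ann_vectors by (simp add: card_SigmaI)
qed

text \<open>The weighted count of annihilated vectors is averaged over G; \<open>Q k\<close> is the
  bound for the number of pairs with annihilator p ^ k per group element.\<close>

lemma average_multiplicity_le:
  fixes Q :: "nat \<Rightarrow> real"
  assumes p: "irreducible p" "monic p" and n: "card V = CARD('a) ^ n"
    and m: "\<And>g. g \<in> G \<Longrightarrow> CARD('a) ^ (degree p * m g) \<le> card (primary_part (act g) p)"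
    and Q: "\<And>k. 1 \<le> k \<Longrightarrow> real (card (ann_pairs (p ^ k))) \<le> Q k * real (card G)"
  defines "x \<equiv> 1 / real CARD('a) ^ degree p"
  shows "average m G \<le> Q 1 / (real CARD('a) ^ degree p - 1) + 4 * x\<^sup>2 * Q 1 + (\<Sum>k=2..n. 2 * real k * x ^ k * Q k)"
    (is "_ \<le> ?R")
proof -
  let ?q = "real CARD('a)"
  let ?N = "\<lambda>g f. real (card (ann_vectors (act g) f))"
  let ?a = "1 / (?q ^ degree p - 1)"
  have "?q ^ degree p \<ge> 1" by (rule one_le_power) (simp add: Suc_le_eq)
  then have a0: "0 \<le> ?a" by simp
  have x0: "0 \<le> x" by (simp add: x_def)
  have S: "(\<Sum>g\<in>G. ?N g f) = real (card (ann_pairs f))" for f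
    unfolding sum_card_ann_vectors[symmetric] by simp
  have Q1: "real (card (ann_pairs p)) \<le> Q 1 * real (card G)" using Q[of 1] by simp
  have "(\<Sum>g\<in>G. real (m g)) \<le> (\<Sum>g\<in>G. ?a * ?N g p + 4 * x\<^sup>2 * ?N g p + (\<Sum>k=2..n. 2 * real k * x ^ k * ?N g (p ^ k)))"
  proof (rule sum_mono)
    fix g assume g: "g \<in> G"
    show "real (m g) \<le> ?a * ?N g p + 4 * x\<^sup>2 * ?N g p + (\<Sum>k=2..n. 2 * real k * x ^ k * ?N g (p ^ k))"
      using multiplicity_le[OF act_isom[OF g] p n m[OF g]] by (simp add: x_def)
  qed
  also have "\<dots> = ?a * real (card (ann_pairs p)) + 4 * x\<^sup>2 * real (card (ann_pairs p))
      + (\<Sum>k=2..n. 2 * real k * x ^ k * real (card (ann_pairs (p ^ k))))"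
    unfolding sum.distrib sum_distrib_left[symmetric] S
    by (subst sum.swap) (simp only: sum_distrib_left[symmetric] S)
  also have "\<dots> \<le> ?a * (Q 1 * real (card G)) + 4 * x\<^sup>2 * (Q 1 * real (card G))
      + (\<Sum>k=2..n. 2 * real k * x ^ k * (Q k * real (card G)))"
    using a0 x0 Q1 Q by (intro add_mono mult_left_mono sum_mono) auto
  also have "\<dots> = ?R * real (card G)"
    by (simp add: distrib_right sum_distrib_right mult.assoc)
  finally have "(\<Sum>g\<in>G. real (m g)) \<le> ?R * real (card G)" .
  moreover have "0 < real (card G)" using G_nonempty finite_G by (simp add: card_gt_0_iff)
  ultimately show ?thesis by (simp add: average_def divide_le_eq)
qed

text \<open>Here \<open>Q\<close> is 1. The constant is 22 = 2 + 4 + 2 * 8: the expansion of 1 / (q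
  ^ d - 1), the quadratic term, and the tail over k.\<close>

lemma average_multiplicity_nonself:
  assumes p: "p \<in> nonself_polys d" and n: "card V = CARD('a) ^ n"
    and m: "\<And>g. g \<in> G \<Longrightarrow> CARD('a) ^ (degree p * m g) \<le> card (primary_part (act g) p)"
  shows "average m G \<le> 1 / real CARD('a) ^ d + 22 * (1 / real CARD('a) ^ d)\<^sup>2"
proof -
  let ?q = "real CARD('a)"
  have p': "irreducible p" "monic p" "degree p = d" "coeff p 0 \<noteq> 0" "\<not> p dvd reflect_poly p"
    using p by (auto simp: nonself_polys_def irr_polys_def)
  define x where "x = 1 / ?q ^ d"
  have q: "2 \<le> ?q" using CARD_ge_2[where 'a = 'a] by simp
  have d: "0 < d" using irreducible_degree_pos[OF p'(1)] p'(3) by simp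
  have "?q ^ 1 \<le> ?q ^ d" using d q by (intro power_increasing) auto
  then have qd: "2 \<le> ?q ^ d" using q unfolding power_one_right by (rule order_trans[rotated])
  then have x: "0 \<le> x" "x \<le> 1 / 2" by (auto simp: x_def field_simps)
  have "average m G \<le> 1 / (?q ^ degree p - 1) + 4 * (1 / ?q ^ degree p)\<^sup>2 * 1 + (\<Sum>k=2..n. 2 * real k * (1 / ?q ^ degree p) ^ k * 1)"
    by (rule average_multiplicity_le[OF p'(1,2) n m]) (use card_ann_pairs_nonself[OF p'(1,2,4,5)] in auto)
  also have "\<dots> = 1 / (?q ^ d - 1) + 4 * x\<^sup>2 + 2 * (\<Sum>k=2..n. real k * x ^ k)"
    by (simp add: p'(3) x_def sum_distrib_left mult.assoc)
  also have "1 / (?q ^ d - 1) \<le> x + 2 * x\<^sup>2"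
    using qd by (simp add: x_def field_simps power2_eq_square)
  also have "(\<Sum>k=2..n. real k * x ^ k) \<le> 8 * x\<^sup>2" using x by (rule sum_linear_power_tail)
  finally show ?thesis by (simp add: x_def)
qed

text \<open>The degree of p ^ k is 2 * d * k and its constant coefficient is 1, so half the Gram
  entries are free and \<open>Q k\<close> is q ^ (d * k). This cancels half of the exponent in q ^ -
  (2 * d * k) and leaves powers of q ^ - d. The constant is 22 = 6 + 2 * 8.\<close>

lemma average_multiplicity_self:
  assumes p: "p \<in> self_polys d" and n: "card V = CARD('a) ^ n"
    and m: "\<And>g. g \<in> G \<Longrightarrow> CARD('a) ^ (degree p * m g) \<le> card (primary_part (act g) p)"
  shows "average m G \<le> 1 / real CARD('a) ^ d + 22 * (1 / real CARD('a) ^ d)\<^sup>2"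
proof -
  let ?q = "real CARD('a)"
  have p': "irreducible p" "monic p" "degree p = 2 * d" "reflect_poly p = p"
    using p by (auto simp: self_polys_def irr_polys_def)
  have p0: "p \<noteq> 0" using p'(1) by auto
  have c0: "coeff p 0 = 1" using p'(2,4) by (metis coeff_0_reflect_poly)
  define x where "x = 1 / ?q ^ d"
  have q: "2 \<le> ?q" using CARD_ge_2[where 'a = 'a] by simp
  have d: "0 < d" using irreducible_degree_pos[OF p'(1)] p'(3) by simp
  have "?q ^ 1 \<le> ?q ^ d" using d q by (intro power_increasing) auto
  then have qd: "2 \<le> ?q ^ d" using q unfolding power_one_right by (rule order_trans[rotated])
  then have x: "0 \<le> x" "x \<le> 1 / 2" by (auto simp: x_def field_simps)
  have "(1 :: 'a) \<noteq> - 1" using two_neq_0 by (metis add.right_inverse one_add_one)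
  then have "card (ann_pairs (p ^ k)) \<le> CARD('a) ^ ((degree (p ^ k) + 1) div 2) * card G" for k
    using p'(2) c0 by (intro card_ann_pairs_self) (simp_all add: lead_coeff_power poly_0_coeff_0[symmetric])
  moreover have "(degree (p ^ k) + 1) div 2 = d * k" for k
    using p0 by (simp add: degree_power_eq p'(3))
  ultimately have ap: "card (ann_pairs (p ^ k)) \<le> CARD('a) ^ (d * k) * card G" for k by simp
  have Q: "real (card (ann_pairs (p ^ k))) \<le> ?q ^ (d * k) * real (card G)" for k
    using ap[of k] by (metis of_nat_le_iff of_nat_mult of_nat_power)
  have "average m G \<le> ?q ^ (d * 1) / (?q ^ degree p - 1) + 4 * (1 / ?q ^ degree p)\<^sup>2 * ?q ^ (d * 1)
      + (\<Sum>k=2..n. 2 * real k * (1 / ?q ^ degree p) ^ k * ?q ^ (d * k))"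
    by (rule average_multiplicity_le[OF p'(1,2) n m, where Q = "\<lambda>k. ?q ^ (d * k)"]) (use Q in auto)
  also have "(\<Sum>k=2..n. 2 * real k * (1 / ?q ^ degree p) ^ k * ?q ^ (d * k)) = 2 * (\<Sum>k=2..n. real k * x ^ k)"
    unfolding sum_distrib_left
  proof (rule sum.cong)
    fix k
    have "(1 / ?q ^ degree p) ^ k * ?q ^ (d * k) = x ^ k"
      using qd by (simp add: p'(3) x_def mult_2 power_add power_mult power_mult_distrib power_one_over)
    then show "2 * real k * (1 / ?q ^ degree p) ^ k * ?q ^ (d * k) = 2 * (real k * x ^ k)" by (simp add: mult.assoc)
  qed simp
  also have "(\<Sum>k=2..n. real k * x ^ k) \<le> 8 * x\<^sup>2" using x by (rule sum_linear_power_tail)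
  also have "?q ^ (d * 1) / (?q ^ degree p - 1) + 4 * (1 / ?q ^ degree p)\<^sup>2 * ?q ^ (d * 1) \<le> x + 6 * x\<^sup>2"
  proof -
    define Y where "Y = ?q ^ d"
    have Y: "2 \<le> Y" "?q ^ degree p = Y * Y" "x = 1 / Y"
      using qd by (simp_all add: Y_def p'(3) mult_2 power_add x_def)
    have YY: "4 \<le> Y * Y" using mult_mono[of 2 Y 2 Y] Y(1) by simp
    have "Y / (Y * Y - 1) \<le> 1 / Y + 2 * (1 / Y)\<^sup>2"
    proof -
      have "Y * Y * Y \<le> (Y + 2) * (Y * Y - 1)"
      proof -
        have "(Y + 2) * (Y * Y - 1) - Y * Y * Y = 2 * (Y * Y) - Y - 2" by (simp add: algebra_simps)
        moreover have "Y * 2 \<le> Y * Y" using Y(1) by (intro mult_left_mono) auto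
        ultimately show ?thesis using Y(1) YY by linarith
      qed
      then show ?thesis using Y(1) YY by (simp add: field_simps power2_eq_square)
    qed
    moreover have "4 * (1 / (Y * Y))\<^sup>2 * Y \<le> 4 * (1 / Y)\<^sup>2"
      using Y(1) by (simp add: field_simps power2_eq_square)
    ultimately show ?thesis unfolding Y(2,3) by (simp add: Y_def)
  qed
  finally show ?thesis by (simp add: x_def)
qed

text \<open>In odd degree the number of free Gram entries is rounded up, so already for k = 1 the
  count q cancels the denominator q - 1 up to a constant. The bound is 30 = 2 + 4 + 4 * 6 and uses q
  \<ge> 3.\<close>

lemma average_multiplicity_linear:
  assumes c: "c = 1 \<or> c = - 1" and n: "card V = CARD('a) ^ n"
    and m: "\<And>g. g \<in> G \<Longrightarrow> CARD('a) ^ (degree [:c, 1:] * m g) \<le> card (primary_part (act g) [:c, 1:])"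
  shows "average m G \<le> 30"
proof -
  let ?q = "real CARD('a)"
  let ?p = "[:c, 1:]"
  have n1: "(1 :: 'a) \<noteq> - 1" using two_neq_0 by (metis add.right_inverse one_add_one)
  have "card {0, 1, - 1 :: 'a} \<le> CARD('a)" by (intro card_mono) auto
  then have q: "3 \<le> ?q" using n1 by simp
  have irr: "irreducible ?p" "monic ?p" by (simp_all add: irreducible_linear_field_poly)
  have ck: "coeff (?p ^ k) 0 = c ^ k" for k by (simp add: poly_0_coeff_0[symmetric])
  have dk: "degree (?p ^ k) = k" for k by (simp add: degree_power_eq)
  have "card (ann_pairs (?p ^ k)) \<le> CARD('a) ^ ((degree (?p ^ k) + 1) div 2) * card G" for k
  proof (rule card_ann_pairs_self)
    show "monic (?p ^ k)" by (simp only: lead_coeff_power) simp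
    show "coeff (?p ^ k) 0 \<noteq> 0" using c by (auto simp: ck)
    show "odd (degree (?p ^ k)) \<or> coeff (?p ^ k) 0 \<noteq> - 1" using c n1 by (cases "odd k") (auto simp: ck dk)
  qed
  then have ap: "card (ann_pairs (?p ^ k)) \<le> CARD('a) ^ ((k + 1) div 2) * card G" for k by (simp only: dk)
  have Q: "real (card (ann_pairs (?p ^ k))) \<le> ?q ^ ((k + 1) div 2) * real (card G)" for k
    using ap[of k] by (metis of_nat_le_iff of_nat_mult of_nat_power)
  have "average m G \<le> ?q ^ ((1 + 1) div 2) / (?q ^ degree ?p - 1) + 4 * (1 / ?q ^ degree ?p)\<^sup>2 * ?q ^ ((1 + 1) div 2)
      + (\<Sum>k=2..n. 2 * real k * (1 / ?q ^ degree ?p) ^ k * ?q ^ ((k + 1) div 2))"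
    by (rule average_multiplicity_le[OF irr n m, where Q = "\<lambda>k. ?q ^ ((k + 1) div 2)"]) (use Q in auto)
  also have "\<dots> = ?q / (?q - 1) + 4 / ?q + (\<Sum>k=2..n. 2 * real k * (1 / ?q) ^ k * ?q ^ ((k + 1) div 2))"
    using q by (simp add: power2_eq_square)
  also have "?q / (?q - 1) \<le> 2" using q by (simp add: divide_le_eq)
  also have "4 / ?q \<le> 4" using q by (simp add: divide_le_eq)
  also have "(\<Sum>k=2..n. 2 * real k * (1 / ?q) ^ k * ?q ^ ((k + 1) div 2)) \<le> (\<Sum>k=2..n. 4 * (real k * (2 / 3) ^ k))"
  proof (rule sum_mono)
    fix k
    have "?q ^ k = ?q ^ (k div 2) * ?q ^ ((k + 1) div 2)"
      unfolding power_add[symmetric] by (rule arg_cong[where f = "power ?q"]) presburger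
    then have "(1 / ?q) ^ k * ?q ^ ((k + 1) div 2) = 1 / ?q ^ (k div 2)"
      using q by (simp add: power_one_over)
    also have "\<dots> \<le> 1 / 3 ^ (k div 2)" using q by (intro divide_left_mono power_mono) auto
    \<comment> \<open>The ratio 2/3 serves because its square exceeds 1/3; the factor 2 absorbs the
      rounding for odd k.\<close>
    also have "\<dots> \<le> 2 * (2 / 3) ^ k"
    proof -
      have pos: "(9 / 4 :: real) ^ j \<le> 3 ^ j" for j by (intro power_mono) auto
      have "(3 / 2 :: real) ^ k \<le> 2 * 3 ^ (k div 2)"
      proof (cases "even k")
        case True
        then obtain j where k: "k = 2 * j" by blast
        have "(3 / 2 :: real) ^ k = (9 / 4) ^ j" by (simp add: k power_mult power2_eq_square)
        also have "\<dots> \<le> 2 * 3 ^ j" using pos[of j] by (rule order_trans) simp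
        finally show ?thesis by (simp add: k)
      next
        case False
        then obtain j where k: "k = 2 * j + 1" by (elim oddE)
        have "(3 / 2 :: real) ^ k = 3 / 2 * (9 / 4) ^ j" by (simp add: k power_mult power2_eq_square)
        also have "\<dots> \<le> 2 * 3 ^ j" using pos[of j] by (intro mult_mono) auto
        finally show ?thesis by (simp add: k)
      qed
      moreover have "(2 / 3 :: real) ^ k = 1 / (3 / 2) ^ k" by (simp add: power_divide)
      ultimately show ?thesis by (simp add: field_simps)
    qed
    finally have "2 * real k * ((1 / ?q) ^ k * ?q ^ ((k + 1) div 2)) \<le> 2 * real k * (2 * (2 / 3) ^ k)"
      by (rule mult_left_mono) simp
    then show "2 * real k * (1 / ?q) ^ k * ?q ^ ((k + 1) div 2) \<le> 4 * (real k * (2 / 3) ^ k)"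
      by (simp add: mult_ac)
  qed
  also have "\<dots> = 4 * (\<Sum>k=2..n. real k * (2 / 3) ^ k)" by (rule sum_distrib_left[symmetric])
  also have "(\<Sum>k=2..n. real k * (2 / 3) ^ k) \<le> 6"
  proof -
    have "(\<Sum>k=2..n. real k * (2 / 3) ^ k) \<le> (\<Sum>k=1..n. real k * (2 / 3 :: real) ^ k)" by (rule sum_mono2) auto
    with sum_linear_two_thirds show ?thesis by (rule order_trans[rotated])
  qed
  finally show ?thesis by simp
qed

end

text \<open>Abel summation on the deviations R of the partial sums from n. The constant is not
  enlarged, because the weights 1/d - 1/(d + 1) telescope and together with 1/(n + 1) add up to
  1.\<close>

lemma sum_diff_harmonic_le:
  fixes h :: "nat \<Rightarrow> real"
  assumes "\<And>n. \<bar>(\<Sum>d=1..n. h d) - real n\<bar> \<le> C"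
  shows "\<bar>(\<Sum>d=1..n. h d / real d) - (\<Sum>d=1..n. 1 / real d)\<bar> \<le> C"
proof -
  define R where "R n = (\<Sum>d=1..n. h d) - real n" for n
  have R: "\<bar>R n\<bar> \<le> C" for n using assms by (simp add: R_def)
  have eq: "(\<Sum>d=1..n. h d / real d) - (\<Sum>d=1..n. 1 / real d)
    = R n / real (n + 1) + (\<Sum>d=1..n. R d * (1 / real d - 1 / real (d + 1)))"
  proof (induction n)
    case (Suc n)
    have "R (Suc n) - R n = h (Suc n) - 1" by (simp add: R_def)
    then have h: "h (Suc n) = R (Suc n) - R n + 1" by simp
    show ?case using Suc by (simp add: h diff_divide_distrib add_divide_distrib right_diff_distrib)
  qed (simp add: R_def)
  have tel: "(\<Sum>d=1..n. 1 / real d - 1 / real (d + 1)) = 1 - 1 / real (n + 1)"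
    by (induction n) auto
  have "\<bar>R n / real (n + 1) + (\<Sum>d=1..n. R d * (1 / real d - 1 / real (d + 1)))\<bar>
    \<le> \<bar>R n / real (n + 1)\<bar> + (\<Sum>d=1..n. \<bar>R d * (1 / real d - 1 / real (d + 1))\<bar>)"
    by (intro order_trans[OF abs_triangle_ineq] add_mono sum_abs order_refl)
  also have "\<dots> \<le> C / real (n + 1) + (\<Sum>d=1..n. C * (1 / real d - 1 / real (d + 1)))"
  proof (intro add_mono sum_mono)
    show "\<bar>R n / real (n + 1)\<bar> \<le> C / real (n + 1)" using R[of n] by (simp add: divide_right_mono)
    fix d assume "d \<in> {1..n}"
    then have "0 \<le> 1 / real d - 1 / real (d + 1)" by (simp add: field_simps)
    then show "\<bar>R d * (1 / real d - 1 / real (d + 1))\<bar> \<le> C * (1 / real d - 1 / real (d + 1))"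
      using R[of d] by (simp add: abs_mult mult_right_mono)
  qed
  also have "\<dots> = C" unfolding sum_distrib_left[symmetric] tel by (simp add: algebra_simps)
  finally show ?thesis unfolding eq .
qed

lemma harmonic_ln_le:
  assumes "1 \<le> n"
  shows "\<bar>(\<Sum>d=1..n. 1 / real d) - ln (real n)\<bar> \<le> 1"
proof -
  have step: "1 / (real n + 1) \<le> ln (real n + 1) - ln (real n)" "ln (real n + 1) - ln (real n) \<le> 1 / real n"
    if "1 \<le> n" for n
  proof -
    have "ln (real n / (real n + 1)) \<le> real n / (real n + 1) - 1" using that by (intro ln_le_minus_one) simp
    then show "1 / (real n + 1) \<le> ln (real n + 1) - ln (real n)" using that by (simp add: ln_div field_simps)
    have "ln ((real n + 1) / real n) \<le> (real n + 1) / real n - 1" using that by (intro ln_le_minus_one) simp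
    moreover have "ln ((real n + 1) / real n) = ln (real n + 1) - ln (real n)" using that by (subst ln_div) auto
    moreover have "(real n + 1) / real n - 1 = 1 / real n" using that by (simp add: field_simps)
    ultimately show "ln (real n + 1) - ln (real n) \<le> 1 / real n" by linarith
  qed
  \<comment> \<open>The lower bound carries n + 1 under the logarithm, so that the induction step
    closes.\<close>
  have "(\<Sum>d=1..n. 1 / real d) \<le> 1 + ln (real n) \<and> ln (real n + 1) \<le> (\<Sum>d=1..n. 1 / real d)"
    using assms
  proof (induction n rule: dec_induct)
    case base
    have "ln (2 :: real) \<le> 1" using ln_le_minus_one[of 2] by simp
    then show ?case by simp
  next
    case (step n)
    then show ?case using \<open>\<And>n. 1 \<le> n \<Longrightarrow> 1 / (real n + 1) \<le> ln (real n + 1) - ln (real n)\<close>[of n]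
        \<open>\<And>n. 1 \<le> n \<Longrightarrow> ln (real n + 1) - ln (real n) \<le> 1 / real n\<close>[of "Suc n"]
      by (simp add: add.commute)
  qed
  moreover have "ln (real n) \<le> ln (real n + 1)" using assms by simp
  ultimately show ?thesis by linarith
qed


section \<open>Average number of irreducible factors\<close>

text \<open>The total weight of the irreducibles with weight at least q ^ - D: self-reciprocal ones
  up to degree 2 * D and the others up to degree D. With D = n div 2 these are the ones that can
  occur in dimension n, apart from x - 1 and x + 1.\<close>

definition poly_weight :: "'a :: {field, finite} itself \<Rightarrow> nat \<Rightarrow> real" where
  "poly_weight _ D = (\<Sum>d=1..D. (real (card (nonself_polys d :: 'a poly set)) +
     real (card (self_polys d :: 'a poly set))) / real CARD('a) ^ d)"

lemma average_nonneg: "0 \<le> average f S"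
  by (simp add: average_def sum_nonneg)

context orthogonal_mat
begin

definition mean_mult :: "'a poly \<Rightarrow> real" where
  "mean_mult p = average (\<lambda>A. factor_mult p (char_poly A)) (isometry_group n J)"

lemma mean_mult_nonneg: "0 \<le> mean_mult p"
  by (simp add: mean_mult_def average_nonneg)

lemma group_carrier: "A \<in> isometry_group n J \<Longrightarrow> A \<in> carrier_mat n n"
  by (simp add: isometry_group_def)

lemma card_group_pos: "0 < card (isometry_group n J)"
  using G_nonempty finite_G by (simp add: card_gt_0_iff)

lemma char_poly_props:
  assumes "A \<in> isometry_group n J"
  shows "char_poly A \<noteq> 0" "degree (char_poly A) = n"
  using degree_monic_char_poly[OF group_carrier[OF assms]] by auto

lemma num_factors_eq:
  assumes "A \<in> isometry_group n J"
  shows "num_factors_char_poly A = (\<Sum>p\<in>irr_polys_upto n. factor_mult p (char_poly A))"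
proof -
  let ?f = "char_poly A"
  note f = char_poly_props[OF assms]
  have "num_factors_char_poly A = (\<Sum>p\<in>{p. monic p \<and> irreducible p \<and> p dvd ?f}. factor_mult p ?f)"
    by (simp add: num_factors_char_poly_def num_irreducible_factors_def factor_mult_def)
  also have "\<dots> = (\<Sum>p\<in>irr_polys_upto n. factor_mult p ?f)"
  proof (rule sum.mono_neutral_left[OF finite_irr_polys_upto])
    show "{p. monic p \<and> irreducible p \<and> p dvd ?f} \<subseteq> irr_polys_upto n"
      using f dvd_imp_degree_le[of _ ?f] by (auto intro!: irr_polys_uptoI)
    show "\<forall>p\<in>irr_polys_upto n - {p. monic p \<and> irreducible p \<and> p dvd ?f}. factor_mult p ?f = 0"
    proof
      fix p assume "p \<in> irr_polys_upto n - {p. monic p \<and> irreducible p \<and> p dvd ?f}"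
      then have "irreducible p" "\<not> p dvd ?f" using irr_polys_uptoD[of p n] by auto
      then show "factor_mult p ?f = 0" using factor_mult_eq_0_iff f(1) by blast
    qed
  qed
  finally show ?thesis .
qed

lemma average_num_factors:
  "average num_factors_char_poly (isometry_group n J) = (\<Sum>p\<in>irr_polys_upto n. mean_mult p)"
proof -
  have "(\<Sum>A\<in>isometry_group n J. real (num_factors_char_poly A))
    = (\<Sum>A\<in>isometry_group n J. \<Sum>p\<in>irr_polys_upto n. real (factor_mult p (char_poly A)))"
    by (intro sum.cong refl) (simp add: num_factors_eq)
  also have "\<dots> = (\<Sum>p\<in>irr_polys_upto n. \<Sum>A\<in>isometry_group n J. real (factor_mult p (char_poly A)))"
    by (rule sum.swap)
  finally show ?thesis by (simp add: average_def mean_mult_def sum_divide_distrib)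
qed

lemma sum_degree_mean_mult: "(\<Sum>p\<in>irr_polys_upto n. real (degree p) * mean_mult p) = real n"
proof -
  let ?G = "isometry_group n J"
  have "(\<Sum>p\<in>irr_polys_upto n. \<Sum>A\<in>?G. real (degree p) * real (factor_mult p (char_poly A)))
    = (\<Sum>A\<in>?G. real (\<Sum>p\<in>irr_polys_upto n. degree p * factor_mult p (char_poly A)))"
    by (subst sum.swap) simp
  also have "\<dots> = (\<Sum>A\<in>?G. real n)"
    using char_poly_props by (intro sum.cong refl arg_cong[where f = real]) (simp add: sum_degree_mult_upto)
  finally have "(\<Sum>p\<in>irr_polys_upto n. \<Sum>A\<in>?G. real (degree p) * real (factor_mult p (char_poly A))) = real n * real (card ?G)"
    by simp
  moreover have "(\<Sum>p\<in>irr_polys_upto n. real (degree p) * mean_mult p)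
    = (\<Sum>p\<in>irr_polys_upto n. \<Sum>A\<in>?G. real (degree p) * real (factor_mult p (char_poly A))) / real (card ?G)"
    by (simp add: mean_mult_def average_def sum_divide_distrib sum_distrib_left)
  ultimately show ?thesis using card_group_pos by simp
qed

lemma factor_mult_eq_0I:
  assumes "A \<in> isometry_group n J" "irreducible p" "monic p" "card (primary_part (mat_act n A) p) \<le> 1"
  shows "factor_mult p (char_poly A) = 0"
proof (rule ccontr)
  assume "factor_mult p (char_poly A) \<noteq> 0"
  then have "degree p * factor_mult p (char_poly A) \<noteq> 0" using irreducible_degree_pos[OF assms(2)] by simp
  then have "1 < CARD('a) ^ (degree p * factor_mult p (char_poly A))"
    using CARD_ge_2[where 'a = 'a] by (intro one_less_power) auto
  then show False using card_primary_part_ge[OF assms(1-3)] assms(4) by linarith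
qed

lemma mean_mult_X: "mean_mult [:0, 1:] = 0"
proof -
  have "factor_mult [:0, 1:] (char_poly A) = 0" if A: "A \<in> isometry_group n J" for A
  proof (rule factor_mult_eq_0I[OF A])
    let ?g = "mat_act n A"
    have g: "isom ?g" using A by (rule isom_mat_act)
    show "irreducible [:0, 1 :: 'a:]" by (simp add: irreducible_linear_field_poly)
    have "v = 0" if "v \<in> kernel_of ?g ([:0, 1:] ^ k)" for v k
      using that
    proof (induction k)
      case (Suc k)
      have "pact ?g ([:0, 1:] * [:0, 1:] ^ k) v = 0" using Suc.prems by (simp add: kernel_of_def)
      then have "?g (pact ?g ([:0, 1:] ^ k) v) = ?g 0"
        by (simp only: pact_mult[OF isom_lin[OF g]] pact_pCons[OF isom_lin[OF g]] pact_0 scale_zero_left add_0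
            scale_one isom_0[OF g] add_0_right)
      moreover have vV: "v \<in> fspace n" using Suc.prems by (simp add: kernel_of_def)
      ultimately have "pact ?g ([:0, 1:] ^ k) v = 0"
        using isom_inj_on[OF g] pact_V[OF g vV] V_closed(4) by (metis inj_on_eq_iff)
      then have "v \<in> kernel_of ?g ([:0, 1:] ^ k)" unfolding kernel_of_def using vV by blast
      then show ?case by (rule Suc.IH)
    qed (simp add: kernel_of_def)
    then have "primary_part ?g [:0, 1:] \<subseteq> {0}" unfolding primary_part_def by blast
    then show "card (primary_part ?g [:0, 1:]) \<le> 1"
      using card_mono[of "{0 :: nat \<Rightarrow> 'a}" "primary_part ?g [:0, 1:]"] by simp
  qed simp
  then show ?thesis by (simp add: mean_mult_def average_def)
qed

text \<open>An occurrence of p would give a vector with annihilator p; its orbit spans a totally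
  isotropic subspace of dimension d, which needs 2 * d \<le> n.\<close>

lemma mean_mult_nonself_large:
  assumes p: "p \<in> nonself_polys d" and d: "n < 2 * d"
  shows "mean_mult p = 0"
proof -
  have p': "irreducible p" "monic p" "degree p = d" "\<not> p dvd reflect_poly p"
    using p by (auto simp: nonself_polys_def irr_polys_def)
  have p0: "p \<noteq> 0" using p'(1) by auto
  have "factor_mult p (char_poly A) = 0" if A: "A \<in> isometry_group n J" for A
  proof (rule factor_mult_eq_0I[OF A p'(1,2)])
    have g: "isom (mat_act n A)" using A by (rule isom_mat_act)
    show "card (primary_part (mat_act n A) p) \<le> 1"
    proof (rule ccontr)
      assume "\<not> ?thesis"
      then have "1 < card (primary_part (mat_act n A) p)" by simp
      then obtain k where "CARD('a) ^ degree p - 1 \<le> card (ann_vectors (mat_act n A) p)"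
        by (rule primary_part_cases[OF g p'(1,2)])
      moreover have "1 < CARD('a) ^ degree p"
        using CARD_ge_2[where 'a = 'a] irreducible_degree_pos[OF p'(1)] by (intro one_less_power) auto
      ultimately have "ann_vectors (mat_act n A) p \<noteq> {}" by auto
      then obtain v where v: "v \<in> fspace n" "annihilator (mat_act n A) v p" by (auto simp: ann_vectors_def)
      have "CARD('a) ^ (2 * degree p) \<le> card (fspace n :: (nat \<Rightarrow> 'a) set)"
        using gram_nonself[OF g v(1) p'(1,4), of 1] v(2)
        by (intro isotropic_degree_bound[OF g v(1) p0 v(2)]) simp
      then have "2 * d \<le> n" using CARD_ge_2[where 'a = 'a] by (simp add: card_fspace p'(3))
      with d show False by simp
    qed
  qed
  then show ?thesis by (simp add: mean_mult_def average_def)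
qed

lemma mean_mult_nonself:
  assumes p: "p \<in> nonself_polys d"
  shows "mean_mult p \<le> 1 / real CARD('a) ^ d + 22 * (1 / real CARD('a) ^ d)\<^sup>2"
  unfolding mean_mult_def
  by (rule average_multiplicity_nonself[OF p card_fspace card_primary_part_ge])
    (use p in \<open>auto simp: nonself_polys_def irr_polys_def\<close>)

lemma mean_mult_self:
  assumes p: "p \<in> self_polys d"
  shows "mean_mult p \<le> 1 / real CARD('a) ^ d + 22 * (1 / real CARD('a) ^ d)\<^sup>2"
  unfolding mean_mult_def
  by (rule average_multiplicity_self[OF p card_fspace card_primary_part_ge])
    (use p in \<open>auto simp: self_polys_def irr_polys_def\<close>)

lemma mean_mult_linear: "c = 1 \<or> c = - 1 \<Longrightarrow> mean_mult [:c, 1:] \<le> 30"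
  unfolding mean_mult_def
  by (rule average_multiplicity_linear[OF _ card_fspace card_primary_part_ge])
    (auto simp: irreducible_linear_field_poly)

abbreviation "nonselfs \<equiv> \<Union>d\<in>{1..n div 2}. nonself_polys d :: 'a poly set"
abbreviation "selfs \<equiv> \<Union>d\<in>{1..n div 2}. self_polys d :: 'a poly set"

lemma finite_selfs: "finite nonselfs" "finite selfs"
  by (auto simp: finite_nonself_polys finite_self_polys)

lemma selfs_disjoint: "nonselfs \<inter> selfs = {}"
  by (auto simp: nonself_polys_def self_polys_def)

text \<open>The first argument of \<open>g\<close> stands for the degree and the second for the
  exponent in the weight; they agree for the first family and differ by the factor 2 for the
  second.\<close>

lemma sum_selfs:
  fixes g :: "nat \<Rightarrow> nat \<Rightarrow> real"
  shows "(\<Sum>p\<in>nonselfs. g (degree p) (degree p)) + (\<Sum>p\<in>selfs. g (2 * (degree p div 2)) (degree p div 2))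
    = (\<Sum>d=1..n div 2. real (card (nonself_polys d :: 'a poly set)) * g d d + real (card (self_polys d :: 'a poly set)) * g (2 * d) d)"
proof -
  have "(\<Sum>p\<in>nonselfs. g (degree p) (degree p)) = (\<Sum>d=1..n div 2. real (card (nonself_polys d :: 'a poly set)) * g d d)"
    by (rule sum_UN_const[where g = "\<lambda>d. g d d" and e = degree])
      (auto simp: finite_nonself_polys, auto simp: nonself_polys_def irr_polys_def)
  moreover have "(\<Sum>p\<in>selfs. g (2 * (degree p div 2)) (degree p div 2)) = (\<Sum>d=1..n div 2. real (card (self_polys d :: 'a poly set)) * g (2 * d) d)"
    by (rule sum_UN_const[where g = "\<lambda>d. g (2 * d) d" and e = "\<lambda>p. degree p div 2"])
      (auto simp: finite_self_polys, auto simp: self_polys_def irr_polys_def)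
  ultimately show ?thesis by (simp add: sum.distrib)
qed

text \<open>The remainder \<open>e\<close> comes from x - 1 and x + 1, each with mean at most 30. It
  is used with h constant, for the number of factors, and with h the degree, for the degree
  identity.\<close>

lemma sum_mean_mult_split:
  fixes h :: "nat \<Rightarrow> real"
  assumes "h 1 = 1" "\<And>d. 0 \<le> h d"
  shows "\<exists>e. 0 \<le> e \<and> e \<le> 60 \<and> (\<Sum>p\<in>irr_polys_upto n. h (degree p) * mean_mult p)
    = (\<Sum>p\<in>nonselfs. h (degree p) * mean_mult p) + (\<Sum>p\<in>selfs. h (degree p) * mean_mult p) + e"
proof -
  let ?F = "\<lambda>p. h (degree p) * mean_mult p"
  let ?S = "nonselfs \<union> selfs"
  let ?L = "{[:1, 1:], [:- 1, 1:]} :: 'a poly set"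
  let ?e = "sum ?F (irr_polys_upto n - ?S)"
  have F0: "0 \<le> ?F p" for p using assms(2) mean_mult_nonneg by simp
  have S: "?S \<subseteq> irr_polys_upto n"
    by (auto simp: nonself_polys_def self_polys_def irr_polys_def intro!: irr_polys_uptoI)
  have "?F p = 0" if p: "p \<in> irr_polys_upto n - ?S - ?L" for p
  proof -
    have pd: "p \<in> irr_polys (degree p)" "degree p \<le> n" "1 \<le> degree p"
      using p irr_polys_uptoD[of p n] by (auto simp: irr_polys_def)
    from pd(1) two show ?thesis
    proof (cases rule: irr_polys_cases)
      case 1
      then show ?thesis by (simp add: mean_mult_X)
    next
      case 4
      then have "\<not> degree p \<le> n div 2" using p pd by auto
      then show ?thesis using mean_mult_nonself_large[OF 4] by simp
    next
      case (5 e)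
      then have "e \<in> {1..n div 2}" using pd by auto
      then show ?thesis using 5 p by blast
    qed (use p in auto)
  qed
  then have "\<forall>p\<in>(irr_polys_upto n - ?S) - (irr_polys_upto n - ?S) \<inter> ?L. ?F p = 0" by blast
  then have "?e = sum ?F ((irr_polys_upto n - ?S) \<inter> ?L)"
    by (intro sum.mono_neutral_right finite_Diff finite_irr_polys_upto Int_lower1)
  also have "\<dots> \<le> sum ?F ?L"
    by (rule sum_mono2[OF _ Int_lower2 F0]) simp
  also have "\<dots> \<le> (\<Sum>p\<in>?L. 30)"
    using mean_mult_linear assms(1) by (intro sum_mono) auto
  also have "\<dots> \<le> 60" using card_insert_le_m1[of 2 "{[:- 1, 1:]} :: 'a poly set" "[:1, 1:]"] by simp
  finally have "?e \<le> 60" .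
  moreover have "0 \<le> ?e" using F0 by (rule sum_nonneg)
  moreover have "sum ?F (irr_polys_upto n) = sum ?F nonselfs + sum ?F selfs + ?e"
    using sum.subset_diff[OF S finite_irr_polys_upto, of ?F]
      sum.union_disjoint[OF finite_selfs selfs_disjoint, of ?F] by simp
  ultimately show ?thesis by blast
qed

text \<open>The degree identity forces the total slack in the upper bounds for the expected
  multiplicities to be bounded, so these upper bounds are also lower bounds on average.\<close>

lemma average_num_factors_bounds:
  shows "\<bar>average num_factors_char_poly (isometry_group n J) - poly_weight TYPE('a) (n div 2)\<bar> \<le> 400"
    and "real n - 200 \<le> (\<Sum>d=1..n div 2. real d * real (card (nonself_polys d :: 'a poly set)) / real CARD('a) ^ d) +
      (\<Sum>d=1..n div 2. 2 * real d * real (card (self_polys d :: 'a poly set)) / real CARD('a) ^ d)"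
proof -
  let ?q = "real CARD('a)"
  let ?D = "n div 2"
  let ?A = "\<lambda>d. real (card (nonself_polys d :: 'a poly set))"
  let ?M = "\<lambda>d. real (card (self_polys d :: 'a poly set))"
  define w where "w d = 1 / ?q ^ d" for d
  have w0: "0 \<le> w d" for d by (simp add: w_def)
  let ?H = "(\<Sum>d=1..?D. real d * ?A d / ?q ^ d) + (\<Sum>d=1..?D. 2 * real d * ?M d / ?q ^ d)"
  let ?b = "\<lambda>d. w d + 22 * (w d)\<^sup>2"
  have q: "2 \<le> ?q" using CARD_ge_2[where 'a = 'a] by simp
  have Aw: "?A d * w d \<le> 1" and Mw: "?M d * w d \<le> 1" for d
  proof -
    have "?A d \<le> ?q ^ d" using card_nonself_polys_le[of d, where 'a = 'a] by (metis of_nat_le_iff of_nat_power)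
    then show "?A d * w d \<le> 1" using q by (simp add: w_def)
    have "?M d \<le> ?q ^ d" using card_self_polys_le[of d, where 'a = 'a] by (metis of_nat_le_iff of_nat_power)
    then show "?M d * w d \<le> 1" using q by (simp add: w_def)
  qed
  \<comment> \<open>At most q ^ d polynomials have index d, which uses up one factor
    \<open>w d\<close>. The degrees d and 2 * d add to 3 * d, and d / q ^ d sums to at most
    2.\<close>
  have quad: "(\<Sum>d=1..?D. ?A d * (real d * (w d)\<^sup>2) + ?M d * (real (2 * d) * (w d)\<^sup>2)) \<le> 6"
  proof -
    have "(\<Sum>d=1..?D. ?A d * (real d * (w d)\<^sup>2) + ?M d * (real (2 * d) * (w d)\<^sup>2)) \<le> (\<Sum>d=1..?D. 3 * (real d / ?q ^ d))"
    proof (rule sum_mono)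
      fix d
      have "(?A d * w d) * (real d * w d) + (?M d * w d) * (2 * (real d * w d)) \<le> 1 * (real d * w d) + 1 * (2 * (real d * w d))"
        using Aw Mw w0 by (intro add_mono mult_right_mono) auto
      then show "?A d * (real d * (w d)\<^sup>2) + ?M d * (real (2 * d) * (w d)\<^sup>2) \<le> 3 * (real d / ?q ^ d)"
        by (simp add: w_def power2_eq_square mult_ac)
    qed
    also have "\<dots> \<le> 3 * 2"
      unfolding sum_distrib_left[symmetric] using sum_linear_inverse_power_le[OF CARD_ge_2[where 'a = 'a]] by simp
    finally show ?thesis by simp
  qed
  let ?s1 = "\<lambda>p. ?b (degree p) - mean_mult p"
  let ?s2 = "\<lambda>p. ?b (degree p div 2) - mean_mult p"
  have s1: "0 \<le> ?s1 p" "1 \<le> degree p" if "p \<in> nonselfs" for p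
  proof -
    obtain d where d: "1 \<le> d" "p \<in> nonself_polys d" using \<open>p \<in> nonselfs\<close> by auto
    then have "degree p = d" by (auto simp: nonself_polys_def irr_polys_def)
    then show "0 \<le> ?s1 p" "1 \<le> degree p" using mean_mult_nonself[OF d(2)] d(1) by (simp_all add: w_def)
  qed
  have s2: "0 \<le> ?s2 p" "2 * (degree p div 2) = degree p" "1 \<le> degree p" if "p \<in> selfs" for p
  proof -
    obtain d where d: "1 \<le> d" "p \<in> self_polys d" using \<open>p \<in> selfs\<close> by auto
    then have "degree p = 2 * d" by (auto simp: self_polys_def irr_polys_def)
    then show "0 \<le> ?s2 p" "2 * (degree p div 2) = degree p" "1 \<le> degree p"
      using mean_mult_self[OF d(2)] d(1) by (simp_all add: w_def)
  qed
  define s where "s = (\<Sum>p\<in>nonselfs. ?s1 p) + (\<Sum>p\<in>selfs. ?s2 p)"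
  define ds where "ds = (\<Sum>p\<in>nonselfs. real (degree p) * ?s1 p) + (\<Sum>p\<in>selfs. real (degree p) * ?s2 p)"
  have s_nonneg: "0 \<le> s" unfolding s_def using s1 s2 by (intro add_nonneg_nonneg sum_nonneg) auto
  have s_ds: "s \<le> ds"
    unfolding s_def ds_def
  proof (intro add_mono sum_mono)
    show "?s1 p \<le> real (degree p) * ?s1 p" if "p \<in> nonselfs" for p
      using mult_right_mono[of 1 "real (degree p)" "?s1 p"] s1[OF that] by simp
    show "?s2 p \<le> real (degree p) * ?s2 p" if "p \<in> selfs" for p
      using mult_right_mono[of 1 "real (degree p)" "?s2 p"] s2[OF that] by simp
  qed
  obtain e1 where e1: "0 \<le> e1" "e1 \<le> 60" "(\<Sum>p\<in>irr_polys_upto n. mean_mult p) = (\<Sum>p\<in>nonselfs. mean_mult p) + (\<Sum>p\<in>selfs. mean_mult p) + e1"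
    using sum_mean_mult_split[of "\<lambda>_. 1"] by auto
  obtain e2 where e2: "0 \<le> e2" "e2 \<le> 60" "real n = (\<Sum>p\<in>nonselfs. real (degree p) * mean_mult p) + (\<Sum>p\<in>selfs. real (degree p) * mean_mult p) + e2"
    using sum_mean_mult_split[of real] unfolding sum_degree_mean_mult by auto
  have "ds = (\<Sum>p\<in>nonselfs. real (degree p) * ?b (degree p)) + (\<Sum>p\<in>selfs. real (2 * (degree p div 2)) * ?b (degree p div 2)) - (real n - e2)"
  proof -
    have "(\<Sum>p\<in>selfs. real (2 * (degree p div 2)) * ?b (degree p div 2)) = (\<Sum>p\<in>selfs. real (degree p) * ?b (degree p div 2))"
      using s2(2) by (intro sum.cong refl) simp
    then show ?thesis unfolding ds_def e2(3) by (simp add: right_diff_distrib sum_subtractf)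
  qed
  also have "(\<Sum>p\<in>nonselfs. real (degree p) * ?b (degree p)) + (\<Sum>p\<in>selfs. real (2 * (degree p div 2)) * ?b (degree p div 2))
    = (\<Sum>d=1..?D. ?A d * (real d * ?b d) + ?M d * (real (2 * d) * ?b d))"
    by (rule sum_selfs[of "\<lambda>a d. real a * ?b d"])
  also have "\<dots> = ?H + 22 * (\<Sum>d=1..?D. ?A d * (real d * (w d)\<^sup>2) + ?M d * (real (2 * d) * (w d)\<^sup>2))"
    unfolding sum_distrib_left sum.distrib[symmetric]
    by (intro sum.cong refl) (simp add: w_def algebra_simps)
  finally have ds: "ds = ?H + 22 * (\<Sum>d=1..?D. ?A d * (real d * (w d)\<^sup>2) + ?M d * (real (2 * d) * (w d)\<^sup>2)) - (real n - e2)" .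
  have H: "?H \<le> 2 * real ?D" by (rule sum_nonself_self_upper)
  have Dn: "2 * real ?D \<le> real n" by linarith
  from ds s_nonneg s_ds quad e2 show "real n - 200 \<le> ?H" by linarith
  \<comment> \<open>The main term \<open>?H\<close> is at most n and cancels; 192 = 22 * 6 + 60 is
    left from the quadratic errors and from the two linear exceptions.\<close>
  have s_le: "s \<le> 192" using ds s_ds quad e2 H Dn by linarith
  have "s = (\<Sum>p\<in>nonselfs. ?b (degree p)) + (\<Sum>p\<in>selfs. ?b (degree p div 2)) - ((\<Sum>p\<in>irr_polys_upto n. mean_mult p) - e1)"
    unfolding s_def e1(3) by (simp add: sum_subtractf)
  also have "(\<Sum>p\<in>nonselfs. ?b (degree p)) + (\<Sum>p\<in>selfs. ?b (degree p div 2)) = (\<Sum>d=1..?D. ?A d * ?b d + ?M d * ?b d)"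
    by (rule sum_selfs[of "\<lambda>a d. ?b d"])
  also have "\<dots> = poly_weight TYPE('a) ?D + 22 * (\<Sum>d=1..?D. ?A d * (w d)\<^sup>2 + ?M d * (w d)\<^sup>2)"
    unfolding poly_weight_def sum_distrib_left sum.distrib[symmetric]
    by (intro sum.cong refl) (simp add: w_def algebra_simps add_divide_distrib)
  finally have s: "s = poly_weight TYPE('a) ?D + 22 * (\<Sum>d=1..?D. ?A d * (w d)\<^sup>2 + ?M d * (w d)\<^sup>2)
    - (average num_factors_char_poly (isometry_group n J) - e1)"
    unfolding average_num_factors .
  have "(\<Sum>d=1..?D. ?A d * (w d)\<^sup>2 + ?M d * (w d)\<^sup>2) \<le> (\<Sum>d=1..?D. ?A d * (real d * (w d)\<^sup>2) + ?M d * (real (2 * d) * (w d)\<^sup>2))"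
  proof (intro sum_mono add_mono mult_left_mono)
    fix d assume d: "d \<in> {1..?D}"
    show "(w d)\<^sup>2 \<le> real d * (w d)\<^sup>2" "(w d)\<^sup>2 \<le> real (2 * d) * (w d)\<^sup>2"
      using d mult_right_mono[of 1 "real d" "(w d)\<^sup>2"] mult_right_mono[of 1 "real (2 * d)" "(w d)\<^sup>2"] by auto
  qed auto
  with quad have quad1: "(\<Sum>d=1..?D. ?A d * (w d)\<^sup>2 + ?M d * (w d)\<^sup>2) \<le> 6" by linarith
  have quad0: "0 \<le> (\<Sum>d=1..?D. ?A d * (w d)\<^sup>2 + ?M d * (w d)\<^sup>2)" by (intro sum_nonneg) simp
  show "\<bar>average num_factors_char_poly (isometry_group n J) - poly_weight TYPE('a) ?D\<bar> \<le> 400"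
    using s s_nonneg s_le quad1 quad0 e1 by linarith
qed

end


section \<open>Form matrices and asymptotics\<close>

text \<open>The sum over the field is invariant under x \<mapsto> x + 1, hence |F| * 1 = 0; if 2
  were 0, an odd |F| would give 1 = 0.\<close>

lemma two_neq_zero_of_odd_card:
  assumes "odd CARD('a :: {field, finite})"
  shows "(2 :: 'a) \<noteq> 0"
proof
  assume two: "(2 :: 'a) = 0"
  have "(\<Sum>x\<in>UNIV. x) = (\<Sum>x\<in>UNIV. x + 1 :: 'a)"
    by (rule sum.reindex_bij_witness[of _ "\<lambda>x. x + 1" "\<lambda>x. x - 1"]) auto
  then have card0: "of_nat CARD('a) = (0 :: 'a)" by (simp add: sum.distrib)
  obtain j where "CARD('a) = 2 * j + 1" using assms by (elim oddE)
  then have "of_nat CARD('a) = 2 * of_nat j + (1 :: 'a)" by simp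
  with two card0 show False by simp
qed

text \<open>All the form matrices considered have exactly one non-zero entry in each row, placed by
  an involution \<open>\<sigma>\<close>: swapped pairs for hyperbolic planes, fixed points for
  diagonal entries. Symmetry and non-degeneracy are read off from this shape.\<close>

lemma orthogonal_mat_monomial:
  fixes J :: "'a :: {field, finite} mat"
  assumes J: "J \<in> carrier_mat n n" and two: "(2 :: 'a) \<noteq> 0"
    and \<sigma>: "\<And>i. i < n \<Longrightarrow> \<sigma> i < n \<and> \<sigma> (\<sigma> i) = i"
    and c: "\<And>i. i < n \<Longrightarrow> c i \<noteq> 0 \<and> c (\<sigma> i) = c i"
    and entry: "\<And>i j. i < n \<Longrightarrow> j < n \<Longrightarrow> J $$ (i, j) = (if j = \<sigma> i then c i else 0)"
  shows "orthogonal_mat n J"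
proof
  show "J $$ (i, j) = J $$ (j, i)" if "i < n" "j < n" for i j
    using that entry \<sigma> c by metis
  show "v = 0\<^sub>v n" if v: "v \<in> carrier_vec n" "J *\<^sub>v v = 0\<^sub>v n" for v
  proof (rule eq_vecI)
    fix j assume "j < dim_vec (0\<^sub>v n :: 'a vec)"
    then have j: "j < n" by simp
    let ?i = "\<sigma> j"
    have i: "?i < n" "\<sigma> ?i = j" using \<sigma>[OF j] by auto
    have "(J *\<^sub>v v) $ ?i = (\<Sum>k\<in>{0..<n}. J $$ (?i, k) * v $ k)"
      using i J v(1) by (simp add: scalar_prod_def)
    also have "\<dots> = (\<Sum>k\<in>{0..<n}. if k = j then c ?i * v $ j else 0)"
      using entry[OF i(1)] i by (intro sum.cong) auto
    also have "\<dots> = c ?i * v $ j" using j by simp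
    finally show "v $ j = 0\<^sub>v n $ j" using v(2) i(1) j c[OF i(1)] by simp
  qed (use v in simp)
qed (use J two in auto)

definition hyp_swap :: "nat \<Rightarrow> nat \<Rightarrow> nat" where
  "hyp_swap l i = (if i < l then i + l else i - l)"

lemma hyp_swap: "i < 2 * l \<Longrightarrow> hyp_swap l i < 2 * l \<and> hyp_swap l (hyp_swap l i) = i"
  by (auto simp: hyp_swap_def)

lemma hyperbolic_mat_carrier: "hyperbolic_mat l \<in> carrier_mat (2 * l) (2 * l)"
  by (simp add: hyperbolic_mat_def mult_2)

lemma hyperbolic_mat_entry:
  "i < 2 * l \<Longrightarrow> j < 2 * l \<Longrightarrow> hyperbolic_mat l $$ (i, j) = (if j = hyp_swap l i then 1 else 0)"
  by (auto simp: hyperbolic_mat_def hyp_swap_def)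

lemma diag_block_mat_two:
  "diag_block_mat [A, B] = four_block_mat A (0\<^sub>m (dim_row A) (dim_col B)) (0\<^sub>m (dim_row B) (dim_col A)) B"
  by (subst diag_block_mat.simps(2)) (simp only: Let_def diag_block_mat_singleton)

lemma orthogonal_mat_scaled_plus:
  fixes e :: "'a :: {field, finite}"
  assumes two: "(2 :: 'a) \<noteq> 0" and e: "e \<noteq> 0"
  shows "orthogonal_mat n (e \<cdot>\<^sub>m plus_form_mat n)"
proof (cases "odd n")
  case False
  then obtain l where n: "n = 2 * l" by blast
  then have eq: "plus_form_mat n = (hyperbolic_mat l :: 'a mat)" by (simp add: plus_form_mat_def)
  have H: "(hyperbolic_mat l :: 'a mat) \<in> carrier_mat n n" using hyperbolic_mat_carrier n by simp
  show ?thesis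
    unfolding eq
  proof (rule orthogonal_mat_monomial[where \<sigma> = "hyp_swap l" and c = "\<lambda>_. e"])
    show "(e \<cdot>\<^sub>m hyperbolic_mat l) $$ (i, j) = (if j = hyp_swap l i then e else 0)" if "i < n" "j < n" for i j
      using that carrier_matD[OF H] hyperbolic_mat_entry[of i l j, where 'a = 'a] by (simp add: n)
  qed (use two e H hyp_swap n in auto)
next
  case True
  then obtain l where n: "n = 2 * l + 1" by (elim oddE)
  let ?H = "hyperbolic_mat l :: 'a mat"
  let ?\<sigma> = "\<lambda>i. if i = 0 then 0 else 1 + hyp_swap l (i - 1)"
  have eq: "plus_form_mat n = four_block_mat (1\<^sub>m 1) (0\<^sub>m 1 (2 * l)) (0\<^sub>m (2 * l) 1) ?H"
    using True n hyperbolic_mat_carrier[of l, where 'a = 'a]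
    unfolding plus_form_mat_def diag_block_mat_two by simp
  have H: "?H \<in> carrier_mat (2 * l) (2 * l)" by (rule hyperbolic_mat_carrier)
  show ?thesis
  proof (rule orthogonal_mat_monomial[where \<sigma> = ?\<sigma> and c = "\<lambda>_. e"])
    show "e \<cdot>\<^sub>m plus_form_mat n \<in> carrier_mat n n" unfolding eq using H n by auto
    show "?\<sigma> i < n \<and> ?\<sigma> (?\<sigma> i) = i" if "i < n" for i
      using that hyp_swap[of "i - 1" l] n by auto
    show "(e \<cdot>\<^sub>m plus_form_mat n) $$ (i, j) = (if j = ?\<sigma> i then e else 0)" if ij: "i < n" "j < n" for i j
    proof -
      have "plus_form_mat n $$ (i, j) = (if j = ?\<sigma> i then 1 else 0 :: 'a)"
        unfolding eq using ij n H hyperbolic_mat_entry[of "i - 1" l "j - 1", where 'a = 'a] by auto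
      moreover have "(plus_form_mat n :: 'a mat) \<in> carrier_mat n n" unfolding eq using H n by auto
      ultimately show ?thesis using ij by (auto split: if_splits)
    qed
  qed (use two e in auto)
qed

lemma orthogonal_mat_plus:
  assumes "(2 :: 'a :: {field, finite}) \<noteq> 0"
  shows "orthogonal_mat n (plus_form_mat n :: 'a mat)"
proof -
  have "1 \<cdot>\<^sub>m plus_form_mat n = (plus_form_mat n :: 'a mat)" by (intro eq_matI) auto
  then show ?thesis using orthogonal_mat_scaled_plus[OF assms, of 1 n] by simp
qed

lemma orthogonal_mat_minus:
  fixes \<delta> :: "'a :: {field, finite}"
  assumes two: "(2 :: 'a) \<noteq> 0" and \<delta>: "\<delta> \<noteq> 0" and n: "1 \<le> n"
  shows "orthogonal_mat n (minus_form_mat \<delta> n)"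
proof (cases "odd n")
  case True
  then show ?thesis using orthogonal_mat_scaled_plus[OF two \<delta>, of n] by (simp add: minus_form_mat_def)
next
  case False
  define l where "l = n div 2 - 1"
  have nl: "n = 2 * l + 2" using False n by (auto simp: l_def)
  let ?H = "hyperbolic_mat l :: 'a mat"
  let ?E = "mat_of_rows_list 2 [[1, 0], [0, - \<delta>]] :: 'a mat"
  let ?\<sigma> = "\<lambda>i. if i < 2 * l then hyp_swap l i else i"
  let ?c = "\<lambda>i. if i = 2 * l + 1 then - \<delta> else 1"
  have H: "?H \<in> carrier_mat (2 * l) (2 * l)" by (rule hyperbolic_mat_carrier)
  have E: "?E \<in> carrier_mat 2 2" unfolding mat_of_rows_list_def carrier_mat_def by simp
  have Ee: "?E $$ (i, j) = (if i = j then if i = 1 then - \<delta> else 1 else 0)" if "i < 2" "j < 2" for i j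
    using that by (auto simp: mat_of_rows_list_def less_2_cases_iff)
  have eq: "minus_form_mat \<delta> n = four_block_mat ?H (0\<^sub>m (2 * l) 2) (0\<^sub>m 2 (2 * l)) ?E"
    using False H E unfolding minus_form_mat_def diag_block_mat_two l_def[symmetric] by simp
  show ?thesis
  proof (rule orthogonal_mat_monomial[where \<sigma> = ?\<sigma> and c = ?c])
    show "minus_form_mat \<delta> n \<in> carrier_mat n n" unfolding eq using H E nl by auto
    show "?\<sigma> i < n \<and> ?\<sigma> (?\<sigma> i) = i" if "i < n" for i
      using that hyp_swap[of i l] nl by auto
    show "?c i \<noteq> 0 \<and> ?c (?\<sigma> i) = ?c i" if "i < n" for i
      using that hyp_swap[of i l] \<delta> by auto
    show "minus_form_mat \<delta> n $$ (i, j) = (if j = ?\<sigma> i then ?c i else 0)" if ij: "i < n" "j < n" for i j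
    proof -
      consider "i < 2 * l" "j < 2 * l" | "i < 2 * l" "2 * l \<le> j" | "2 * l \<le> i" "j < 2 * l" | "2 * l \<le> i" "2 * l \<le> j"
        by linarith
      then show ?thesis
      proof cases
        case 1
        then show ?thesis unfolding eq using H E by (simp add: hyperbolic_mat_entry)
      next
        case 2
        then show ?thesis unfolding eq using H E ij nl hyp_swap[of i l] by auto
      next
        case 3
        then show ?thesis unfolding eq using H E ij nl by auto
      next
        case 4
        then have lt: "i - 2 * l < 2" "j - 2 * l < 2" using ij nl by auto
        have "minus_form_mat \<delta> n $$ (i, j) = ?E $$ (i - 2 * l, j - 2 * l)"
          unfolding eq using 4 carrier_matD[OF H] carrier_matD[OF E] ij nl by simp
        moreover have "i - 2 * l = j - 2 * l \<longleftrightarrow> j = i" "i - 2 * l = 1 \<longleftrightarrow> i = 2 * l + 1" using 4 by linarith+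
        ultimately show ?thesis using 4 unfolding Ee[OF lt] by simp
      qed
    qed
  qed (use two in auto)
qed

text \<open>Both degree-weighted counts are n + O(1), so partial summation turns each into a
  harmonic sum. The bound 150 covers 23 + 200 / 2 + 3 / 2.\<close>

lemma poly_weight_asymptotics:
  assumes two: "(2 :: 'a :: {field, finite}) \<noteq> 0" and D: "1 \<le> D"
  shows "\<bar>poly_weight TYPE('a) D - 3 / 2 * ln (real D)\<bar> \<le> 150"
proof -
  let ?q = "real CARD('a)"
  let ?a = "\<lambda>d. real d * real (card (nonself_polys d :: 'a poly set)) / ?q ^ d"
  let ?b = "\<lambda>d. 2 * real d * real (card (self_polys d :: 'a poly set)) / ?q ^ d"
  let ?h = "\<Sum>d=1..D. 1 / real d"
  have A: "\<bar>(\<Sum>d=1..n. ?a d) - real n\<bar> \<le> 23" for n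
    using sum_nonself_upper[of n, where 'a = 'a] sum_nonself_lower[OF two, of n] by linarith
  have Bm: "\<bar>(\<Sum>d=1..n. ?b d) - real n\<bar> \<le> 200" for n
  proof -
    \<comment> \<open>The lower bound for the self-reciprocal irreducibles comes from the orthogonal
      group of the hyperbolic form in dimension 2 * n: its degree identity bounds the sum of both
      counts from below, and the first count is at most n.\<close>
    interpret orthogonal_mat "2 * n" "plus_form_mat (2 * n) :: 'a mat" using two by (rule orthogonal_mat_plus)
    have "real (2 * n) - 200 \<le> (\<Sum>d=1..n. ?a d) + (\<Sum>d=1..n. ?b d)"
      using average_num_factors_bounds(2) by simp
    then show ?thesis
      using sum_nonself_self_upper[of n, where 'a = 'a] sum_nonself_upper[of n, where 'a = 'a] A[of n] by simp
  qed
  have SA: "\<bar>(\<Sum>d=1..D. ?a d / real d) - ?h\<bar> \<le> 23" by (rule sum_diff_harmonic_le) (rule A)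
  have SB: "\<bar>(\<Sum>d=1..D. ?b d / real d) - ?h\<bar> \<le> 200" by (rule sum_diff_harmonic_le) (rule Bm)
  \<comment> \<open>A self-reciprocal polynomial of index d has degree 2 * d but weight q ^ - d;
    hence the factor 1/2, and 1 + 1/2 = 3/2.\<close>
  have "poly_weight TYPE('a) D = (\<Sum>d=1..D. ?a d / real d) + 1 / 2 * (\<Sum>d=1..D. ?b d / real d)"
    unfolding poly_weight_def sum_distrib_left sum.distrib[symmetric]
    by (intro sum.cong refl) (simp add: add_divide_distrib)
  then show ?thesis using SA SB harmonic_ln_le[OF D] unfolding abs_le_iff by linarith
qed

theorem theorem24:
  fixes \<delta> :: "'a :: {field, finite}" and p k q :: nat
  assumes "prime p" and "odd p" and "k \<ge> 1" and "q = p ^ k"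
    and "CARD('a) = q"
    and "\<not> (\<exists>x. x\<^sup>2 = \<delta>)"
  shows "(\<lambda>n. mean_X \<delta> n - 3 / 2 * ln (real n)) \<in> O(\<lambda>n. 1)"
proof (rule bigoI)
  have "odd CARD('a)" using assms by simp
  then have two: "(2 :: 'a) \<noteq> 0" by (rule two_neq_zero_of_odd_card)
  have \<delta>: "\<delta> \<noteq> 0" using assms(6) by (metis zero_power2)
  \<comment> \<open>For n \<ge> 2 the minus form has size n and n \<le> 3 * (n div 2), so replacing
    n div 2 by n changes the logarithm by at most ln 3 \<le> 2. The errors add up to 400 + 150 +
    3.\<close>
  have "\<bar>mean_X \<delta> n - 3 / 2 * ln (real n)\<bar> \<le> 600" if n: "2 \<le> n" for n
  proof -
    let ?D = "n div 2"
    let ?W = "poly_weight TYPE('a) ?D"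
    interpret plus: orthogonal_mat n "plus_form_mat n :: 'a mat" using two by (rule orthogonal_mat_plus)
    interpret minus: orthogonal_mat n "minus_form_mat \<delta> n" using two \<delta> n by (intro orthogonal_mat_minus) auto
    have P: "\<bar>average num_factors_char_poly (O_plus n :: 'a mat set) - ?W\<bar> \<le> 400"
      unfolding O_plus_def by (rule plus.average_num_factors_bounds(1))
    have M: "\<bar>average num_factors_char_poly (O_minus \<delta> n) - ?W\<bar> \<le> 400"
      unfolding O_minus_def by (rule minus.average_num_factors_bounds(1))
    have "n \<le> 3 * ?D" using n by linarith
    then have "real n \<le> real (3 * ?D)" by (simp only: of_nat_le_iff)
    then have D: "1 \<le> ?D" "real ?D \<le> real n" "real n \<le> 3 * real ?D" using n by auto
    have W: "\<bar>?W - 3 / 2 * ln (real ?D)\<bar> \<le> 150" using two D(1) by (rule poly_weight_asymptotics)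
    have "ln (real ?D) \<le> ln (real n)" using D n by simp
    moreover have "ln (real n) \<le> ln (3 * real ?D)" using D n by simp
    moreover have "ln (3 * real ?D) = ln 3 + ln (real ?D)" using D by (simp add: ln_mult)
    moreover have "ln (3 :: real) \<le> 2" using ln_le_minus_one[of 3] by simp
    ultimately have L: "ln (real ?D) \<le> ln (real n)" "ln (real n) \<le> 2 + ln (real ?D)" by linarith+
    have "\<bar>1 / 2 * (a + b) - 3 / 2 * y\<bar> \<le> 600"
      if "\<bar>a - w\<bar> \<le> 400" "\<bar>b - w\<bar> \<le> 400" "\<bar>w - 3 / 2 * x\<bar> \<le> 150" "x \<le> y" "y \<le> 2 + x" for a b w x y :: real
    proof -
      have "a - w \<le> 400" "w - a \<le> 400" "b - w \<le> 400" "w - b \<le> 400" "w - 3 / 2 * x \<le> 150" "3 / 2 * x - w \<le> 150"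
        using that(1-3) by (simp_all add: abs_le_iff)
      with that(4,5) show ?thesis by (intro abs_leI) (simp_all add: field_simps)
    qed
    from this[OF P M W L] show ?thesis unfolding mean_X_def .
  qed
  then show "\<forall>\<^sub>F n in sequentially. norm (mean_X \<delta> n - 3 / 2 * ln (real n)) \<le> 600 * norm (1 :: real)"
    unfolding eventually_sequentially by (intro exI[of _ 2]) simp
qed

end
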